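(* Let $n\ge 4$ be an even integer and let $u\in C^\infty(\mathbb{R}^n)$ be such that the conformal metric $g=e^{2u}|dx|^2$ on $\mathbb{R}^n$ has finite total Q-curvature, with Q-curvature $Q$ and scalar curvature $R_g$. (1) If the negative part $R_g^-=\max\{-R_g,0\}$ satisfies $$\int_{\mathbb{R}^n}(R_g^-)^{\frac n2}e^{nu}\,dx<+\infty,$$ then $$0\le\int_{\mathbb{R}^n}Qe^{nu}\,dx\le(n-1)!\,|\mathbb{S}^n|.$$ (2) If $$\int_{\mathbb{R}^n}|R_g|^{\frac n2}e^{nu}\,dx<+\infty,$$ then $$\int_{\mathbb{R}^n}Qe^{nu}\,dx=0\quad\text{or}\quad\int_{\mathbb{R}^n}Qe^{nu}\,dx=(n-1)!\,|\mathbb{S}^n|.$$ Moreover, if in addition the volume is finite, i.e. $e^{nu}\in L^1(\mathbb{R}^n)$, then $$\int_{\mathbb{R}^n}Qe^{nu}\,dx=(n-1)!\,|\mathbb{S}^n|.$$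
   Context: For a smooth function $u$ on $\mathbb{R}^n$ ($n\ge4$ even) and $g=e^{2u}|dx|^2$ (with $|dx|^2$ the Euclidean metric), the Q-curvature $Q$ of $g$ is the function defined by $(-\Delta)^{n/2}u=Qe^{nu}$, where $\Delta$ is the Euclidean Laplacian. The metric has finite total Q-curvature if $Qe^{nu}\in L^1(\mathbb{R}^n)$. The scalar curvature of $g$ is $R_g=2(n-1)e^{-2u}\left(-\Delta u-\frac{n-2}{2}|\nabla u|^2\right)$. $|\mathbb{S}^n|$ is the volume of the standard unit $n$-sphere. *)

theory Defs
  imports "HOL-Analysis.Analysis"
begin

definition partial_deriv :: "'a::euclidean_space \<Rightarrow> ('a \<Rightarrow> real) \<Rightarrow> 'a \<Rightarrow> real" where
  "partial_deriv v f x = frechet_derivative f (at x) v"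

text \<open>
  The function \<^term>\<open>partial_deriv v f\<close> is only meaningful where \<^term>\<open>f\<close> is differentiable,
  so differentiability is demanded at every stage of the recursion.
\<close>

fun k_times_cont_diff :: "nat \<Rightarrow> ('a::euclidean_space \<Rightarrow> real) \<Rightarrow> bool" where
  "k_times_cont_diff 0 f \<longleftrightarrow> continuous_on UNIV f"
| "k_times_cont_diff (Suc k) f \<longleftrightarrow>
     (\<forall>x. f differentiable (at x)) \<and> (\<forall>b\<in>Basis. k_times_cont_diff k (partial_deriv b f))"

definition smooth :: "('a::euclidean_space \<Rightarrow> real) \<Rightarrow> bool" where
  "smooth f \<longleftrightarrow> (\<forall>k. k_times_cont_diff k f)"

definition gradient :: "('a::euclidean_space \<Rightarrow> real) \<Rightarrow> 'a \<Rightarrow> 'a" where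
  "gradient f x = (\<Sum>b\<in>Basis. partial_deriv b f x *\<^sub>R b)"

definition laplacian :: "('a::euclidean_space \<Rightarrow> real) \<Rightarrow> 'a \<Rightarrow> real" where
  "laplacian f x = (\<Sum>b\<in>Basis. partial_deriv b (partial_deriv b f) x)"

definition neg_laplacian :: "('a::euclidean_space \<Rightarrow> real) \<Rightarrow> 'a \<Rightarrow> real" where
  "neg_laplacian f x = - laplacian f x"

text \<open>
  Curvatures of the conformal metric with factor \<open>exp (2 * u)\<close> on Euclidean space of even
  dimension. The defining equation determines \<open>Q\<close> uniquely, as \<open>exp\<close> never vanishes.
\<close>

definition is_Q_curvature :: "('a::euclidean_space \<Rightarrow> real) \<Rightarrow> ('a \<Rightarrow> real) \<Rightarrow> bool" where
  "is_Q_curvature u Q \<longleftrightarrow>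
     (\<forall>x. (neg_laplacian ^^ (DIM('a) div 2)) u x = Q x * exp (real DIM('a) * u x))"

definition scalar_curvature :: "('a::euclidean_space \<Rightarrow> real) \<Rightarrow> 'a \<Rightarrow> real" where
  "scalar_curvature u x =
     2 * (real DIM('a) - 1) * exp (- 2 * u x) *
       (- laplacian u x - (real DIM('a) - 2) / 2 * (norm (gradient u x))\<^sup>2)"

text \<open>
  The surface measure on the unit sphere of a Euclidean space of dimension \<open>d\<close>, normalised as in
  the polar coordinate formula: \<open>d\<close> times the Lebesgue measure of the cone over \<open>A\<close>. This is the
  Riemannian volume of the round metric.
\<close>

definition sphere_surface_measure :: "'a::euclidean_space set \<Rightarrow> real" where
  "sphere_surface_measure A =
     real DIM('a) * measure lborel {r *\<^sub>R x | r x. 0 < r \<and> r \<le> 1 \<and> x \<in> A}"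

text \<open>
  The unit sphere of dimension \<open>CARD('n)\<close> lives in a space of dimension \<open>CARD('n) + 1\<close>, for which
  we take \<^typ>\<open>(real ^ 'n) \<times> real\<close> with its Euclidean norm.
\<close>

definition unit_sphere_volume :: "'n::finite itself \<Rightarrow> real" where
  "unit_sphere_volume _ = sphere_surface_measure (sphere (0 :: (real ^ 'n) \<times> real) 1)"

lemma unit_sphere_volume_eq:
  "unit_sphere_volume TYPE('n::finite) =
     2 * pi powr ((real CARD('n) + 1) / 2) / Gamma ((real CARD('n) + 1) / 2)"
proof -
  let ?S = "sphere (0 :: (real ^ 'n) \<times> real) 1"
  let ?d = "real CARD('n) + 1"
  have cone: "{r *\<^sub>R x | r x. 0 < r \<and> r \<le> 1 \<and> x \<in> ?S} = cball 0 1 - {0}"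
  proof (intro equalityI subsetI)
    fix y assume "y \<in> {r *\<^sub>R x | r x. 0 < r \<and> r \<le> 1 \<and> x \<in> ?S}"
    then obtain r x where "y = r *\<^sub>R x" "0 < r" "r \<le> 1" "norm x = 1" by auto
    then show "y \<in> cball 0 1 - {0}" by auto
  next
    fix y :: "(real ^ 'n) \<times> real" assume y: "y \<in> cball 0 1 - {0}"
    have "y = norm y *\<^sub>R (y /\<^sub>R norm y)" "0 < norm y" "norm y \<le> 1" "y /\<^sub>R norm y \<in> ?S"
      using y by auto
    then show "y \<in> {r *\<^sub>R x | r x. 0 < r \<and> r \<le> 1 \<and> x \<in> ?S}" by blast
  qed
  have "measure lborel (cball (0 :: (real ^ 'n) \<times> real) 1 - {0}) =
        measure lborel (cball (0 :: (real ^ 'n) \<times> real) 1)"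
    by (rule measure_Diff_null_set) auto
  also have "\<dots> = unit_ball_vol ?d"
    using content_cball[of 1 "0 :: (real ^ 'n) \<times> real"] by (simp add: add.commute)
  finally have "unit_sphere_volume TYPE('n) = ?d * unit_ball_vol ?d"
    unfolding unit_sphere_volume_def sphere_surface_measure_def cone by simp
  moreover have "Gamma (?d / 2 + 1) = ?d / 2 * Gamma (?d / 2)"
    by (rule Gamma_plus1) (auto simp: nonpos_Ints_def)
  moreover have "d * (P / (d / 2 * G)) = 2 * P / G" if "d > 0" for d P G :: real
    using that by simp
  ultimately show ?thesis
    by (simp only: unit_ball_vol_def)
qed

end

(*
  In terms of k = Lap u + (n-2)/2 |grad u|^2 the hypotheses say that the positive part of k, respectively
  |k|, lies in L^(n/2); this norm is invariant under dilations.

  Put f = (-Lap)^(n/2) u and alpha = 2 (int f) / ((n-1)! |S^n|). Testing the upper bound on k against a cutoff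
  gives a Caccioppoli estimate: the Dirichlet integral of u over the ball of radius R is O(R^(n-2)).
  Averaging a partial derivative of u against the dilates of a compactly supported radial profile whose
  dilation derivative is (-Lap)^(n/2) of a dilated bump, and letting the dilation parameter run from 0 to
  infinity, then yields without any regularity theory
      grad u (x) = - 2 / ((n-1)! |S^n|) int f(y) (x-y) / |x-y|^2 dy;
  the constant is the mass of the profile.

  By Cauchy-Schwarz, R grad u (R w) converges to - alpha w / |w|^2 in L^2 of the unit ball, so the rescaled
  averages of k against a fixed nonnegative weight converge to a positive multiple of alpha^2 - 2 alpha. The
  averages of a function in L^(n/2) tend to 0 at this scale. Hence alpha^2 - 2 alpha is nonpositive in (1)
  and zero in (2). If alpha = 0, the averages of u over large balls decrease more slowly than (1/2) ln R,
  and Jensen's inequality makes the volume infinite.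
*)

theory Submission
  imports Defs
begin

section \<open>Differentiation and integration by parts\<close>

text \<open>The quadratic comes from the model u = -\<alpha> ln |x|, for which k = (n-2)/2
  (\<alpha>^2 - 2 \<alpha>) / |x|^2; \<alpha> = 2 is the decay of the round sphere. The obstacle is
  that f is merely integrable, so grad u need have no pointwise asymptotics. L^2 convergence of its
  dilates suffices, because after one integration by parts an average of k is quadratic plus linear
  in grad u. For that convergence one more power of the inverse distance than the squared kernel has
  is spent to gain a factor |y| / R, and |x|^-3 is locally integrable since n >= 4. Subtracting a
  logarithmic potential from u would leave a polynomial to be excluded by a Liouville theorem. The
  averages avoid this: their term at infinity is a mean of grad u at scale R, which is O(1/R) by the
  energy estimate. Test functions are truncated powers in s = |x|^2. The radial Laplacian then reads
  4 s F'' + 2 n F', which is regular at the origin, and all constants are moments on [0, 1].\<close>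

definition bounded_support :: "('a::real_normed_vector \<Rightarrow> real) \<Rightarrow> bool" where
  "bounded_support h \<longleftrightarrow> (\<exists>r. \<forall>x. r < norm x \<longrightarrow> h x = 0)"

abbreviation C1 :: "('a::euclidean_space \<Rightarrow> real) \<Rightarrow> bool" where
  "C1 \<equiv> k_times_cont_diff (Suc 0)"

abbreviation C2 :: "('a::euclidean_space \<Rightarrow> real) \<Rightarrow> bool" where
  "C2 \<equiv> k_times_cont_diff (Suc (Suc 0))"

section \<open>Calculus of the classes \<open>C1\<close> and \<open>C2\<close>\<close>

lemma partial_deriv_eqI: "(f has_derivative f') (at x) \<Longrightarrow> partial_deriv b f x = f' b"
  unfolding partial_deriv_def using frechet_derivative_at by metis

lemma k_times_cont_diff_cont: "k_times_cont_diff k f \<Longrightarrow> continuous_on UNIV f"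
  by (cases k) (auto intro!: differentiable_imp_continuous_on simp: differentiable_on_def)

lemma k_times_cont_diff_Suc: "k_times_cont_diff (Suc k) f \<Longrightarrow> k_times_cont_diff k f"
proof (induction k arbitrary: f)
  case 0
  then show ?case using k_times_cont_diff_cont by fastforce
next
  case (Suc k)
  have "(\<forall>x. f differentiable (at x)) \<and> (\<forall>b\<in>Basis. k_times_cont_diff (Suc k) (partial_deriv b f))"
    using Suc.prems by simp
  with Suc.IH show ?case unfolding k_times_cont_diff.simps(2)[of k f] by blast
qed

lemma C1_iff: "C1 f \<longleftrightarrow> (\<forall>x. f differentiable (at x)) \<and> (\<forall>b\<in>Basis. continuous_on UNIV (partial_deriv b f))"
  by simp

lemma C2_iff: "C2 f \<longleftrightarrow> (\<forall>x. f differentiable (at x)) \<and> (\<forall>b\<in>Basis. C1 (partial_deriv b f))"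
  by simp

lemma C2_C1: "C2 f \<Longrightarrow> C1 f"
  by (rule k_times_cont_diff_Suc)

lemma C1_differentiable: "C1 f \<Longrightarrow> f differentiable (at x)"
  and C1_cont: "C1 f \<Longrightarrow> continuous_on UNIV f"
  and C1_cont_partial: "C1 f \<Longrightarrow> b \<in> Basis \<Longrightarrow> continuous_on UNIV (partial_deriv b f)"
  and C2_partial: "C2 f \<Longrightarrow> b \<in> Basis \<Longrightarrow> C1 (partial_deriv b f)"
  using k_times_cont_diff_cont[of "Suc 0" f] by (auto simp: C2_iff)

text \<open>As simplification rules these equations would dissolve the abbreviations
  \<open>C1\<close> and \<open>C2\<close>, which are instances of the recursive predicate.\<close>

declare k_times_cont_diff.simps [simp del]

lemma smooth_C1: "smooth f \<Longrightarrow> C1 f" and smooth_C2: "smooth f \<Longrightarrow> C2 f"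
  by (auto simp: smooth_def)

lemma smooth_partial: "smooth f \<Longrightarrow> b \<in> Basis \<Longrightarrow> smooth (partial_deriv b f)"
  unfolding smooth_def by (metis k_times_cont_diff.simps(2))

lemma partial_deriv_sum:
  assumes "\<And>i x. i \<in> I \<Longrightarrow> f i differentiable (at x)"
  shows "partial_deriv b (\<lambda>x. \<Sum>i\<in>I. c i * f i x) = (\<lambda>x. \<Sum>i\<in>I. c i * partial_deriv b (f i) x)"
proof
  fix x
  have "((\<lambda>x. \<Sum>i\<in>I. c i * f i x) has_derivative (\<lambda>h. \<Sum>i\<in>I. c i * frechet_derivative (f i) (at x) h)) (at x)"
    by (intro has_derivative_sum has_derivative_mult_right)
       (use assms frechet_derivative_works in blast)
  from partial_deriv_eqI[OF this] show "partial_deriv b (\<lambda>x. \<Sum>i\<in>I. c i * f i x) x = (\<Sum>i\<in>I. c i * partial_deriv b (f i) x)"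
    by (simp add: partial_deriv_def)
qed

lemma k_times_cont_diff_sum:
  assumes "\<And>i. i \<in> I \<Longrightarrow> k_times_cont_diff k (f i)"
  shows "k_times_cont_diff k (\<lambda>x. \<Sum>i\<in>I. c i * f i x)"
  using assms
proof (induction k arbitrary: f)
  case 0
  then show ?case by (auto intro!: continuous_intros simp: k_times_cont_diff.simps(1))
next
  case (Suc k)
  note [simp] = k_times_cont_diff.simps(2)
  have d: "\<And>i x. i \<in> I \<Longrightarrow> f i differentiable (at x)" using Suc.prems by simp
  then have "(\<lambda>x. \<Sum>i\<in>I. c i * f i x) differentiable (at x)" for x
  proof (cases "finite I")
    case True
    then show ?thesis using d by (intro differentiable_sum) auto
  qed auto
  moreover have "k_times_cont_diff k (\<lambda>x. \<Sum>i\<in>I. c i * partial_deriv b (f i) x)" if "b \<in> Basis" for b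
    using Suc.prems that by (intro Suc.IH) auto
  ultimately show ?case using d by (simp add: partial_deriv_sum)
qed

text \<open>The factor (-1) makes the operator an instance of the linear combinations treated in
  \<open>k_times_cont_diff_sum\<close> and \<open>partial_deriv_sum\<close>.\<close>

lemma neg_laplacian_sum: "neg_laplacian f = (\<lambda>x. \<Sum>b\<in>Basis. (-1) * partial_deriv b (partial_deriv b f) x)"
  by (auto simp: neg_laplacian_def laplacian_def sum_negf)

lemma smooth_neg_laplacian: "smooth f \<Longrightarrow> smooth (neg_laplacian f)"
  unfolding neg_laplacian_sum smooth_def[of "\<lambda>x. sum (f x) A" for f A]
  by (intro allI k_times_cont_diff_sum) (use smooth_partial smooth_def in blast)

lemma smooth_neg_laplacian_pow: "smooth f \<Longrightarrow> smooth ((neg_laplacian ^^ k) f)"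
  by (induction k) (auto intro: smooth_neg_laplacian)

lemma has_derivative_C1:
  assumes "C1 f"
  shows "(f has_derivative (\<lambda>h. gradient f x \<bullet> h)) (at x)"
proof -
  let ?D = "frechet_derivative f (at x)"
  have D: "(f has_derivative ?D) (at x)"
    using assms frechet_derivative_works C1_differentiable by blast
  then interpret bounded_linear ?D by (rule has_derivative_bounded_linear)
  have "?D h = gradient f x \<bullet> h" for h
  proof -
    have "?D h = ?D (\<Sum>b\<in>Basis. (h \<bullet> b) *\<^sub>R b)" by (simp add: euclidean_representation)
    also have "\<dots> = (\<Sum>b\<in>Basis. (h \<bullet> b) * ?D b)" by (simp add: sum scaleR)
    also have "\<dots> = gradient f x \<bullet> h"
      by (simp add: gradient_def partial_deriv_def inner_sum_left inner_commute[of h] mult.commute)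
    finally show ?thesis .
  qed
  then have "?D = (\<lambda>h. gradient f x \<bullet> h)" by auto
  with D show ?thesis by simp
qed

lemma gradient_inner_Basis: "b \<in> Basis \<Longrightarrow> gradient f x \<bullet> b = partial_deriv b f x"
  by (simp add: gradient_def inner_sum_left inner_Basis if_distrib cong: if_cong)

lemma inner_gradient: "gradient f x \<bullet> gradient g x = (\<Sum>b\<in>Basis. partial_deriv b f x * partial_deriv b g x)"
  unfolding euclidean_inner[of "gradient f x" "gradient g x"] by (simp add: gradient_inner_Basis)

lemma continuous_on_gradient: "C1 f \<Longrightarrow> continuous_on UNIV (gradient f)"
  unfolding gradient_def by (auto intro!: continuous_intros C1_cont_partial)

lemma partial_deriv_mult:
  assumes "C1 f" "C1 g"
  shows "partial_deriv b (\<lambda>x. f x * g x) = (\<lambda>x. f x * partial_deriv b g x + partial_deriv b f x * g x)"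
proof
  fix x
  note d = has_derivative_C1[OF assms(1), of x] has_derivative_C1[OF assms(2), of x]
  show "partial_deriv b (\<lambda>x. f x * g x) x = f x * partial_deriv b g x + partial_deriv b f x * g x"
    using partial_deriv_eqI[OF has_derivative_mult[OF d]] d[THEN partial_deriv_eqI] by simp
qed

lemma C1_mult:
  assumes "C1 f" "C1 g"
  shows "C1 (\<lambda>x. f x * g x)"
  unfolding C1_iff partial_deriv_mult[OF assms]
  using assms[THEN C1_cont] assms[THEN C1_cont_partial] assms[THEN C1_differentiable]
  by (auto intro!: continuous_intros)

lemma has_real_derivative_line:
  assumes "C1 f"
  shows "((\<lambda>t. f (x + t *\<^sub>R h)) has_real_derivative gradient f (x + t *\<^sub>R h) \<bullet> h) (at t)"
proof -
  have "((\<lambda>t. x + t *\<^sub>R h) has_derivative (\<lambda>s. s *\<^sub>R h)) (at t)"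
    by (auto intro!: derivative_eq_intros)
  from has_derivative_compose[OF this has_derivative_C1[OF assms]]
  show ?thesis by (simp add: has_field_derivative_def mult.commute[of _ "_ \<bullet> _"])
qed

section \<open>Functions of bounded support\<close>

lemma bounded_supportI: "(\<And>x. r < norm x \<Longrightarrow> h x = 0) \<Longrightarrow> bounded_support h"
  unfolding bounded_support_def by blast

lemma bounded_support_mult:
  "bounded_support f \<Longrightarrow> bounded_support (\<lambda>x. f x * g x)"
  "bounded_support f \<Longrightarrow> bounded_support (\<lambda>x. g x * f x)"
  unfolding bounded_support_def by auto

lemma bounded_support_partial:
  assumes "bounded_support f"
  shows "bounded_support (partial_deriv b f)"
proof -
  obtain r where r: "\<And>x. r < norm x \<Longrightarrow> f x = 0" using assms by (auto simp: bounded_support_def)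
  have "partial_deriv b f x = 0" if "r < norm x" for x
  proof -
    have "open {x::'a. r < norm x}"
      by (intro open_Collect_less continuous_intros)
    from has_derivative_transform_within_open[OF has_derivative_const this, of x 0 f]
    have "(f has_derivative (\<lambda>h. 0)) (at x)"
      using that r by auto
    then show ?thesis by (rule partial_deriv_eqI)
  qed
  then show ?thesis by (rule bounded_supportI)
qed

lemma bounded_support_add:
  "bounded_support f \<Longrightarrow> bounded_support g \<Longrightarrow> bounded_support (\<lambda>x. f x + g x)"
proof -
  assume "bounded_support f" "bounded_support g"
  then obtain r s where "\<And>x. r < norm x \<Longrightarrow> f x = 0" "\<And>x. s < norm x \<Longrightarrow> g x = 0"
    by (auto simp: bounded_support_def)
  then show ?thesis by (intro bounded_supportI[of "max r s"]) auto
qed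

lemma bounded_support_sum:
  "(\<And>i. i \<in> I \<Longrightarrow> bounded_support (f i)) \<Longrightarrow> bounded_support (\<lambda>x. \<Sum>i\<in>I. f i x)"
proof (induction I rule: infinite_finite_induct)
  case (insert i I)
  then have "bounded_support (\<lambda>x. f i x + (\<Sum>i\<in>I. f i x))"
    by (intro bounded_support_add) auto
  with insert show ?case by simp
qed (auto simp: bounded_support_def)

lemma integrable_bounded_support:
  fixes f :: "'a::euclidean_space \<Rightarrow> real"
  assumes "bounded_support f" "continuous_on UNIV f"
  shows "integrable lborel f"
proof -
  obtain r where r: "\<And>x. r < norm x \<Longrightarrow> f x = 0" using assms by (auto simp: bounded_support_def)
  have "integrable lborel (\<lambda>x. indicator (cball 0 r) x *\<^sub>R f x)"
    by (intro borel_integrable_compact compact_cball continuous_on_subset[OF assms(2)]) auto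
  moreover have "(\<lambda>x. indicator (cball 0 r) x *\<^sub>R f x) = f"
    using r by (force simp: indicator_def)
  ultimately show ?thesis by simp
qed

lemma integrable_mult_bounded_support:
  fixes v \<psi> :: "'a::euclidean_space \<Rightarrow> real"
  assumes "bounded_support \<psi>" "continuous_on UNIV v" "continuous_on UNIV \<psi>"
  shows "integrable lborel (\<lambda>x. v x * \<psi> x)"
  using assms by (intro integrable_bounded_support bounded_support_mult continuous_on_mult)

lemma cont_borel_measurable:
  "continuous_on UNIV f \<Longrightarrow> f \<in> borel_measurable borel"
  by (rule borel_measurable_continuous_onI)

section \<open>Change of variables and integration by parts\<close>

lemma lborel_scale:
  fixes h :: "'a::euclidean_space \<Rightarrow> real"
  assumes "c > 0" and [measurable]: "h \<in> borel_measurable borel"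
  shows "integrable lborel (\<lambda>x. h (t + c *\<^sub>R x)) \<longleftrightarrow> integrable lborel h"
    and "(LBINT x. h x) = c ^ DIM('a) * (LBINT x. h (t + c *\<^sub>R x))"
    and "(\<integral>\<^sup>+x. ennreal (h x) \<partial>lborel) = ennreal (c ^ DIM('a)) * (\<integral>\<^sup>+x. ennreal (h (t + c *\<^sub>R x)) \<partial>lborel)"
proof -
  have c: "\<bar>c\<bar> = c" "0 \<le> c ^ DIM('a)" "c ^ DIM('a) \<noteq> 0" using assms by auto
  have L: "lborel = density (distr lborel borel (\<lambda>x. t + c *\<^sub>R x)) (\<lambda>_. ennreal (c ^ DIM('a)))"
    using lborel_affine[of c t] assms c by (simp add: ennreal_power)
  show "integrable lborel (\<lambda>x. h (t + c *\<^sub>R x)) \<longleftrightarrow> integrable lborel h"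
    apply (subst (2) L)
    using c by (subst integrable_density) (auto simp: integrable_distr_eq)
  show "(LBINT x. h x) = c ^ DIM('a) * (LBINT x. h (t + c *\<^sub>R x))"
    apply (subst L)
    using c by (subst integral_density) (auto simp: integral_distr)
  show "(\<integral>\<^sup>+x. ennreal (h x) \<partial>lborel) = ennreal (c ^ DIM('a)) * (\<integral>\<^sup>+x. ennreal (h (t + c *\<^sub>R x)) \<partial>lborel)"
    apply (subst L)
    using c by (subst nn_integral_density) (auto simp: nn_integral_distr nn_integral_cmult)
qed

text \<open>Translation invariance makes every difference quotient of \<open>h\<close> in direction
  \<open>b\<close> integrate to zero, and dominated convergence passes this to the derivative. No
  iterated integration over coordinates is involved.\<close>

lemma integral_partial_deriv_zero:
  fixes h :: "'a::euclidean_space \<Rightarrow> real"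
  assumes h: "C1 h" and supp: "bounded_support h" and b: "b \<in> Basis"
  shows "(LBINT x. partial_deriv b h x) = 0"
proof -
  obtain r where r: "\<And>x. r < norm x \<Longrightarrow> h x = 0" using supp by (auto simp: bounded_support_def)
  have ch: "continuous_on UNIV h" using h by (rule C1_cont)
  then have [measurable]: "h \<in> borel_measurable borel" by (rule cont_borel_measurable)
  have cp: "continuous_on UNIV (partial_deriv b h)" using h b by (rule C1_cont_partial)
  then have [measurable]: "partial_deriv b h \<in> borel_measurable borel" by (rule cont_borel_measurable)
  \<comment> \<open>Steps have length at most 1, so the quotients vanish outside radius |r| + 1, and
    the mean value points stay within |r| + 2.\<close>
  define K where "K = cball (0::'a) (\<bar>r\<bar> + 2)"
  have "compact (partial_deriv b h ` K)"
    unfolding K_def by (intro compact_continuous_image continuous_on_subset[OF cp] compact_cball) auto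
  then obtain C where C: "\<And>x. x \<in> K \<Longrightarrow> \<bar>partial_deriv b h x\<bar> \<le> C"
    using compact_imp_bounded bounded_iff by (metis imageI real_norm_def)
  have C0: "0 \<le> C" using C[of 0] by (force simp: K_def)
  define q where "q = (\<lambda>n x. (h (x + inverse (real (Suc n)) *\<^sub>R b) - h x) * real (Suc n))"
  have ih: "integrable lborel h" using supp ch by (rule integrable_bounded_support)
  have z: "(LBINT x. q n x) = 0" for n
  proof -
    let ?t = "inverse (real (Suc n)) *\<^sub>R b"
    have "integrable lborel (\<lambda>x. h (x + ?t))" "(LBINT x. h (x + ?t)) = (LBINT x. h x)"
      using lborel_scale(1)[of 1 h ?t] lborel_scale(2)[of 1 h ?t] ih by (auto simp: add.commute)
    then show ?thesis unfolding q_def using ih by simp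
  qed
  have "(\<lambda>n. LBINT x. q n x) \<longlonglongrightarrow> (LBINT x. partial_deriv b h x)"
  proof (rule integral_dominated_convergence)
    show "integrable lborel (\<lambda>x. indicator K x *\<^sub>R C)"
      unfolding K_def by (intro borel_integrable_compact) auto
    show "AE x in lborel. (\<lambda>n. q n x) \<longlonglongrightarrow> partial_deriv b h x"
    proof (rule AE_I2)
      fix x
      have "((\<lambda>t. h (x + t *\<^sub>R b)) has_real_derivative partial_deriv b h x) (at 0)"
        using has_real_derivative_line[OF h, of x b 0] b by (simp add: gradient_inner_Basis)
      then have *: "((\<lambda>t. (h (x + t *\<^sub>R b) - h x) / t) \<longlongrightarrow> partial_deriv b h x) (at 0)"
        by (simp add: has_field_derivative_iff)
      have "filterlim (\<lambda>n. inverse (real (Suc n))) (at 0) sequentially"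
        unfolding filterlim_at using LIMSEQ_inverse_real_of_nat by (auto simp: )
      from filterlim_compose[OF * this] show "(\<lambda>n. q n x) \<longlonglongrightarrow> partial_deriv b h x"
        unfolding q_def by (simp add: divide_inverse)
    qed
    show "AE x in lborel. norm (q n x) \<le> indicator K x *\<^sub>R C" for n
    proof (rule AE_I2)
      fix x
      define t where "t = inverse (real (Suc n))"
      have t: "0 < t" "t \<le> 1" by (auto simp: t_def field_simps)
      have nb: "norm (t *\<^sub>R b) \<le> 1" using b t by simp
      show "norm (q n x) \<le> indicator K x *\<^sub>R C"
      proof (cases "norm x \<le> \<bar>r\<bar> + 1")
        case False
        have "norm x \<le> norm (x + t *\<^sub>R b) + norm (t *\<^sub>R b)"
          using norm_triangle_ineq4[of "x + t *\<^sub>R b" "t *\<^sub>R b"] by simp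
        then have "h (x + t *\<^sub>R b) = 0" "h x = 0" using False nb by (auto intro!: r)
        then show ?thesis using C0 by (simp add: q_def t_def)
      next
        case True
        obtain s where s: "0 < s" "s < t" "h (x + t *\<^sub>R b) - h (x + 0 *\<^sub>R b) = (t - 0) * (gradient h (x + s *\<^sub>R b) \<bullet> b)"
          using MVT2[OF t(1), of "\<lambda>t. h (x + t *\<^sub>R b)" "\<lambda>t. gradient h (x + t *\<^sub>R b) \<bullet> b"]
            has_real_derivative_line[OF h] by blast
        have "norm (x + s *\<^sub>R b) \<le> norm x + norm (s *\<^sub>R b)" by (rule norm_triangle_ineq)
        then have "x + s *\<^sub>R b \<in> K" using True s t b by (simp add: K_def)
        then have "\<bar>partial_deriv b h (x + s *\<^sub>R b)\<bar> \<le> C" by (rule C)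
        moreover have "q n x = partial_deriv b h (x + s *\<^sub>R b)"
          using s(3) t b by (simp add: q_def t_def gradient_inner_Basis field_simps del: of_nat_Suc)
        ultimately show ?thesis using True by (simp add: K_def)
      qed
    qed
  qed (auto simp: q_def)
  then show ?thesis using z by (simp add: LIMSEQ_const_iff)
qed

lemma integral_by_parts:
  fixes v \<psi> :: "'a::euclidean_space \<Rightarrow> real"
  assumes "C1 v" "C1 \<psi>" "bounded_support \<psi>" and b: "b \<in> Basis"
  shows "(LBINT x. partial_deriv b v x * \<psi> x) = - (LBINT x. v x * partial_deriv b \<psi> x)"
proof -
  have i: "integrable lborel (\<lambda>x. partial_deriv b v x * \<psi> x)" "integrable lborel (\<lambda>x. v x * partial_deriv b \<psi> x)"
    by (intro integrable_mult_bounded_support bounded_support_partial C1_cont_partial C1_cont assms)+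
  have "(LBINT x. partial_deriv b (\<lambda>x. v x * \<psi> x) x) = 0"
    using assms by (intro integral_partial_deriv_zero bounded_support_mult C1_mult)
  with i show ?thesis unfolding partial_deriv_mult[OF assms(1,2)] by simp
qed

lemma integral_laplacian_by_parts:
  fixes v \<psi> :: "'a::euclidean_space \<Rightarrow> real"
  assumes v: "C2 v" and \<psi>: "C1 \<psi>" "bounded_support \<psi>"
  shows "(LBINT x. neg_laplacian v x * \<psi> x) = (LBINT x. gradient v x \<bullet> gradient \<psi> x)"
proof -
  note pv = C2_partial[OF v]
  have i: "integrable lborel (\<lambda>x. partial_deriv b (partial_deriv b v) x * \<psi> x)"
      "integrable lborel (\<lambda>x. partial_deriv b v x * partial_deriv b \<psi> x)" if "b \<in> Basis" for b
    by (intro integrable_mult_bounded_support bounded_support_partial C1_cont_partial C1_cont \<psi> C2_C1[OF v] pv that)+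
  have "(LBINT x. neg_laplacian v x * \<psi> x)
      = (LBINT x. - (\<Sum>b\<in>Basis. partial_deriv b (partial_deriv b v) x * \<psi> x))"
    by (simp add: neg_laplacian_def laplacian_def sum_distrib_right)
  also have "\<dots> = - (\<Sum>b\<in>Basis. LBINT x. partial_deriv b (partial_deriv b v) x * \<psi> x)"
    using i by simp
  also have "\<dots> = (\<Sum>b\<in>Basis. LBINT x. partial_deriv b v x * partial_deriv b \<psi> x)"
    using integral_by_parts[OF pv \<psi>] by (simp add: sum_negf)
  also have "\<dots> = (LBINT x. (\<Sum>b\<in>Basis. partial_deriv b v x * partial_deriv b \<psi> x))"
    using i by simp
  also have "(\<lambda>x. (\<Sum>b\<in>Basis. partial_deriv b v x * partial_deriv b \<psi> x)) = (\<lambda>x. gradient v x \<bullet> gradient \<psi> x)"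
    by (simp add: inner_gradient)
  finally show ?thesis .
qed

lemma integral_laplacian_sym:
  fixes v \<psi> :: "'a::euclidean_space \<Rightarrow> real"
  assumes v: "C2 v" and \<psi>: "C2 \<psi>" "bounded_support \<psi>"
  shows "(LBINT x. neg_laplacian v x * \<psi> x) = (LBINT x. v x * neg_laplacian \<psi> x)"
proof -
  note p\<psi> = C2_partial[OF \<psi>(1)] and C1 = C2_C1[OF v] C2_C1[OF \<psi>(1)]
  have i: "integrable lborel (\<lambda>x. v x * partial_deriv b (partial_deriv b \<psi>) x)"
      "integrable lborel (\<lambda>x. partial_deriv b v x * partial_deriv b \<psi> x)" if "b \<in> Basis" for b
    by (intro integrable_mult_bounded_support bounded_support_partial C1_cont_partial C1_cont \<psi> C1 p\<psi> that)+
  have "(LBINT x. neg_laplacian v x * \<psi> x)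
      = (LBINT x. (\<Sum>b\<in>Basis. partial_deriv b v x * partial_deriv b \<psi> x))"
    by (simp add: integral_laplacian_by_parts[OF v C1(2) \<psi>(2)] inner_gradient)
  also have "\<dots> = (\<Sum>b\<in>Basis. LBINT x. partial_deriv b v x * partial_deriv b \<psi> x)"
    using i by simp
  also have "\<dots> = - (\<Sum>b\<in>Basis. LBINT x. v x * partial_deriv b (partial_deriv b \<psi>) x)"
    using integral_by_parts[OF C1(1) p\<psi> bounded_support_partial[OF \<psi>(2)]] by (simp add: sum_negf)
  also have "\<dots> = (LBINT x. - (\<Sum>b\<in>Basis. v x * partial_deriv b (partial_deriv b \<psi>) x))"
    using i by simp
  also have "\<dots> = (LBINT x. v x * neg_laplacian \<psi> x)"
    by (simp add: neg_laplacian_def laplacian_def sum_distrib_left)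
  finally show ?thesis .
qed

section \<open>Radial functions and truncated powers\<close>

text \<open>The argument is the squared distance: it is polynomial in \<open>x\<close>, so a profile
  that is differentiable on the line gives a function that is differentiable at the centre
  too.\<close>

definition radial :: "'a::euclidean_space \<Rightarrow> (real \<Rightarrow> real) \<Rightarrow> 'a \<Rightarrow> real" where
  "radial c F x = F ((x - c) \<bullet> (x - c))"

lemma has_derivative_radial:
  assumes "\<And>s. (F has_real_derivative F' s) (at s)"
  shows "((\<lambda>x. F ((x - c) \<bullet> (x - c))) has_derivative (\<lambda>h. 2 * ((x - c) \<bullet> h) * F' ((x - c) \<bullet> (x - c)))) (at x)"
proof -
  have "((\<lambda>x. (x - c) \<bullet> (x - c)) has_derivative (\<lambda>h. 2 * ((x - c) \<bullet> h))) (at x)"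
    by (auto intro!: derivative_eq_intros simp: inner_commute)
  from has_derivative_compose[OF this assms[THEN has_field_derivative_imp_has_derivative]]
  show ?thesis by (simp add: mult_ac)
qed

lemma partial_deriv_radial:
  assumes "\<And>s. (F has_real_derivative F' s) (at s)"
  shows "partial_deriv b (radial c F) = (\<lambda>x. 2 * ((x - c) \<bullet> b) * F' ((x - c) \<bullet> (x - c)))"
proof
  fix x
  have "((\<lambda>x. F ((x - c) \<bullet> (x - c))) has_derivative (\<lambda>h. 2 * ((x - c) \<bullet> h) * F' ((x - c) \<bullet> (x - c)))) (at x)"
    by (rule has_derivative_radial[OF assms])
  from partial_deriv_eqI[OF this] show "partial_deriv b (radial c F) x = 2 * ((x - c) \<bullet> b) * F' ((x - c) \<bullet> (x - c))"
    unfolding radial_def[abs_def] .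
qed

lemma differentiable_radial:
  assumes "\<And>s. (F has_real_derivative F' s) (at s)"
  shows "radial c F differentiable (at x)"
proof -
  have "((\<lambda>x. F ((x - c) \<bullet> (x - c))) has_derivative (\<lambda>h. 2 * ((x - c) \<bullet> h) * F' ((x - c) \<bullet> (x - c)))) (at x)"
    by (rule has_derivative_radial[OF assms])
  then show ?thesis unfolding radial_def[abs_def] differentiable_def by blast
qed

lemma C1_radial:
  assumes F: "\<And>s. (F has_real_derivative F' s) (at s)" and c: "continuous_on UNIV F'"
  shows "C1 (radial c F)"
  unfolding C1_iff partial_deriv_radial[OF F]
  using differentiable_radial[OF F] 
  by (auto intro!: continuous_intros continuous_on_compose2[OF c])

lemma partial_deriv_radial2:
  assumes F: "\<And>s. (F has_real_derivative F' s) (at s)" "\<And>s. (F' has_real_derivative F'' s) (at s)"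
    and ab: "a \<in> Basis" "b \<in> Basis"
  shows "partial_deriv a (partial_deriv b (radial c F)) = (\<lambda>x. 4 * ((x - c) \<bullet> a) * ((x - c) \<bullet> b) * F'' ((x - c) \<bullet> (x - c))
     + 2 * (a \<bullet> b) * F' ((x - c) \<bullet> (x - c)))" (is ?eq)
    and "partial_deriv b (radial c F) differentiable (at x)"
proof -
  have *: "((\<lambda>x. 2 * ((x - c) \<bullet> b) * F' ((x - c) \<bullet> (x - c))) has_derivative
       (\<lambda>h. 2 * ((x - c) \<bullet> b) * (2 * ((x - c) \<bullet> h) * F'' ((x - c) \<bullet> (x - c))) + 2 * (h \<bullet> b) * F' ((x - c) \<bullet> (x - c)))) (at x)" for x
    by (intro has_derivative_mult has_derivative_radial[OF F(2)]) (auto intro!: derivative_eq_intros)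
  show ?eq unfolding partial_deriv_radial[OF F(1)] 
    by (rule ext, subst partial_deriv_eqI[OF *]) (simp add: algebra_simps)
  show "partial_deriv b (radial c F) differentiable (at x)"
    unfolding partial_deriv_radial[OF F(1)] using * by (auto simp: differentiable_def)
qed

lemma C2_radial:
  assumes F: "\<And>s. (F has_real_derivative F' s) (at s)" "\<And>s. (F' has_real_derivative F'' s) (at s)"
    and c: "continuous_on UNIV F''"
  shows "C2 (radial c F)"
proof -
  have c': "continuous_on UNIV F'" using F(2) DERIV_continuous_on by blast
  show ?thesis
    unfolding C2_iff C1_iff
    using differentiable_radial[OF F(1)] partial_deriv_radial2(2)[OF F]
    by (auto simp: partial_deriv_radial2(1)[OF F] intro!: continuous_intros continuous_on_compose2[OF c] continuous_on_compose2[OF c'])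
qed

lemma neg_laplacian_radial:
  assumes F: "\<And>s. (F has_real_derivative F' s) (at s)" "\<And>s. (F' has_real_derivative F'' s) (at s)"
  shows "neg_laplacian (radial c F) = radial (c::'a::euclidean_space) (\<lambda>s. - (4 * s * F'' s + 2 * real DIM('a) * F' s))"
proof
  fix x :: 'a
  have "laplacian (radial c F) x = (\<Sum>b\<in>Basis. 4 * (((x - c) \<bullet> b) * ((x - c) \<bullet> b)) * F'' ((x - c) \<bullet> (x - c))
     + 2 * F' ((x - c) \<bullet> (x - c)))"
    unfolding laplacian_def by (intro sum.cong refl) (simp add: partial_deriv_radial2[OF F])
  also have "\<dots> = 4 * ((x - c) \<bullet> (x - c)) * F'' ((x - c) \<bullet> (x - c)) + 2 * real DIM('a) * F' ((x - c) \<bullet> (x - c))"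
    unfolding sum.distrib euclidean_inner[of "x - c" "x - c"] by (simp add: sum_distrib_right sum_distrib_left)
  finally show "neg_laplacian (radial c F) x = radial c (\<lambda>s. - (4 * s * F'' s + 2 * real DIM('a) * F' s)) x"
    by (simp add: neg_laplacian_def radial_def)
qed

section \<open>Truncated powers as test functions\<close>

lemma max_power_derivative:
  assumes "l \<ge> 1"
  shows "((\<lambda>s::real. max 0 (\<rho> - s) ^ Suc l) has_real_derivative - (real (Suc l) * max 0 (\<rho> - s) ^ l)) (at s)"
proof -
  \<comment> \<open>At the kink the difference quotient is \<open>max 0 h ^ l\<close>, which tends
    to 0 because \<open>l \<ge> 1\<close>; elsewhere the function is locally a power or
    zero.\<close>
  have "((\<lambda>y::real. max 0 y ^ Suc l) has_real_derivative (real (Suc l) * max 0 y ^ l)) (at y)" for y :: real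
  proof (cases "y = 0")
    case True
    have "((\<lambda>h::real. max 0 h ^ l) \<longlongrightarrow> max 0 0 ^ l) (at 0)"
      by (intro tendsto_intros)
    moreover have "\<forall>\<^sub>F h::real in at 0. max 0 h ^ l = (max 0 (0 + h) ^ Suc l - max 0 0 ^ Suc l) / h"
      using assms by (auto simp: eventually_at_filter max_def intro!: always_eventually)
    ultimately show ?thesis using True assms
      unfolding DERIV_def using Lim_transform_eventually by (fastforce simp: power_0_left)
  next
    case False
    show ?thesis
    proof (cases "y > 0")
      case True
      have "((\<lambda>y::real. y ^ Suc l) has_real_derivative (real (Suc l) * max 0 y ^ l)) (at y)"
        by (rule derivative_eq_intros refl | use True in simp)+
      then show ?thesis
        by (rule has_field_derivative_transform_within_open[of _ _ _ "{0<..}"]) (use True in auto)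
    next
      case f: False
      have "((\<lambda>y::real. 0) has_real_derivative (real (Suc l) * max 0 y ^ l)) (at y)"
        by (rule derivative_eq_intros refl | use f assms in simp)+
      then show ?thesis
        by (rule has_field_derivative_transform_within_open[of _ _ _ "{..<0}"]) (use f False in auto)
    qed
  qed
  note * = DERIV_chain2[OF this, of "\<lambda>s. \<rho> - s" "-1" s]
  have "((\<lambda>s. \<rho> - s) has_real_derivative - 1) (at s)"
    by (auto intro!: derivative_eq_intros)
  from *[OF this] show ?thesis by (simp add: algebra_simps)
qed

text \<open>Stand-in for smooth cutoffs. The class is stable under sums, polynomial factors and, at
  the cost of one order, differentiation, so the number \<open>l\<close> alone keeps track of how
  many derivatives remain available.\<close>

definition trunc_power :: "real \<Rightarrow> nat \<Rightarrow> (real \<Rightarrow> real) \<Rightarrow> bool" where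
  "trunc_power \<rho> l F \<longleftrightarrow> (\<exists>p. \<forall>s. F s = poly p s * max 0 (\<rho> - s) ^ l)"

text \<open>As long as one truncated factor is left over, another may be replaced by the polynomial
  \<open>\<rho> - s\<close>; this is the purpose of \<open>l \<ge> 1\<close>.\<close>

lemma trunc_power_Suc: "trunc_power \<rho> (Suc l) F \<Longrightarrow> l \<ge> 1 \<Longrightarrow> trunc_power \<rho> l F"
proof -
  assume l: "l \<ge> 1" and "trunc_power \<rho> (Suc l) F"
  then obtain p where p: "\<And>s. F s = poly p s * max 0 (\<rho> - s) ^ Suc l" by (auto simp: trunc_power_def)
  have m: "poly p s * max 0 (\<rho> - s) ^ Suc l = poly (p * [:\<rho>, -1:]) s * max 0 (\<rho> - s) ^ l" for s
    using l by (auto simp: max_def algebra_simps)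
  have "F s = poly (p * [:\<rho>, -1:]) s * max 0 (\<rho> - s) ^ l" for s
    unfolding p m ..
  then show ?thesis unfolding trunc_power_def by blast
qed

lemma trunc_power_add: "trunc_power \<rho> l F \<Longrightarrow> trunc_power \<rho> l G \<Longrightarrow> trunc_power \<rho> l (\<lambda>s. F s + G s)"
proof -
  assume "trunc_power \<rho> l F" "trunc_power \<rho> l G"
  then obtain p q where "\<And>s. F s = poly p s * max 0 (\<rho> - s) ^ l" "\<And>s. G s = poly q s * max 0 (\<rho> - s) ^ l"
    by (auto simp: trunc_power_def)
  then have "\<forall>s. F s + G s = poly (p + q) s * max 0 (\<rho> - s) ^ l" by (simp add: algebra_simps)
  then show ?thesis unfolding trunc_power_def by blast
qed

lemma trunc_power_mult: "trunc_power \<rho> l F \<Longrightarrow> trunc_power \<rho> l (\<lambda>s. poly q s * F s)"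
proof -
  assume "trunc_power \<rho> l F"
  then obtain p where "\<And>s. F s = poly p s * max 0 (\<rho> - s) ^ l"
    by (auto simp: trunc_power_def)
  then have "\<forall>s. poly q s * F s = poly (q * p) s * max 0 (\<rho> - s) ^ l" by (simp add: algebra_simps)
  then show ?thesis unfolding trunc_power_def by blast
qed

lemma trunc_power_deriv:
  assumes "trunc_power \<rho> (Suc l) F" "l \<ge> 1"
  shows "(F has_real_derivative deriv F s) (at s)" and "trunc_power \<rho> l (deriv F)"
proof -
  obtain p where p: "\<And>s. F s = poly p s * max 0 (\<rho> - s) ^ Suc l" using assms by (auto simp: trunc_power_def)
  define D where "D s = poly (pderiv p * [:\<rho>, -1:] - smult (real (Suc l)) p) s * max 0 (\<rho> - s) ^ l" for s
  have m: "x * max 0 (\<rho> - s) ^ Suc l = x * (\<rho> - s) * max 0 (\<rho> - s) ^ l" for s x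
    using assms(2) by (auto simp: max_def)
  have d: "(F has_real_derivative D s) (at s)" for s
  proof -
    have "((\<lambda>s. poly p s * max 0 (\<rho> - s) ^ Suc l) has_real_derivative
        poly (pderiv p) s * max 0 (\<rho> - s) ^ Suc l + - (real (Suc l) * max 0 (\<rho> - s) ^ l) * poly p s) (at s)"
      by (intro DERIV_mult poly_DERIV max_power_derivative assms)
    also have "poly (pderiv p) s * max 0 (\<rho> - s) ^ Suc l + - (real (Suc l) * max 0 (\<rho> - s) ^ l) * poly p s = D s"
      unfolding m D_def by (simp add: algebra_simps)
    also have "(\<lambda>s. poly p s * max 0 (\<rho> - s) ^ Suc l) = F" using p by auto
    finally show ?thesis .
  qed
  then have "deriv F = D" using DERIV_imp_deriv by blast
  with d show "(F has_real_derivative deriv F s) (at s)" by simp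
  show "trunc_power \<rho> l (deriv F)" unfolding \<open>deriv F = D\<close> D_def[abs_def] trunc_power_def by blast
qed

lemma trunc_power_continuous: "trunc_power \<rho> l F \<Longrightarrow> continuous_on UNIV F"
proof -
  assume "trunc_power \<rho> l F"
  then obtain p where "F = (\<lambda>s. poly p s * max 0 (\<rho> - s) ^ l)" by (auto simp: trunc_power_def)
  then show ?thesis by (auto intro!: continuous_intros)
qed

lemma trunc_power_zero: "trunc_power \<rho> l F \<Longrightarrow> l \<ge> 1 \<Longrightarrow> s \<ge> \<rho> \<Longrightarrow> F s = 0"
  by (auto simp: trunc_power_def max_def)

text \<open>The negative Laplacian of R^n acting on functions of s = |x|^2. Iterating it never
  leaves the functions of one real variable.\<close>

definition rad_lap :: "nat \<Rightarrow> (real \<Rightarrow> real) \<Rightarrow> real \<Rightarrow> real" where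
  "rad_lap n F s = - (4 * s * deriv (deriv F) s + 2 * real n * deriv F s)"

lemma trunc_power_rad_lap:
  assumes "trunc_power \<rho> (Suc (Suc l)) F" "l \<ge> 1"
  shows "trunc_power \<rho> l (rad_lap n F)"
proof -
  have d: "trunc_power \<rho> (Suc l) (deriv F)" using assms by (intro trunc_power_deriv) auto
  then have d2: "trunc_power \<rho> l (deriv (deriv F))" using assms by (intro trunc_power_deriv) auto
  from trunc_power_add[OF trunc_power_mult[OF d2, of "[:0, -4:]"] trunc_power_mult[OF trunc_power_Suc[OF d assms(2)], of "[:- 2 * real n:]"]]
  show ?thesis unfolding rad_lap_def[abs_def] by (simp add: algebra_simps)
qed

lemma trunc_power_rad_lap_pow:
  assumes "trunc_power \<rho> (2 * k + l) F" "l \<ge> 1"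
  shows "trunc_power \<rho> l ((rad_lap n ^^ k) F)"
  using assms
proof (induction k arbitrary: l)
  case (Suc k)
  then have "trunc_power \<rho> (Suc (Suc l)) ((rad_lap n ^^ k) F)" by (intro Suc.IH) auto
  then show ?case using Suc.prems by (auto intro: trunc_power_rad_lap)
qed auto

lemma bounded_support_radial:
  fixes c :: "'a::euclidean_space"
  assumes "trunc_power \<rho> l F" "l \<ge> 1"
  shows "bounded_support (radial c F)"
proof (rule bounded_supportI[of "norm c + sqrt \<bar>\<rho>\<bar>"])
  fix x :: 'a assume "norm c + sqrt \<bar>\<rho>\<bar> < norm x"
  moreover have "norm x \<le> norm (x - c) + norm c" using norm_triangle_ineq[of "x - c" c] by simp
  ultimately have "sqrt \<bar>\<rho>\<bar> < norm (x - c)" by simp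
  then have "\<bar>\<rho>\<bar> < (norm (x - c))\<^sup>2" using power_strict_mono[of "sqrt \<bar>\<rho>\<bar>" "norm (x - c)" 2] by simp
  then have "\<rho> \<le> (x - c) \<bullet> (x - c)" unfolding power2_norm_eq_inner by simp
  then show "radial c F x = 0" using trunc_power_zero[OF assms] by (simp add: radial_def)
qed

lemma radial_trunc_power:
  fixes c :: "'a::euclidean_space" and b :: 'a
  assumes "trunc_power \<rho> (Suc (Suc l)) F" "l \<ge> 1"
  shows "C2 (radial c F)" "neg_laplacian (radial c F) = radial c (rad_lap DIM('a) F)"
    "partial_deriv b (radial c F) = (\<lambda>x. 2 * ((x - c) \<bullet> b) * deriv F ((x - c) \<bullet> (x - c)))"
proof -
  note d = trunc_power_deriv[OF assms(1)]
  note d2 = trunc_power_deriv[OF d(2)]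
  have l: "Suc l \<ge> 1" "l \<ge> 1" using assms by auto
  note D = d(1)[OF l(1)] d2(1)[OF l]
  show "C2 (radial c F)"
    by (rule C2_radial[OF D trunc_power_continuous[OF d2(2)[OF l]]])
  show "neg_laplacian (radial c F) = radial c (rad_lap DIM('a) F)"
    unfolding neg_laplacian_radial[OF D] rad_lap_def[abs_def] ..
  show "partial_deriv b (radial c F) = (\<lambda>x. 2 * ((x - c) \<bullet> b) * deriv F ((x - c) \<bullet> (x - c)))"
    by (rule partial_deriv_radial[OF D(1)])
qed

text \<open>Green's formula moves one Laplacian at a time. Each transfer spends two orders of the
  truncated power and keeps the test function radial, so the induction hypothesis applies to
  \<open>rad_lap\<close> of the profile.\<close>

lemma integral_neg_laplacian_pow_radial:
  fixes v :: "'a::euclidean_space \<Rightarrow> real"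
  assumes v: "smooth v" and F: "trunc_power \<rho> (2 * k + l) F" "l \<ge> 1"
  shows "(LBINT x. (neg_laplacian ^^ k) v x * radial c F x) = (LBINT x. v x * radial c ((rad_lap DIM('a) ^^ k) F) x)"
  using F
proof (induction k arbitrary: F)
  case (Suc k)
  then have F: "trunc_power \<rho> (Suc (Suc (2 * k + l))) F" "2 * k + l \<ge> 1" by simp_all
  have "(LBINT x. (neg_laplacian ^^ Suc k) v x * radial c F x)
      = (LBINT x. (neg_laplacian ^^ k) v x * neg_laplacian (radial c F) x)"
    using integral_laplacian_sym[OF smooth_C2[OF smooth_neg_laplacian_pow[OF v]] radial_trunc_power(1)[OF F] bounded_support_radial[OF F(1)]]
    by simp
  also have "\<dots> = (LBINT x. (neg_laplacian ^^ k) v x * radial c (rad_lap DIM('a) F) x)"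
    by (simp add: radial_trunc_power(2)[OF F])
  also have "\<dots> = (LBINT x. v x * radial c ((rad_lap DIM('a) ^^ k) (rad_lap DIM('a) F)) x)"
    using F Suc.prems by (intro Suc.IH trunc_power_rad_lap)
  finally show ?case by (simp add: funpow_Suc_right del: funpow.simps)
qed auto

lemma rad_lap_scale:
  assumes F: "trunc_power \<rho> (Suc (Suc l)) F" "l \<ge> 1"
  shows "rad_lap n (\<lambda>s. F (s / q)) = (\<lambda>s. rad_lap n F (s / q) / q)"
proof -
  note d = trunc_power_deriv[OF assms(1)]
  note d2 = trunc_power_deriv[OF d(2)]
  have l: "Suc l \<ge> 1" "l \<ge> 1" using assms by auto
  note D = d(1)[OF l(1)] d2(1)[OF l]
  have "((\<lambda>s. F (s / q)) has_real_derivative deriv F (s / q) * (1 / q)) (at s)" for s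
    by (intro DERIV_chain2[OF D(1)] DERIV_cdivide DERIV_ident)
  then have 1: "deriv (\<lambda>s. F (s / q)) = (\<lambda>s. deriv F (s / q) / q)"
    using DERIV_imp_deriv by fastforce
  have "((\<lambda>s. deriv F (s / q) * (1 / q)) has_real_derivative deriv (deriv F) (s / q) * (1 / q) * (1 / q)) (at s)" for s
    by (intro DERIV_cmult_right DERIV_chain2[OF D(2)] DERIV_cdivide DERIV_ident)
  then have 2: "deriv (\<lambda>s. deriv F (s / q) / q) = (\<lambda>s. deriv (deriv F) (s / q) / q / q)"
    using DERIV_imp_deriv by fastforce
  show ?thesis unfolding rad_lap_def[abs_def] 1 2 by (auto simp: algebra_simps diff_divide_distrib)
qed

lemma rad_lap_divide:
  assumes F: "trunc_power \<rho> (Suc (Suc l)) F" "l \<ge> 1"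
  shows "rad_lap n (\<lambda>s. F s / q) = (\<lambda>s. rad_lap n F s / q)"
proof -
  note d = trunc_power_deriv[OF assms(1)]
  note d2 = trunc_power_deriv[OF d(2)]
  have l: "Suc l \<ge> 1" "l \<ge> 1" using assms by auto
  note D = d(1)[OF l(1)] d2(1)[OF l]
  have 1: "deriv (\<lambda>s. F s / q) = (\<lambda>s. deriv F s / q)"
    using DERIV_imp_deriv[OF DERIV_cdivide[OF D(1)]] by fastforce
  have 2: "deriv (\<lambda>s. deriv F s / q) = (\<lambda>s. deriv (deriv F) s / q)"
    using DERIV_imp_deriv[OF DERIV_cdivide[OF D(2)]] by fastforce
  show ?thesis unfolding rad_lap_def[abs_def] 1 2 by (auto simp: algebra_simps diff_divide_distrib)
qed

lemma trunc_power_scale: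
  assumes "trunc_power 1 l F" "q > 0"
  shows "trunc_power q l (\<lambda>s. F (s / q))"
proof -
  obtain p where p: "\<And>s. F s = poly p s * max 0 (1 - s) ^ l" using assms by (auto simp: trunc_power_def)
  have "max 0 (1 - s / q) = max 0 (q - s) / q" for s
    using assms by (auto simp: max_def field_simps)
  then have "F (s / q) = poly (smult (1 / q ^ l) (pcompose p [:0, 1 / q:])) s * max 0 (q - s) ^ l" for s
    unfolding p by (simp add: poly_pcompose power_divide)
  then show ?thesis unfolding trunc_power_def by blast
qed

text \<open>In the variable s the Laplacian is homogeneous of degree -1. The lemma is applied with q
  = r^2, where \<open>q ^ k\<close> becomes r^(2k).\<close>

lemma rad_lap_pow_scale:
  assumes F: "trunc_power \<rho> (2 * k + l) F" "l \<ge> 1"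
  shows "(rad_lap n ^^ k) (\<lambda>s. F (s / q)) = (\<lambda>s. (rad_lap n ^^ k) F (s / q) / q ^ k)"
  using F
proof (induction k arbitrary: l)
  case (Suc k)
  then have *: "(rad_lap n ^^ k) (\<lambda>s. F (s / q)) = (\<lambda>s. (rad_lap n ^^ k) F (s / q) / q ^ k)"
    by (intro Suc.IH[of "Suc (Suc l)"]) auto
  have T: "trunc_power \<rho> (Suc (Suc l)) ((rad_lap n ^^ k) F)"
    using Suc.prems by (intro trunc_power_rad_lap_pow) auto
  then have T': "trunc_power \<rho> (Suc (Suc l)) (\<lambda>s. (rad_lap n ^^ k) F s / q ^ k)"
    using trunc_power_mult[OF T, of "[:1 / q ^ k:]"] by simp
  have "(rad_lap n ^^ Suc k) (\<lambda>s. F (s / q)) = (\<lambda>s. rad_lap n (\<lambda>s. (rad_lap n ^^ k) F s / q ^ k) (s / q) / q)"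
    using rad_lap_scale[OF T'] Suc.prems * by simp
  also have "rad_lap n (\<lambda>s. (rad_lap n ^^ k) F s / q ^ k) = (\<lambda>s. rad_lap n ((rad_lap n ^^ k) F) s / q ^ k)"
    by (rule rad_lap_divide[OF T Suc.prems(2)])
  finally show ?case by (simp add: field_simps)
qed auto

section \<open>The averaging identity\<close>

text \<open>Schwarz's theorem by duality. A positive difference of the mixed derivatives at
  \<open>c\<close> persists on a ball. Tested against a radial bump on that ball, both derivatives
  move onto the bump, whose mixed derivatives agree by their explicit formula, so the integral of a
  positive function would vanish.\<close>

lemma mixed_partials_aux:
  fixes w :: "'a::euclidean_space \<Rightarrow> real"
  assumes w: "C2 w" and ab: "a \<in> Basis" "b \<in> Basis"
  shows "partial_deriv a (partial_deriv b w) c \<le> partial_deriv b (partial_deriv a w) c"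
proof (rule ccontr)
  define D where "D x = partial_deriv a (partial_deriv b w) x - partial_deriv b (partial_deriv a w) x" for x
  assume "\<not> ?thesis"
  then have "D c > 0" by (simp add: D_def)
  have pw: "C1 (partial_deriv a w)" "C1 (partial_deriv b w)" and w1: "C1 w"
    using w ab by (auto intro: C2_partial C2_C1)
  have cD: "continuous_on UNIV D" unfolding D_def[abs_def]
    by (intro continuous_on_diff C1_cont_partial pw ab)
  then obtain \<delta> where \<delta>: "\<delta> > 0" "\<And>x. dist x c < \<delta> \<Longrightarrow> dist (D x) (D c) < D c"
    using \<open>D c > 0\<close> unfolding continuous_on_iff by (metis UNIV_I)
  have Dpos: "D x > 0" if "x \<in> ball c \<delta>" for x
    using \<delta>(2)[of x] that by (auto simp: dist_commute dist_real_def)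
  define \<psi> where "\<psi> = radial c (\<lambda>s. max 0 (\<delta>\<^sup>2 - s) ^ Suc (Suc 2))"
  have tp: "trunc_power (\<delta>\<^sup>2) (Suc (Suc 2)) (\<lambda>s. max 0 (\<delta>\<^sup>2 - s) ^ Suc (Suc 2))"
    unfolding trunc_power_def by (rule exI[of _ 1]) simp
  have \<psi>: "C2 \<psi>" "bounded_support \<psi>"
    unfolding \<psi>_def by (intro radial_trunc_power(1)[OF tp] bounded_support_radial[OF tp]; simp)+
  have p\<psi>: "C1 (partial_deriv a \<psi>)" "C1 (partial_deriv b \<psi>)" and \<psi>1: "C1 \<psi>"
    using \<psi> ab by (auto intro: C2_partial C2_C1)
  have ibp: "(LBINT x. partial_deriv a' (partial_deriv b' w) x * \<psi> x) = (LBINT x. w x * partial_deriv b' (partial_deriv a' \<psi>) x)"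
    if "a' \<in> Basis" "b' \<in> Basis" for a' b'
    using integral_by_parts[OF C2_partial[OF w that(2)] \<psi>1 \<psi>(2) that(1)]
      integral_by_parts[OF w1 C2_partial[OF \<psi>(1) that(1)] bounded_support_partial[OF \<psi>(2)] that(2)] by simp
  have sym: "partial_deriv b (partial_deriv a \<psi>) = partial_deriv a (partial_deriv b \<psi>)"
  proof -
    note d = trunc_power_deriv[OF tp]
    note d2 = trunc_power_deriv[OF d(2)]
    have l: "Suc 2 \<ge> 1" "2 \<ge> (1::nat)" by auto
    note D = d(1)[OF l(1)] d2(1)[OF l]
    show ?thesis unfolding \<psi>_def partial_deriv_radial2(1)[OF D ab(2,1)] partial_deriv_radial2(1)[OF D ab]
      by (simp add: inner_commute mult_ac)
  qed
  have i: "integrable lborel (\<lambda>x. partial_deriv a (partial_deriv b w) x * \<psi> x)"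
    "integrable lborel (\<lambda>x. partial_deriv b (partial_deriv a w) x * \<psi> x)"
    by (intro integrable_mult_bounded_support C1_cont_partial C1_cont[OF \<psi>1] pw \<psi> ab)+
  have "(LBINT x. D x * \<psi> x) = 0"
    using ibp[OF ab] ibp[OF ab(2,1)] sym i by (simp add: D_def left_diff_distrib)
  moreover have nn: "D x * \<psi> x \<ge> 0" for x
  proof (cases "x \<in> ball c \<delta>")
    case True
    then show ?thesis using Dpos[of x] by (simp add: \<psi>_def radial_def)
  next
    case False
    then have "\<delta> \<le> norm (x - c)" by (simp add: dist_norm norm_minus_commute)
    then have "\<delta>\<^sup>2 \<le> (x - c) \<bullet> (x - c)" using \<delta>(1) power_mono[of \<delta> "norm (x - c)" 2] by (simp add: power2_norm_eq_inner)
    then show ?thesis by (simp add: \<psi>_def radial_def)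
  qed
  moreover have "integrable lborel (\<lambda>x. D x * \<psi> x)"
    using i by (simp add: D_def left_diff_distrib)
  ultimately have "AE x in lborel. D x * \<psi> x = 0"
    by (subst (asm) integral_nonneg_eq_0_iff_AE) auto
  then have "AE x in lborel. x \<notin> ball c \<delta>"
  proof (rule AE_mp, intro AE_I2 impI notI)
    fix x assume z: "D x * \<psi> x = 0" and x: "x \<in> ball c \<delta>"
    then have "norm (x - c) < \<delta>" by (simp add: dist_norm norm_minus_commute)
    then have "(x - c) \<bullet> (x - c) < \<delta>\<^sup>2" using power_strict_mono[of "norm (x - c)" \<delta> 2] by (simp add: power2_norm_eq_inner)
    then show False using Dpos[OF x] z by (simp add: \<psi>_def radial_def)
  qed
  then have "emeasure lborel (ball c \<delta>) = 0"
    using AE_iff_measurable[of "ball c \<delta>" lborel "\<lambda>x. x \<notin> ball c \<delta>"] by (simp add: ball_def)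
  then have "measure lborel (ball c \<delta>) = 0" by (simp add: measure_def)
  then show False using \<delta>(1) content_ball_gt_0_iff[of c \<delta>] by simp
qed

lemma mixed_partials:
  assumes "C2 w" "a \<in> Basis" "b \<in> Basis"
  shows "partial_deriv a (partial_deriv b w) = partial_deriv b (partial_deriv a w)"
  using mixed_partials_aux[OF assms] mixed_partials_aux[OF assms(1,3,2)] by (intro ext antisym)

lemma neg_laplacian_partial:
  fixes u :: "'a::euclidean_space \<Rightarrow> real"
  assumes u: "smooth u" and b: "b \<in> Basis"
  shows "neg_laplacian (partial_deriv b u) = partial_deriv b (neg_laplacian u)"
proof -
  have "partial_deriv a (partial_deriv a (partial_deriv b u)) = partial_deriv b (partial_deriv a (partial_deriv a u))"
    if "a \<in> Basis" for a
    unfolding mixed_partials[OF smooth_C2[OF u] that b]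
    by (rule mixed_partials[OF smooth_C2[OF smooth_partial[OF u that]] that b])
  moreover have "partial_deriv a (partial_deriv a u) differentiable (at x)" if "a \<in> Basis" for a x
    using C1_differentiable[OF smooth_C1[OF smooth_partial[OF smooth_partial[OF u that] that]]] .
  ultimately show ?thesis
    unfolding neg_laplacian_sum by (subst partial_deriv_sum) auto
qed

lemma neg_laplacian_pow_partial:
  fixes u :: "'a::euclidean_space \<Rightarrow> real"
  assumes u: "smooth u" and b: "b \<in> Basis"
  shows "(neg_laplacian ^^ k) (partial_deriv b u) = partial_deriv b ((neg_laplacian ^^ k) u)"
  using neg_laplacian_partial[OF smooth_neg_laplacian_pow[OF u] b]
  by (induction k) auto

text \<open>Each application of \<open>rad_lap\<close> costs two orders, so \<open>m\<close> of them
  leave order 3 and hence a continuous function. The value 1 at the origin fixes the normalisation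
  of the kernel in the limit.\<close>

definition bump :: "nat \<Rightarrow> real \<Rightarrow> real" where
  "bump m s = max 0 (1 - s) ^ (2 * m + 3)"

text \<open>For G the iterated \<open>rad_lap\<close> in the body, the product rule gives r^(-2m)
  (rad_lap G)(s/r^2) / (2r) as the r-derivative of r^(-2m) G'(s/r^2). The factor -4 turns 1/(2r)
  into -2/r and makes the mass of the profile positive.\<close>

definition profile :: "nat \<Rightarrow> real \<Rightarrow> real" where
  "profile m s = - 4 * deriv ((rad_lap (2 * m) ^^ (m - 1)) (bump m)) s"

lemma trunc_power_bump: "trunc_power 1 (2 * m + 3) (bump m)"
  unfolding trunc_power_def bump_def by (rule exI[of _ 1]) simp

lemma trunc_power_profile_aux:
  assumes "m \<ge> 1"
  shows "trunc_power 1 5 ((rad_lap (2 * m) ^^ (m - 1)) (bump m))"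
proof -
  have e: "2 * (m - 1) + 5 = 2 * m + 3" using assms by auto
  have "trunc_power 1 (2 * (m - 1) + 5) (bump m)" unfolding e by (rule trunc_power_bump)
  then show ?thesis by (rule trunc_power_rad_lap_pow) simp
qed

lemma trunc_power_profile: "m \<ge> 1 \<Longrightarrow> trunc_power 1 4 (profile m)"
  using trunc_power_deriv(2)[of 1 4 "(rad_lap (2 * m) ^^ (m - 1)) (bump m)"] trunc_power_profile_aux[of m]
    trunc_power_mult[of 1 4 "deriv ((rad_lap (2 * m) ^^ (m - 1)) (bump m))" "[:-4:]"]
  by (simp add: profile_def[abs_def])

lemma trunc_power_bump_pow: "trunc_power 1 3 ((rad_lap (2 * m) ^^ m) (bump m))"
  using trunc_power_bump[of m] by (intro trunc_power_rad_lap_pow) auto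

text \<open>
  This works because \<^const>\<open>profile\<close> is the radial derivative of \<open>(-\<Delta>)\<^sup>m\<^sup>-\<^sup>1\<close> of the bump, and because the
  order \<open>2 m\<close> of the operator equals the dimension.
\<close>

lemma profile_scale_derivative:
  assumes m: "m \<ge> 1" and r: "r > 0"
  shows "((\<lambda>r. profile m (s / r\<^sup>2) / r ^ (2 * m)) has_real_derivative
     - (2 / r) * (rad_lap (2 * m) ^^ m) (\<lambda>s. bump m (s / r\<^sup>2)) s) (at r)"
proof -
  define G where "G = (rad_lap (2 * m) ^^ (m - 1)) (bump m)"
  have G: "trunc_power 1 (Suc 4) G" using trunc_power_profile_aux[OF m] by (simp add: G_def)
  have d1: "trunc_power 1 (Suc 3) (deriv G)" using trunc_power_deriv(2)[OF G] by simp
  have d2: "(deriv G has_real_derivative deriv (deriv G) s) (at s)" for s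
    by (rule trunc_power_deriv(1)[OF d1]) simp
  have p: "profile m = (\<lambda>s. - 4 * deriv G s)" by (simp add: profile_def[abs_def] G_def)
  have "((\<lambda>r. s / r\<^sup>2) has_real_derivative - 2 * s / r ^ 3) (at r)"
    using r by (auto intro!: derivative_eq_intros simp: field_simps power2_eq_square power3_eq_cube)
  from DERIV_chain2[OF d2 this]
  have "((\<lambda>r. deriv G (s / r\<^sup>2)) has_real_derivative deriv (deriv G) (s / r\<^sup>2) * (- 2 * s / r ^ 3)) (at r)" .
  moreover have "((\<lambda>r. r ^ (2 * m)) has_real_derivative 2 * m * r ^ (2 * m - 1)) (at r)"
    by (auto intro!: derivative_eq_intros)
  ultimately have "((\<lambda>r. - 4 * (deriv G (s / r\<^sup>2) / r ^ (2 * m))) has_real_derivative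
     - 4 * ((deriv (deriv G) (s / r\<^sup>2) * (- 2 * s / r ^ 3) * r ^ (2 * m) - deriv G (s / r\<^sup>2) * (2 * m * r ^ (2 * m - 1)))
       / (r ^ (2 * m) * r ^ (2 * m)))) (at r)"
    using r by (intro DERIV_cmult DERIV_divide) auto
  moreover have "- 4 * ((D2 * (- 2 * s / r ^ 3) * r ^ (2 * m) - D1 * (2 * m * r ^ (2 * m - 1))) / (r ^ (2 * m) * r ^ (2 * m)))
    = - (2 / r) * ((- (4 * (s / r\<^sup>2) * D2 + 2 * real (2 * m) * D1)) / r ^ (2 * m))" for D1 D2 :: real
  proof -
    define R where "R = r ^ (2 * m)"
    have R: "R > 0" using r by (simp add: R_def)
    have e: "r ^ (2 * m - 1) = R / r" using m r by (simp add: R_def power_diff)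
    show ?thesis unfolding e R_def[symmetric] using R r by (simp add: field_simps power2_eq_square power3_eq_cube)
  qed
  moreover have "(rad_lap (2 * m) ^^ m) (\<lambda>s. bump m (s / r\<^sup>2)) s = rad_lap (2 * m) G (s / r\<^sup>2) / r ^ (2 * m)"
  proof -
    have "(rad_lap (2 * m) ^^ m) (bump m) = rad_lap (2 * m) G"
      unfolding G_def using m by (cases m) auto
    then show ?thesis
      using rad_lap_pow_scale[of 1 m 3 "bump m" "2 * m" "r\<^sup>2"] trunc_power_bump[of m] by (simp add: power_mult)
  qed
  ultimately show ?thesis unfolding p by (simp add: rad_lap_def[of _ G])
qed

text \<open>Vanishing off the ball replaces a cutoff in \<open>x\<close>, so continuity on one
  compact cylinder already gives joint integrability.\<close>

lemma fubini_compact: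
  fixes h :: "'a::euclidean_space \<Rightarrow> real \<Rightarrow> real"
  assumes cont: "continuous_on (cball c N \<times> {a..b}) (\<lambda>(x, r). h x r)"
    and zero: "\<And>x r. x \<notin> cball c N \<Longrightarrow> r \<in> {a..b} \<Longrightarrow> h x r = 0"
  shows "(LBINT x. (LBINT r. indicator {a..b} r *\<^sub>R h x r)) = (LBINT r. indicator {a..b} r *\<^sub>R (LBINT x. h x r))"
proof -
  define H where "H = (\<lambda>x r. indicator (cball c N \<times> {a..b}) (x, r) *\<^sub>R h x r)"
  have "integrable lborel (\<lambda>z. indicator (cball c N \<times> {a..b}) z *\<^sub>R (case z of (x, r) \<Rightarrow> h x r))"
    by (intro borel_integrable_compact compact_Times compact_cball compact_Icc cont)
  also have "(\<lambda>z. indicator (cball c N \<times> {a..b}) z *\<^sub>R (case z of (x, r) \<Rightarrow> h x r)) = case_prod H"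
    by (auto simp: H_def)
  finally have "integrable (lborel \<Otimes>\<^sub>M lborel) (case_prod H)" by (simp add: lborel_prod)
  from lborel_pair.Fubini_integral[OF this]
  have "(LBINT r. (LBINT x. H x r)) = (LBINT x. (LBINT r. H x r))" .
  moreover have "H x r = indicator {a..b} r *\<^sub>R h x r" for x r
    using zero[of x r] by (auto simp: H_def indicator_def)
  ultimately show ?thesis by simp
qed

text \<open>The difference of the two kernels is an integral over scales r of -(2/r) (-Delta)^m of
  the dilated bump. At each scale (-Delta)^m moves onto the derivative of \<open>u\<close>, commutes
  with it, and the remaining first derivative moves back onto the bump. The resulting integrand is
  again an exact r-derivative, so the integral over scales can be evaluated.\<close>

lemma scaled_radial_average_difference:
  fixes u :: "'a::euclidean_space \<Rightarrow> real"
  assumes u: "smooth u" and b: "b \<in> Basis" and m: "DIM('a) = 2 * m" and \<epsilon>N: "0 < \<epsilon>" "\<epsilon> \<le> N"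
  shows "(LBINT y. partial_deriv b u y * (radial c (\<lambda>s. profile m (s / N\<^sup>2) / N ^ (2 * m)) y
            - radial c (\<lambda>s. profile m (s / \<epsilon>\<^sup>2) / \<epsilon> ^ (2 * m)) y))
    = (LBINT y. (neg_laplacian ^^ m) u y * (- 2 * ((y - c) \<bullet> b) / ((y - c) \<bullet> (y - c)) *
        (bump m (((y - c) \<bullet> (y - c)) / N\<^sup>2) - bump m (((y - c) \<bullet> (y - c)) / \<epsilon>\<^sup>2))))"
proof -
  define v where "v = partial_deriv b u"
  define f where "f = (neg_laplacian ^^ m) u"
  define S where "S y = (y - c) \<bullet> (y - c)" for y
  define T where "T = (rad_lap (2 * m) ^^ m) (bump m)"
  have m1: "m \<ge> 1" using m DIM_positive[where 'a='a] by linarith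
  have sv: "smooth v" using u b by (simp add: v_def smooth_partial)
  have sf: "smooth f" using u by (simp add: f_def smooth_neg_laplacian_pow)
  have cv: "continuous_on UNIV v" and cf: "continuous_on UNIV f"
    using sv sf by (auto intro: C1_cont smooth_C1)
  have T: "trunc_power 1 3 T" unfolding T_def by (rule trunc_power_bump_pow)
  have cT: "continuous_on UNIV T" by (rule trunc_power_continuous[OF T])
  have Tr: "(rad_lap (2 * m) ^^ m) (\<lambda>s. bump m (s / r\<^sup>2)) = (\<lambda>s. T (s / r\<^sup>2) / (r\<^sup>2) ^ m)" for r
    unfolding T_def using trunc_power_bump[of m] by (intro rad_lap_pow_scale) auto
  have Suc3: "2 * m + 3 = Suc (2 * m + 2)" by simp
  have db: "(bump m has_real_derivative deriv (bump m) s) (at s)" and tdb: "trunc_power 1 (2 * m + 2) (deriv (bump m))" for s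
    using trunc_power_deriv[of 1 "2 * m + 2" "bump m"] trunc_power_bump[of m, unfolded Suc3] by simp_all
  have cdb: "continuous_on UNIV (deriv (bump m))" by (rule trunc_power_continuous[OF tdb])
  \<comment> \<open>All kernels at scales up to \<open>N\<close> live in the ball of radius
    \<open>N\<close> about \<open>c\<close>, as \<open>fubini_compact\<close> demands.\<close>
  have out: "S y / r\<^sup>2 \<ge> 1" if "y \<notin> cball c N" "r \<in> {\<epsilon>..N}" for y r
  proof -
    have "N < norm (y - c)" using that by (simp add: dist_norm norm_minus_commute)
    then have "r \<le> norm (y - c)" using that by auto
    then have "r\<^sup>2 \<le> S y" unfolding S_def power2_norm_eq_inner[symmetric] using that \<epsilon>N by (intro power_mono) auto
    then show ?thesis using that \<epsilon>N by simp
  qed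
  have fub1: "(LBINT y. (LBINT r. indicator {\<epsilon>..N} r *\<^sub>R (v y * (- (2 / r) * (T (S y / r\<^sup>2) / (r\<^sup>2) ^ m)))))
     = (LBINT r. indicator {\<epsilon>..N} r *\<^sub>R (LBINT y. v y * (- (2 / r) * (T (S y / r\<^sup>2) / (r\<^sup>2) ^ m))))"
  proof (rule fubini_compact)
    show "continuous_on (cball c N \<times> {\<epsilon>..N}) (\<lambda>(y, r). v y * (- (2 / r) * (T (S y / r\<^sup>2) / (r\<^sup>2) ^ m)))"
      unfolding case_prod_unfold S_def using \<epsilon>N
      by (intro continuous_intros continuous_on_compose2[OF cT] continuous_on_compose2[OF cv]) auto
    show "v y * (- (2 / r) * (T (S y / r\<^sup>2) / (r\<^sup>2) ^ m)) = 0" if "y \<notin> cball c N" "r \<in> {\<epsilon>..N}" for y r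
      using trunc_power_zero[OF T _ out[OF that]] by simp
  qed
  have fub2: "(LBINT y. (LBINT r. indicator {\<epsilon>..N} r *\<^sub>R (f y * (4 * ((y - c) \<bullet> b) * deriv (bump m) (S y / r\<^sup>2) / r ^ 3))))
     = (LBINT r. indicator {\<epsilon>..N} r *\<^sub>R (LBINT y. f y * (4 * ((y - c) \<bullet> b) * deriv (bump m) (S y / r\<^sup>2) / r ^ 3)))"
  proof (rule fubini_compact)
    show "continuous_on (cball c N \<times> {\<epsilon>..N}) (\<lambda>(y, r). f y * (4 * ((y - c) \<bullet> b) * deriv (bump m) (S y / r\<^sup>2) / r ^ 3))"
      unfolding case_prod_unfold S_def using \<epsilon>N
      by (intro continuous_intros continuous_on_compose2[OF cdb] continuous_on_compose2[OF cf]) auto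
    show "f y * (4 * ((y - c) \<bullet> b) * deriv (bump m) (S y / r\<^sup>2) / r ^ 3) = 0" if "y \<notin> cball c N" "r \<in> {\<epsilon>..N}" for y r
      using trunc_power_zero[OF tdb _ out[OF that]] by simp
  qed
  have slice: "(LBINT y. v y * (- (2 / r) * (T (S y / r\<^sup>2) / (r\<^sup>2) ^ m)))
      = (LBINT y. f y * (4 * ((y - c) \<bullet> b) * deriv (bump m) (S y / r\<^sup>2) / r ^ 3))" if r: "r \<in> {\<epsilon>..N}" for r
  proof -
    have r0: "r > 0" using r \<epsilon>N by auto
    let ?F = "\<lambda>s. bump m (s / r\<^sup>2)"
    have tF: "trunc_power (r\<^sup>2) (2 * m + 3) ?F"
      by (rule trunc_power_scale[OF trunc_power_bump]) (use r0 in simp)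
    then have tF': "trunc_power (r\<^sup>2) (Suc (Suc (2 * m + 1))) ?F" by (simp add: numeral_3_eq_3)
    have "((\<lambda>s. bump m (s / r\<^sup>2)) has_real_derivative deriv (bump m) (s / r\<^sup>2) * (1 / r\<^sup>2)) (at s)" for s
      by (intro DERIV_chain2[OF db] DERIV_cdivide DERIV_ident)
    then have dF: "deriv ?F = (\<lambda>s. deriv (bump m) (s / r\<^sup>2) / r\<^sup>2)"
      using DERIV_imp_deriv by fastforce
    have "(LBINT y. v y * (- (2 / r) * (T (S y / r\<^sup>2) / (r\<^sup>2) ^ m)))
      = (LBINT y. - (2 / r) * (v y * radial c ((rad_lap (2 * m) ^^ m) ?F) y))"
      unfolding Tr by (simp add: radial_def S_def mult_ac)
    also have "\<dots> = - (2 / r) * (LBINT y. v y * radial c ((rad_lap (2 * m) ^^ m) ?F) y)"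
      by (rule integral_mult_right_zero)
    also have "(LBINT y. v y * radial c ((rad_lap (2 * m) ^^ m) ?F) y) = (LBINT y. (neg_laplacian ^^ m) v y * radial c ?F y)"
      using integral_neg_laplacian_pow_radial[OF sv tF, of c] m by simp
    also have "(neg_laplacian ^^ m) v = partial_deriv b f"
      unfolding v_def f_def by (rule neg_laplacian_pow_partial[OF u b])
    also have "(LBINT y. partial_deriv b f y * radial c ?F y) = - (LBINT y. f y * partial_deriv b (radial c ?F) y)"
      using radial_trunc_power(1)[OF tF'] bounded_support_radial[OF tF'] b sf
      by (intro integral_by_parts C2_C1 smooth_C1) auto
    also have "partial_deriv b (radial c ?F) = (\<lambda>y. 2 * ((y - c) \<bullet> b) * (deriv (bump m) (S y / r\<^sup>2) / r\<^sup>2))"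
      by (subst radial_trunc_power(3)[OF tF']) (simp_all add: dF S_def)
    also have "- (2 / r) * - (LBINT y. f y * (2 * ((y - c) \<bullet> b) * (deriv (bump m) (S y / r\<^sup>2) / r\<^sup>2)))
       = (LBINT y. (2 / r) * (f y * (2 * ((y - c) \<bullet> b) * (deriv (bump m) (S y / r\<^sup>2) / r\<^sup>2))))"
      by (subst integral_mult_right_zero) simp
    also have "\<dots> = (LBINT y. f y * (4 * ((y - c) \<bullet> b) * deriv (bump m) (S y / r\<^sup>2) / r ^ 3))"
      using r0 by (intro Bochner_Integration.integral_cong refl) (simp add: power2_eq_square power3_eq_cube mult_ac)
    finally show ?thesis .
  qed
  have inner1: "(LBINT r. indicator {\<epsilon>..N} r *\<^sub>R (v y * (- (2 / r) * (T (S y / r\<^sup>2) / (r\<^sup>2) ^ m))))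
     = v y * (profile m (S y / N\<^sup>2) / N ^ (2 * m) - profile m (S y / \<epsilon>\<^sup>2) / \<epsilon> ^ (2 * m))" for y
  proof -
    have "(LBINT r. indicator {\<epsilon>..N} r *\<^sub>R (v y * (- (2 / r) * (T (S y / r\<^sup>2) / (r\<^sup>2) ^ m))))
     = v y * (profile m (S y / N\<^sup>2) / N ^ (2 * m)) - v y * (profile m (S y / \<epsilon>\<^sup>2) / \<epsilon> ^ (2 * m))"
    proof (rule integral_FTC_atLeastAtMost)
      fix r assume r: "\<epsilon> \<le> r" "r \<le> N"
      then have "r > 0" using \<epsilon>N by auto
      from DERIV_cmult[OF profile_scale_derivative[OF m1 this, of "S y"], of "v y"]
      show "((\<lambda>r. v y * (profile m (S y / r\<^sup>2) / r ^ (2 * m))) has_vector_derivative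
          v y * (- (2 / r) * (T (S y / r\<^sup>2) / (r\<^sup>2) ^ m))) (at r within {\<epsilon>..N})"
        unfolding Tr by (simp add: has_real_derivative_iff_has_vector_derivative has_vector_derivative_at_within)
    next
      show "continuous_on {\<epsilon>..N} (\<lambda>r. v y * (- (2 / r) * (T (S y / r\<^sup>2) / (r\<^sup>2) ^ m)))"
        using \<epsilon>N by (intro continuous_intros continuous_on_compose2[OF cT]) auto
    qed (use \<epsilon>N in auto)
    then show ?thesis by (simp add: right_diff_distrib)
  qed
  \<comment> \<open>The r-derivative of \<open>bump m (S y / r\<^sup>2)\<close> is -2 S / r^3 times
    the derivative of the bump, so the integrand is -2 ((y - c) . b) / S times an exact derivative.
    At y = c both sides are 0.\<close>
  have inner2: "(LBINT r. indicator {\<epsilon>..N} r *\<^sub>R (f y * (4 * ((y - c) \<bullet> b) * deriv (bump m) (S y / r\<^sup>2) / r ^ 3)))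
     = f y * (- 2 * ((y - c) \<bullet> b) / S y * (bump m (S y / N\<^sup>2) - bump m (S y / \<epsilon>\<^sup>2)))" for y
  proof (cases "y = c")
    case False
    then have S0: "S y > 0" by (simp add: S_def)
    define k where "k = f y * (- 2 * ((y - c) \<bullet> b) / S y)"
    have "(LBINT r. indicator {\<epsilon>..N} r *\<^sub>R (f y * (4 * ((y - c) \<bullet> b) * deriv (bump m) (S y / r\<^sup>2) / r ^ 3)))
     = k * bump m (S y / N\<^sup>2) - k * bump m (S y / \<epsilon>\<^sup>2)"
    proof (rule integral_FTC_atLeastAtMost)
      fix r assume r: "\<epsilon> \<le> r" "r \<le> N"
      then have r0: "r > 0" using \<epsilon>N by auto
      have "((\<lambda>r. S y / r\<^sup>2) has_real_derivative - 2 * S y / r ^ 3) (at r)"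
        using r0 by (auto intro!: derivative_eq_intros simp: field_simps power2_eq_square power3_eq_cube)
      from DERIV_cmult[OF DERIV_chain2[OF db this], of k]
      have "((\<lambda>r. k * bump m (S y / r\<^sup>2)) has_real_derivative f y * (4 * ((y - c) \<bullet> b) * deriv (bump m) (S y / r\<^sup>2) / r ^ 3)) (at r)"
        by (rule DERIV_cong) (use S0 r0 in \<open>simp add: k_def field_simps\<close>)
      then show "((\<lambda>r. k * bump m (S y / r\<^sup>2)) has_vector_derivative
          f y * (4 * ((y - c) \<bullet> b) * deriv (bump m) (S y / r\<^sup>2) / r ^ 3)) (at r within {\<epsilon>..N})"
        by (simp add: has_real_derivative_iff_has_vector_derivative has_vector_derivative_at_within)
    next
      show "continuous_on {\<epsilon>..N} (\<lambda>r. f y * (4 * ((y - c) \<bullet> b) * deriv (bump m) (S y / r\<^sup>2) / r ^ 3))"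
        using \<epsilon>N by (intro continuous_intros continuous_on_compose2[OF cdb]) auto
    qed (use \<epsilon>N in auto)
    then show ?thesis by (simp add: k_def right_diff_distrib)
  qed auto
  have "(LBINT y. v y * (profile m (S y / N\<^sup>2) / N ^ (2 * m) - profile m (S y / \<epsilon>\<^sup>2) / \<epsilon> ^ (2 * m)))
      = (LBINT r. indicator {\<epsilon>..N} r *\<^sub>R (LBINT y. v y * (- (2 / r) * (T (S y / r\<^sup>2) / (r\<^sup>2) ^ m))))"
    using fub1 unfolding inner1 .
  also have "\<dots> = (LBINT r. indicator {\<epsilon>..N} r *\<^sub>R (LBINT y. f y * (4 * ((y - c) \<bullet> b) * deriv (bump m) (S y / r\<^sup>2) / r ^ 3)))"
  proof (intro Bochner_Integration.integral_cong refl)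
    fix r
    show "indicator {\<epsilon>..N} r *\<^sub>R (LBINT y. v y * (- (2 / r) * (T (S y / r\<^sup>2) / (r\<^sup>2) ^ m)))
      = indicator {\<epsilon>..N} r *\<^sub>R (LBINT y. f y * (4 * ((y - c) \<bullet> b) * deriv (bump m) (S y / r\<^sup>2) / r ^ 3))"
    proof (cases "r \<in> {\<epsilon>..N}")
      case True
      then show ?thesis by (simp only: slice)
    next
      case False
      then show ?thesis by simp
    qed
  qed
  also have "\<dots> = (LBINT y. f y * (- 2 * ((y - c) \<bullet> b) / S y * (bump m (S y / N\<^sup>2) - bump m (S y / \<epsilon>\<^sup>2))))"
    using fub2 unfolding inner2 by simp
  finally show ?thesis by (simp add: v_def f_def S_def radial_def)
qed

section \<open>The mass of the profile\<close>

text \<open>For F supported in s <= 1, the integral of F(|x|^2) over R^(2m) is a constant times the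
  moment of order m - 1.\<close>

definition moment :: "nat \<Rightarrow> (real \<Rightarrow> real) \<Rightarrow> real" where
  "moment j F = (LBINT s. indicator {0..1} s *\<^sub>R (s ^ j * F s))"

lemma moment_integrable:
  assumes "continuous_on UNIV F"
  shows "integrable lborel (\<lambda>s::real. indicator {0..1} s *\<^sub>R (s ^ j * F s))"
  by (intro borel_integrable_compact continuous_intros continuous_on_subset[OF assms]) auto

lemma moment_deriv:
  assumes F: "trunc_power 1 (Suc l) F" "l \<ge> 1"
  shows "moment (Suc j) (deriv F) = - real (Suc j) * moment j F" and "moment 0 (deriv F) = - F 0"
proof -
  note d = trunc_power_deriv[OF F]
  have c: "continuous_on UNIV F" "continuous_on UNIV (deriv F)"
    using trunc_power_continuous F d(2) by blast+
  have F1: "F 1 = 0" using trunc_power_zero[OF F(1)] by simp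
  have "(LBINT s. indicator {0..1} s *\<^sub>R (s ^ Suc j * deriv F s + real (Suc j) * s ^ j * F s)) = 1 ^ Suc j * F 1 - 0 ^ Suc j * F 0"
  proof (rule integral_FTC_atLeastAtMost)
    fix s :: real assume "0 \<le> s" "s \<le> 1"
    have "((\<lambda>s. s ^ Suc j * F s) has_real_derivative s ^ Suc j * deriv F s + real (Suc j) * s ^ j * F s) (at s)"
      by (rule derivative_eq_intros d(1) refl | simp)+
    then show "((\<lambda>s. s ^ Suc j * F s) has_vector_derivative s ^ Suc j * deriv F s + real (Suc j) * s ^ j * F s) (at s within {0..1})"
      by (simp add: has_real_derivative_iff_has_vector_derivative has_vector_derivative_at_within)
  next
    show "continuous_on {0..1} (\<lambda>s. s ^ Suc j * deriv F s + real (Suc j) * s ^ j * F s)"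
      by (intro continuous_intros continuous_on_subset[OF c(1)] continuous_on_subset[OF c(2)]) auto
  qed simp
  moreover have "(LBINT s. indicator {0..1} s *\<^sub>R (s ^ Suc j * deriv F s + real (Suc j) * s ^ j * F s))
    = (LBINT s. indicator {0..1} s *\<^sub>R (s ^ Suc j * deriv F s) + real (Suc j) * (indicator {0..1} s *\<^sub>R (s ^ j * F s)))"
    by (intro Bochner_Integration.integral_cong refl) (simp add: algebra_simps)
  moreover have "\<dots> = moment (Suc j) (deriv F) + real (Suc j) * moment j F"
    unfolding moment_def
    by (subst Bochner_Integration.integral_add, (intro moment_integrable c integrable_mult_right)+,
        (subst integral_mult_right_zero)+, rule refl)
  ultimately have "moment (Suc j) (deriv F) + real (Suc j) * moment j F = 0" using F1 by simp
  then show "moment (Suc j) (deriv F) = - real (Suc j) * moment j F" by (simp add: algebra_simps)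
  have "(LBINT s. indicator {0..1} s *\<^sub>R (s ^ 0 * deriv F s)) = F 1 - F 0"
  proof (rule integral_FTC_atLeastAtMost)
    fix s :: real assume "0 \<le> s" "s \<le> 1"
    show "(F has_vector_derivative s ^ 0 * deriv F s) (at s within {0..1})"
      using d(1)[of s] by (simp add: has_real_derivative_iff_has_vector_derivative has_vector_derivative_at_within)
  next
    show "continuous_on {0..1} (\<lambda>s. s ^ 0 * deriv F s)"
      by (intro continuous_intros continuous_on_subset[OF c(2)]) auto
  qed simp
  then show "moment 0 (deriv F) = - F 0" using F1 by (simp add: moment_def)
qed

text \<open>One integration by parts in the second-order term. The factor vanishes at j = m - 1, the
  order that represents integration over R^(2m), as it must: Laplacians of compactly supported
  functions have integral zero.\<close>

lemma moment_rad_lap: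
  assumes F: "trunc_power 1 (Suc (Suc l)) F" "l \<ge> 1"
  shows "moment j (rad_lap (2 * m) F) = 4 * (real j + 1 - real m) * moment j (deriv F)"
proof -
  have d: "trunc_power 1 (Suc l) (deriv F)" using F by (intro trunc_power_deriv) auto
  have d2: "trunc_power 1 l (deriv (deriv F))" using d F by (intro trunc_power_deriv) auto
  note c = trunc_power_continuous[OF d] trunc_power_continuous[OF d2]
  have "moment j (rad_lap (2 * m) F) = (LBINT s. - 4 * (indicator {0..1} s *\<^sub>R (s ^ Suc j * deriv (deriv F) s)) +
     - 4 * real m * (indicator {0..1} s *\<^sub>R (s ^ j * deriv F s)))"
    unfolding moment_def rad_lap_def
    by (intro Bochner_Integration.integral_cong refl) (simp add: algebra_simps)
  also have "\<dots> = - 4 * moment (Suc j) (deriv (deriv F)) + - 4 * real m * moment j (deriv F)"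
    unfolding moment_def
    by (subst Bochner_Integration.integral_add, (intro moment_integrable c integrable_mult_right)+,
        (subst integral_mult_right_zero)+, rule refl)
  finally show ?thesis using moment_deriv(1)[OF d F(2)] by (simp add: algebra_simps)
qed

text \<open>Each step lowers the order of the moment and the number of Laplacians by one, until
  order 0 leaves only the boundary value \<open>F 0\<close>. The factorial on the left completes the
  product (m-1)(m-2)...(m-1-j) to \<open>fact (m - 1)\<close>; the bound on \<open>j\<close> stops
  before the factor that vanishes.\<close>

lemma moment_rad_lap_pow:
  assumes F: "trunc_power 1 (2 * Suc j + l) F" "l \<ge> 1" and j: "j + 2 \<le> m"
  shows "moment j ((rad_lap (2 * m) ^^ Suc j) F) * fact (m - 2 - j) = 4 ^ Suc j * fact j * fact (m - 1) * F 0"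
  using F j
proof (induction j arbitrary: l)
  case 0
  then have F: "trunc_power 1 (Suc (Suc l)) F" by simp
  obtain k where k: "m = Suc (Suc k)" using 0(3) le_Suc_ex[of 2 m] by auto
  have "moment 0 (rad_lap (2 * m) F) = 4 * (1 - real m) * (- F 0)"
    using moment_rad_lap[OF F 0(2)] moment_deriv(2)[OF F] by simp
  then show ?case by (simp add: k algebra_simps)
next
  case (Suc j)
  define G where "G = (rad_lap (2 * m) ^^ Suc j) F"
  have G: "trunc_power 1 (Suc (Suc l)) G"
    using Suc.prems(1,2) unfolding G_def by (intro trunc_power_rad_lap_pow) auto
  obtain k where k: "m = j + 3 + k" using Suc.prems(3) le_Suc_ex[of "j + 3" m] by auto
  have IH: "moment j G * fact (m - 2 - j) = 4 ^ Suc j * fact j * fact (m - 1) * F 0"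
    unfolding G_def using Suc.prems by (intro Suc.IH[of "Suc (Suc l)"]) auto
  have M: "moment (Suc j) (rad_lap (2 * m) G) = 4 * (real (Suc j) + 1 - real m) * (- real (Suc j) * moment j G)"
    using moment_rad_lap[OF G Suc.prems(2)] moment_deriv(1)[OF G] by simp
  have e: "m - 2 - j = Suc k" "m - 2 - Suc j = k" "real m = real j + 3 + real k" using k by auto
  have "moment (Suc j) (rad_lap (2 * m) G) * fact (m - 2 - Suc j) = 4 * real (Suc j) * (moment j G * fact (m - 2 - j))"
    unfolding M e by (simp add: algebra_simps)
  also have "\<dots> = 4 ^ Suc (Suc j) * fact (Suc j) * fact (m - 1) * F 0"
    unfolding IH by simp
  finally show ?case by (simp add: G_def)
qed

text \<open>Layer-cake formula instead of polar coordinates: F(|x|^2) is minus the integral of F'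
  from |x|^2 to 1, and exchanging the integrals leaves the volume of the ball of radius sqrt s, a
  constant times s^m.\<close>

lemma integral_radial:
  assumes F: "trunc_power 1 (Suc l) F" "l \<ge> 1" and m: "DIM('a::euclidean_space) = 2 * m"
  shows "(LBINT (x::'a). radial 0 F x) = - unit_ball_vol (2 * m) * moment m (deriv F)"
proof -
  note d = trunc_power_deriv[OF F]
  have c: "continuous_on UNIV (deriv F)" by (rule trunc_power_continuous[OF d(2)])
  define K where "K = cball (0::'a) 1 \<times> {0..1::real}"
  define H where "H = (\<lambda>(x::'a) s. indicator K (x, s) * deriv F s * indicator {z. fst z \<bullet> fst z \<le> snd z} (x, s))"
  have iK: "integrable lborel (\<lambda>z. indicator K z *\<^sub>R deriv F (snd z))"
    unfolding K_def by (intro borel_integrable_compact compact_Times compact_cball compact_Icc continuous_on_compose2[OF c] continuous_intros) auto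
  have "closed {z::'a \<times> real. fst z \<bullet> fst z \<le> snd z}"
    by (intro closed_Collect_le continuous_intros)
  then have "{z::'a \<times> real. fst z \<bullet> fst z \<le> snd z} \<in> sets lborel" by simp
  from integrable_real_mult_indicator[OF this iK]
  have "integrable (lborel \<Otimes>\<^sub>M lborel) (case_prod H)"
    by (simp add: lborel_prod H_def case_prod_unfold)
  from lborel_pair.Fubini_integral[OF this]
  have fub: "(LBINT s. (LBINT x. H x s)) = (LBINT x. (LBINT s. H x s))" .
  have in1: "(LBINT s. H x s) = - radial 0 F x" for x
  proof (cases "x \<bullet> x \<le> 1")
    case True
    have "norm x \<le> 1" using True by (simp add: norm_le_square flip: power2_norm_eq_inner)
    have "(LBINT s. H x s) = (LBINT s. indicator {x \<bullet> x..1} s *\<^sub>R deriv F s)"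
      using \<open>norm x \<le> 1\<close>
      by (intro Bochner_Integration.integral_cong refl)
         (auto simp: H_def K_def indicator_def dest: order_trans[OF inner_ge_zero])
    also have "\<dots> = F 1 - F (x \<bullet> x)"
      by (rule integral_FTC_atLeastAtMost)
         (use True d(1) in \<open>auto simp: has_real_derivative_iff_has_vector_derivative has_vector_derivative_at_within
           intro: continuous_on_subset[OF c]\<close>)
    finally show ?thesis using trunc_power_zero[OF F(1), of 1] by (simp add: radial_def)
  next
    case False
    then have "(\<lambda>s. H x s) = (\<lambda>s. 0)" by (auto simp: H_def K_def indicator_def)
    then show ?thesis using False trunc_power_zero[OF F(1), of "x \<bullet> x"] by (simp add: radial_def)
  qed
  have in2: "(LBINT x. H x s) = unit_ball_vol (2 * m) * (indicator {0..1} s *\<^sub>R (s ^ m * deriv F s))" for s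
  proof (cases "s \<in> {0..1}")
    case True
    have "(LBINT x. H x s) = (LBINT x. indicator (cball (0::'a) (sqrt s)) x * deriv F s)"
    proof (intro Bochner_Integration.integral_cong refl)
      fix x :: 'a
      have "x \<bullet> x \<le> s \<longleftrightarrow> norm x \<le> sqrt s"
        by (simp add: norm_eq_sqrt_inner)
      moreover have "norm x \<le> sqrt s \<Longrightarrow> norm x \<le> 1" using True order_trans[of "norm x" "sqrt s" 1] by auto
      ultimately show "H x s = indicator (cball 0 (sqrt s)) x * deriv F s"
        using True by (auto simp: H_def K_def indicator_def)
    qed
    also have "\<dots> = measure lborel (cball (0::'a) (sqrt s)) * deriv F s"
      by simp
    also have "measure lborel (cball (0::'a) (sqrt s)) = unit_ball_vol (2 * m) * s ^ m"
      using True content_cball[of "sqrt s" "0::'a"] m by (simp add: power_mult)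
    finally show ?thesis using True by simp
  qed (auto simp: H_def K_def)
  from fub show ?thesis unfolding in1 in2 by (simp add: moment_def)
qed

text \<open>Two integrations by parts lower the moment of order m of the second derivative of G to
  the moment of order m - 2 of G, which is the extreme case j = m - 2 of
  \<open>moment_rad_lap_pow\<close>. By \<open>unit_sphere_volume_even\<close> the value is (n-1)!
  |S^n|.\<close>

lemma integral_profile:
  assumes m: "DIM('a::euclidean_space) = 2 * m" "m \<ge> 2"
  shows "(LBINT (x::'a). radial 0 (profile m) x) = (4 * pi) ^ m * fact (m - 1)"
proof -
  define G where "G = (rad_lap (2 * m) ^^ (m - 1)) (bump m)"
  have G: "trunc_power 1 (Suc 4) G" using trunc_power_profile_aux[of m] m by (simp add: G_def)
  have d1: "trunc_power 1 (Suc 3) (deriv G)" using trunc_power_deriv(2)[OF G] by simp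
  obtain k where k: "m = Suc (Suc k)" using m by (metis add_2_eq_Suc le_iff_add)
  have p: "radial (0::'a) (profile m) = (\<lambda>x. - 4 * radial 0 (deriv G) x)"
    by (simp add: radial_def profile_def G_def fun_eq_iff)
  have "trunc_power 1 (2 * Suc k + 5) (bump m)" using trunc_power_bump[of m] k
    by (simp add: algebra_simps)
  from moment_rad_lap_pow[OF this, of m]
  have M: "moment k G = 4 ^ Suc k * fact k * fact (Suc k)"
    using k by (simp add: G_def bump_def)
  have "(LBINT (x::'a). radial 0 (profile m) x) = - 4 * (LBINT (x::'a). radial 0 (deriv G) x)"
    unfolding p by (rule integral_mult_right_zero)
  also have "\<dots> = 4 * unit_ball_vol (2 * m) * moment m (deriv (deriv G))"
    using integral_radial[OF d1 _ m(1)] by simp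
  also have "moment m (deriv (deriv G)) = real m * real (m - 1) * moment k G"
    using moment_deriv(1)[OF d1, of "Suc k"] moment_deriv(1)[OF G, of k] by (simp add: k algebra_simps)
  also have "unit_ball_vol (2 * m) = pi ^ m / fact m"
    using unit_ball_vol_even[of m] by simp
  finally have I: "(LBINT (x::'a). radial 0 (profile m) x) = 4 * (pi ^ m / fact m) *
      (real m * real (m - 1) * (4 ^ Suc k * fact k * fact (Suc k)))" unfolding M .
  define X where "X = real m * real (m - 1)"
  have X: "X \<noteq> 0" "fact m = X * fact k" using k by (simp_all add: X_def)
  have "(4 * pi) ^ m = 4 * 4 ^ Suc k * pi ^ m" using k by (simp add: power_mult_distrib)
  moreover have "m - 1 = Suc k" using k by simp
  ultimately show ?thesis unfolding I X_def[symmetric] using X by simp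
qed

section \<open>The gradient of a normal solution\<close>

lemma half_power_cube: "((1/2::real) ^ j) ^ 3 = 1 / 8 ^ j"
proof -
  have "((1/2::real) ^ j) ^ 3 = ((1/2) ^ 3) ^ j" by (simp only: power_mult[symmetric] mult.commute)
  also have "(1/2::real) ^ 3 = 1 / 8" by (simp add: power3_eq_cube)
  finally show ?thesis by (simp add: power_one_over)
qed

lemma le_suminf_ennreal: "f k \<le> suminf (f :: nat \<Rightarrow> ennreal)"
  using sum_le_suminf[of f "{k}"] by simp

lemma borel_measurable_ball_inverse_norm_cube:
  fixes p :: "'a::euclidean_space"
  shows "(\<lambda>x. indicator (ball p 1) x / norm (x - p) ^ 3 :: real) \<in> borel_measurable borel"
  by (intro borel_measurable_divide borel_measurable_indicator borel_measurable_continuous_onI continuous_intros) auto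

text \<open>Dyadic shells: between the radii 2^-(k+1) and 2^-k the integrand is at most 8^(k+1),
  while the ball of radius 2^-k has volume of order 2^(-nk). With n >= 4 the series is dominated by
  a geometric one of ratio 1/2.\<close>

lemma integrable_inverse_norm_cube_ball:
  assumes n: "DIM('a::euclidean_space) \<ge> 4"
  shows "integrable lborel (\<lambda>x::'a. indicator (ball 0 1) x / norm x ^ 3)"
proof (rule integrableI_bounded)
  let ?\<omega> = "unit_ball_vol DIM('a)"
  have \<omega>: "?\<omega> \<ge> 0" by simp
  have "(\<integral>\<^sup>+(x::'a). ennreal (norm (indicator (ball 0 1) x / norm x ^ 3)) \<partial>lborel)
      \<le> (\<integral>\<^sup>+(x::'a). (\<Sum>k. ennreal (8 ^ Suc k) * indicator (ball 0 ((1/2) ^ k)) x) \<partial>lborel)"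
  proof (rule nn_integral_mono)
    fix x :: 'a
    show "ennreal (norm (indicator (ball 0 1) x / norm x ^ 3)) \<le> (\<Sum>k. ennreal (8 ^ Suc k) * indicator (ball 0 ((1/2) ^ k)) x)"
    proof (cases "x \<in> ball 0 1 \<and> x \<noteq> 0")
      case True
      then have x: "0 < norm x" "norm x < 1" by auto
      have "\<exists>k. (1/2) ^ k \<le> norm x" using x real_arch_pow_inv[of "norm x" "1/2"] by (auto intro: less_imp_le)
      then obtain j where j: "(1/2) ^ j \<le> norm x" "\<And>i. i < j \<Longrightarrow> \<not> (1/2) ^ i \<le> norm x"
        using exists_least_iff[of "\<lambda>k. (1/2) ^ k \<le> norm x"] by blast
      obtain k where k: "j = Suc k" using j(1) x by (cases j) auto
      have l: "norm x < (1/2) ^ k" using j(2)[of k] k by simp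
      have "1 / norm x ^ 3 \<le> 1 / ((1/2) ^ Suc k) ^ 3"
        using j(1) x k by (intro divide_left_mono power_mono) auto
      also have "((1/2::real) ^ Suc k) ^ 3 = 1 / 8 ^ Suc k"
        by (rule half_power_cube)
      finally have "1 / norm x ^ 3 \<le> 8 ^ Suc k" by simp
      then have "ennreal (norm (indicator (ball 0 1) x / norm x ^ 3)) \<le> ennreal (8 ^ Suc k) * indicator (ball 0 ((1/2) ^ k)) x"
        using l x by (auto simp: ennreal_leI)
      also have "\<dots> \<le> (\<Sum>k. ennreal (8 ^ Suc k) * indicator (ball 0 ((1/2) ^ k)) x)"
        by (rule le_suminf_ennreal)
      finally show ?thesis .
    qed auto
  qed
  also have "\<dots> = (\<Sum>k. ennreal (8 ^ Suc k) * emeasure lborel (ball (0::'a) ((1/2) ^ k)))"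
    by (subst nn_integral_suminf, intro borel_measurable_times_ennreal borel_measurable_const borel_measurable_indicator)
       (simp_all add: nn_integral_cmult_indicator)
  also have "\<dots> \<le> (\<Sum>k. ennreal (8 * ?\<omega> * (1/2) ^ k))"
  proof (intro suminf_le summableI)
    fix k
    have pk: "((1/2::real) ^ k) ^ DIM('a) = ((1/2) ^ DIM('a)) ^ k"
      by (simp only: power_mult[symmetric] mult.commute)
    have "(1/2::real) ^ DIM('a) \<le> (1/2) ^ 4" using n by (intro power_decreasing) auto
    then have "((1/2::real) ^ DIM('a)) ^ k \<le> ((1/2) ^ 4) ^ k" by (rule power_mono) simp
    then have "8 ^ Suc k * (?\<omega> * ((1/2) ^ k) ^ DIM('a)) \<le> 8 ^ Suc k * (?\<omega> * (((1/2) ^ 4) ^ k))"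
      using \<omega> unfolding pk by (intro mult_left_mono) auto
    also have "\<dots> = 8 * ?\<omega> * (8 * (1/2) ^ 4) ^ k" by (simp add: power_mult_distrib)
    also have "8 * (1/2::real) ^ 4 = 1/2" by (simp add: power_divide)
    finally have "8 ^ Suc k * (?\<omega> * ((1/2) ^ k) ^ DIM('a)) \<le> 8 * ?\<omega> * (1/2) ^ k" .
    then show "ennreal (8 ^ Suc k) * emeasure lborel (ball (0::'a) ((1/2) ^ k)) \<le> ennreal (8 * ?\<omega> * (1/2) ^ k)"
      using \<omega> by (subst emeasure_ball) (auto simp: ennreal_mult[symmetric] intro!: ennreal_leI)
  qed
  also have "\<dots> < \<infinity>"
    using \<omega> by (subst suminf_ennreal2) (auto intro!: summable_mult summable_geometric)
  finally show "(\<integral>\<^sup>+(x::'a). ennreal (norm (indicator (ball 0 1) x / norm x ^ 3)) \<partial>lborel) < \<infinity>" .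
qed (use borel_measurable_ball_inverse_norm_cube[of 0] in simp)

lemma integrable_inverse_norm_cube:
  fixes p :: "'a::euclidean_space"
  assumes n: "DIM('a) \<ge> 4"
  shows "integrable lborel (\<lambda>x. indicator (ball p 1) x / norm (x - p) ^ 3)"
    and "(LBINT x. indicator (ball p 1) x / norm (x - p) ^ 3) = (LBINT (x::'a). indicator (ball 0 1) x / norm x ^ 3)"
proof -
  have e: "indicator (ball p 1) (p + 1 *\<^sub>R x) / norm (p + 1 *\<^sub>R x - p) ^ 3 = (indicator (ball 0 1) x / norm x ^ 3 :: real)" for x
  proof -
    have "p + 1 *\<^sub>R x \<in> ball p 1 \<longleftrightarrow> x \<in> ball 0 1" by (simp add: dist_norm)
    then show ?thesis by (simp only: indicator_def scaleR_one add_diff_cancel_left')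
  qed
  show "integrable lborel (\<lambda>x. indicator (ball p 1) x / norm (x - p) ^ 3)"
    using lborel_scale(1)[OF zero_less_one borel_measurable_ball_inverse_norm_cube[of p], of p] integrable_inverse_norm_cube_ball[OF n]
    unfolding e by blast
  show "(LBINT x. indicator (ball p 1) x / norm (x - p) ^ 3) = (LBINT (x::'a). indicator (ball 0 1) x / norm x ^ 3)"
    using lborel_scale(2)[OF zero_less_one borel_measurable_ball_inverse_norm_cube[of p], of p]
    unfolding e by simp
qed

text \<open>Within distance 1 of \<open>c\<close> continuity bounds \<open>f\<close> and the inverse
  cube dominates; farther away the weight is at most 1. The case k = 1 serves the kernel of the
  representation, k = 3 the rescaled gradients.\<close>

lemma integrable_div_norm_power:
  fixes f :: "'a::euclidean_space \<Rightarrow> real"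
  assumes n: "DIM('a) \<ge> 4" and k: "k \<le> 3" and f: "continuous_on UNIV f" "integrable lborel f"
  shows "integrable lborel (\<lambda>y. f y / norm (y - c) ^ k)"
proof -
  have meas: "(\<lambda>y. f y / norm (y - c) ^ k) \<in> borel_measurable borel"
    by (intro borel_measurable_divide borel_measurable_continuous_onI f continuous_intros)
  have "compact (f ` cball c 1)"
    by (intro compact_continuous_image continuous_on_subset[OF f(1)]) auto
  then obtain C where C: "\<And>x. x \<in> cball c 1 \<Longrightarrow> \<bar>f x\<bar> \<le> C"
    using compact_imp_bounded bounded_iff by (metis imageI real_norm_def)
  have C0: "0 \<le> C" using order_trans[OF abs_ge_zero C[of c]] by simp
  show ?thesis
  proof (rule Bochner_Integration.integrable_bound)
    show "integrable lborel (\<lambda>y. norm (f y) + C * (indicator (ball c 1) y / norm (y - c) ^ 3))"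
      by (intro Bochner_Integration.integrable_add integrable_norm integrable_mult_right f integrable_inverse_norm_cube(1)[OF n])
    show "AE y in lborel. norm (f y / norm (y - c) ^ k) \<le> norm (norm (f y) + C * (indicator (ball c 1) y / norm (y - c) ^ 3))"
    proof (rule AE_I2)
      fix y
      let ?i = "indicator (ball c 1) y / norm (y - c) ^ 3 :: real"
      have i0: "0 \<le> ?i" by (simp add: indicator_def)
      have "norm (f y / norm (y - c) ^ k) = \<bar>f y\<bar> / norm (y - c) ^ k" by (simp add: abs_divide power_abs)
      also have "\<dots> \<le> \<bar>f y\<bar> + C * ?i"
      proof (cases "y = c \<or> 1 \<le> norm (y - c)")
        case True
        then have "\<bar>f y\<bar> / norm (y - c) ^ k \<le> \<bar>f y\<bar>"
        proof
          assume "1 \<le> norm (y - c)"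
          then have "1 \<le> norm (y - c) ^ k" by (rule one_le_power)
          then have "\<bar>f y\<bar> / norm (y - c) ^ k \<le> \<bar>f y\<bar> / 1" by (intro divide_left_mono) auto
          then show ?thesis by simp
        qed (cases "k = 0", auto simp: power_0_left)
        moreover have "0 \<le> C * ?i" using C0 i0 by (rule mult_nonneg_nonneg)
        ultimately show ?thesis by linarith
      next
        case False
        then have p: "0 < norm (y - c)" "norm (y - c) < 1" by auto
        have y: "y \<in> ball c 1" using p(2) by (simp add: dist_norm norm_minus_commute)
        have "norm (y - c) ^ 3 \<le> norm (y - c) ^ k" using p k by (intro power_decreasing) auto
        moreover have "\<bar>f y\<bar> \<le> C" using y by (intro C) auto
        ultimately have "\<bar>f y\<bar> / norm (y - c) ^ k \<le> C / norm (y - c) ^ 3"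
          using p C0 by (intro frac_le) auto
        also have "\<dots> = C * ?i" using y by simp
        finally show ?thesis using abs_ge_zero[of "f y"] by linarith
      qed
      also have "\<dots> = norm (norm (f y) + C * ?i)"
        using mult_nonneg_nonneg[OF C0 i0] by (simp only: real_norm_def abs_of_nonneg[OF add_nonneg_nonneg[OF abs_ge_zero]])
      finally show "norm (f y / norm (y - c) ^ k) \<le> norm (norm (f y) + C * ?i)" .
    qed
  qed (use meas in simp)
qed

section \<open>Energy growth and the representation of the gradient\<close>

lemma continuous_bounded_compact:
  fixes f :: "'a::topological_space \<Rightarrow> real"
  assumes "continuous_on UNIV f" "compact K"
  obtains C where "C \<ge> 0" "\<And>x. x \<in> K \<Longrightarrow> \<bar>f x\<bar> \<le> C"
proof -
  have "compact (f ` K)"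
    by (intro compact_continuous_image continuous_on_subset[OF assms(1)] assms(2)) auto
  then obtain C where "\<And>x. x \<in> K \<Longrightarrow> \<bar>f x\<bar> \<le> C"
    using compact_imp_bounded bounded_iff by (metis imageI real_norm_def)
  then have "\<bar>f x\<bar> \<le> max C 0" if "x \<in> K" for x using that by fastforce
  then show ?thesis using that[of "max C 0"] by auto
qed

lemma integrable_indicator_continuous:
  fixes f :: "'a::euclidean_space \<Rightarrow> real"
  assumes "continuous_on UNIV f" "compact K"
  shows "integrable lborel (\<lambda>x. indicator K x * f x)"
  using borel_integrable_compact[OF assms(2) continuous_on_subset[OF assms(1)]] by simp

text \<open>The cutoff is a square, so its gradient carries a factor sqrt \<eta> and Young's
  inequality absorbs half of the energy. The bound t <= 1 + t^m at t = R^2 h takes the place of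
  Hoelder's inequality. Both errors integrate to order R^(2m-2).\<close>

lemma gradient_energy_growth:
  fixes u h :: "'a::euclidean_space \<Rightarrow> real"
  assumes m: "DIM('a) = 2 * m" "m \<ge> 2" and u: "smooth u"
    and h: "\<And>x. 0 \<le> h x" "integrable lborel (\<lambda>x. h x ^ m)"
    and le: "\<And>x. laplacian u x + (real DIM('a) - 2) / 2 * (norm (gradient u x))\<^sup>2 \<le> h x"
    and R: "R \<ge> 1"
  shows "(LBINT x. indicator (cball 0 R) x * (norm (gradient u x))\<^sup>2)
    \<le> 4 * (3 * 4 ^ m * unit_ball_vol DIM('a) + (LBINT x. h x ^ m)) * R ^ (2 * m - 2)"
proof -
  define \<rho> where "\<rho> = 4 * R\<^sup>2"
  have \<rho>: "\<rho> > 0" using R by (simp add: \<rho>_def)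
  define \<phi> where "\<phi> x = max 0 (\<rho> - x \<bullet> x)" for x :: 'a
  define F where "F s = max 0 (\<rho> - s) ^ Suc 1 / \<rho>\<^sup>2" for s
  define F' where "F' s = - (2 * max 0 (\<rho> - s)) / \<rho>\<^sup>2" for s
  have dF: "(F has_real_derivative F' s) (at s)" for s
    using DERIV_cdivide[OF max_power_derivative[of 1 \<rho> s], of "\<rho>\<^sup>2"] unfolding F_def[abs_def] F'_def by simp
  have cF': "continuous_on UNIV F'" unfolding F'_def[abs_def] using \<rho> by (intro continuous_intros) auto
  define \<eta> where "\<eta> = radial (0::'a) F"
  have \<eta>: "\<eta> x = (\<phi> x / \<rho>)\<^sup>2" for x
    by (simp add: \<eta>_def radial_def F_def \<phi>_def power_divide power2_eq_square)
  have C1\<eta>: "C1 \<eta>" unfolding \<eta>_def by (rule C1_radial[OF dF cF'])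
  have g\<eta>: "gradient \<eta> x = - (4 * \<phi> x / \<rho>\<^sup>2) *\<^sub>R x" for x
  proof -
    have "gradient \<eta> x = (\<Sum>b\<in>Basis. (2 * F' (x \<bullet> x)) *\<^sub>R ((x \<bullet> b) *\<^sub>R b))"
      unfolding gradient_def \<eta>_def partial_deriv_radial[OF dF] by (simp add: mult_ac)
    also have "\<dots> = (2 * F' (x \<bullet> x)) *\<^sub>R x"
      unfolding scaleR_sum_right[symmetric] euclidean_representation ..
    finally show ?thesis by (simp add: F'_def \<phi>_def)
  qed
  have out: "\<phi> x = 0" if "x \<notin> cball 0 (2 * R)" for x
  proof -
    have "2 * R < norm x" using that by simp
    then have "(2 * R)\<^sup>2 \<le> (norm x)\<^sup>2" using R by (intro power_mono) auto
    then show ?thesis by (simp add: \<phi>_def \<rho>_def power2_norm_eq_inner power_mult_distrib)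
  qed
  have supp: "bounded_support \<eta>"
    by (rule bounded_supportI[of "2 * R"]) (simp add: \<eta> out)
  have C1u: "C1 u" using u by (rule smooth_C1)
  \<comment> \<open>\<open>Z\<close> integrates to zero by Green's formula; carrying it along turns
    the whole estimate into a pointwise inequality.\<close>
  define Z where "Z x = neg_laplacian u x * \<eta> x - gradient u x \<bullet> gradient \<eta> x" for x
  have cnl: "continuous_on UNIV (neg_laplacian u)" using u by (intro C1_cont smooth_C1 smooth_neg_laplacian)
  have i1: "integrable lborel (\<lambda>x. neg_laplacian u x * \<eta> x)"
    by (intro integrable_mult_bounded_support supp cnl C1_cont[OF C1\<eta>])
  have i2: "integrable lborel (\<lambda>x. gradient u x \<bullet> gradient \<eta> x)"
    by (intro integrable_bounded_support bounded_supportI[of "2 * R"] continuous_intros continuous_on_gradient C1u C1\<eta>)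
       (simp add: g\<eta> out)
  have Z: "integrable lborel Z" "(LBINT x. Z x) = 0"
    using i1 i2 integral_laplacian_by_parts[OF smooth_C2[OF u] C1\<eta> supp] by (simp_all add: Z_def[abs_def])
  have cg: "continuous_on UNIV (\<lambda>x. (norm (gradient u x))\<^sup>2)"
    by (intro continuous_intros continuous_on_gradient C1u)
  have ig: "integrable lborel (\<lambda>x. indicator (cball 0 R) x * (norm (gradient u x))\<^sup>2)"
    by (rule integrable_indicator_continuous[OF cg]) simp
  have ii: "integrable lborel (\<lambda>x::'a. indicator (cball 0 (2 * R)) x :: real)"
    using integrable_indicator_continuous[of "\<lambda>x::'a. 1" "cball 0 (2 * R)"] by simp
  \<comment> \<open>9/32 is half of (3/4)^2, the lower bound for \<eta> on the ball of radius R. Of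
    the 3 / R^2, one part comes from \<open>h\<close> and two from Young's inequality.\<close>
  have point: "9/32 * (indicator (cball 0 R) x * (norm (gradient u x))\<^sup>2)
     \<le> indicator (cball 0 (2 * R)) x * (3 / R\<^sup>2) + R ^ (2 * m - 2) * h x ^ m + Z x" for x
  proof -
    let ?g = "norm (gradient u x)"
    have \<phi>0: "0 \<le> \<phi> x" and \<phi>\<rho>: "\<phi> x \<le> \<rho>" using \<rho> by (auto simp: \<phi>_def)
    have \<eta>01: "0 \<le> \<eta> x" "\<eta> x \<le> 1" using \<phi>0 \<phi>\<rho> \<rho> by (auto simp: \<eta> intro: power_le_one)
    have "9/16 * indicator (cball 0 R) x \<le> \<eta> x"
    proof (cases "x \<in> cball 0 R")
      case True
      then have "(norm x)\<^sup>2 \<le> R\<^sup>2" by (intro power_mono) auto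
      then have "3/4 * \<rho> \<le> \<phi> x" by (simp add: \<phi>_def \<rho>_def power2_norm_eq_inner)
      then have "3/4 \<le> \<phi> x / \<rho>" using \<rho> by (simp add: field_simps)
      then have "(3/4)\<^sup>2 \<le> \<eta> x" unfolding \<eta> by (intro power_mono) auto
      then show ?thesis using True by (simp add: power2_eq_square)
    qed (use \<eta>01 in simp)
    then have a: "9/16 * indicator (cball 0 R) x * ?g\<^sup>2 \<le> \<eta> x * ?g\<^sup>2"
      by (rule mult_right_mono) simp
    have b: "\<eta> x * h x \<le> indicator (cball 0 (2 * R)) x / R\<^sup>2 + R ^ (2 * m - 2) * h x ^ m"
    proof (cases "x \<in> cball 0 (2 * R)")
      case True
      define t where "t = R\<^sup>2 * h x"
      have t0: "t \<ge> 0" using h(1) by (simp add: t_def)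
      have "t \<le> 1 + t ^ m"
      proof (cases "t \<le> 1")
        case False
        then have "t ^ 1 \<le> t ^ m" using m by (intro power_increasing) auto
        then show ?thesis by simp
      qed (use t0 in \<open>simp add: add_increasing2\<close>)
      have "\<eta> x * h x \<le> h x" using \<eta>01 h(1)[of x] by (simp add: mult_left_le_one_le)
      also have "h x = t / R\<^sup>2" using R by (simp add: t_def)
      also have "\<dots> \<le> (1 + t ^ m) / R\<^sup>2" using \<open>t \<le> 1 + t ^ m\<close> by (rule divide_right_mono) simp
      also have "\<dots> = 1 / R\<^sup>2 + R ^ (2 * m - 2) * h x ^ m"
        using R m by (simp add: t_def add_divide_distrib power_mult_distrib power_mult[symmetric] power_diff)
      finally show ?thesis using True by simp
    next
      case False
      then show ?thesis using h(1)[of x] R out[OF False] by (simp add: \<eta>)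
    qed
    have c: "gradient u x \<bullet> gradient \<eta> x \<le> 1/2 * (\<eta> x * ?g\<^sup>2) + indicator (cball 0 (2 * R)) x * (2 / R\<^sup>2)"
    proof (cases "x \<in> cball 0 (2 * R)")
      case True
      have "gradient u x \<bullet> gradient \<eta> x \<le> ?g * norm (gradient \<eta> x)" by (rule norm_cauchy_schwarz)
      also have "norm (gradient \<eta> x) = 4 * \<phi> x / \<rho>\<^sup>2 * norm x" using \<phi>0 by (simp add: g\<eta>)
      also have "?g * (4 * \<phi> x / \<rho>\<^sup>2 * norm x) = (?g * (\<phi> x / \<rho>)) * (4 * norm x / \<rho>)"
        by (simp add: power2_eq_square)
      also have "\<dots> \<le> 1/2 * (?g * (\<phi> x / \<rho>))\<^sup>2 + 1/2 * (4 * norm x / \<rho>)\<^sup>2"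
        using sum_squares_bound[of "?g * (\<phi> x / \<rho>)" "4 * norm x / \<rho>"] by simp
      also have "(?g * (\<phi> x / \<rho>))\<^sup>2 = \<eta> x * ?g\<^sup>2" by (simp add: \<eta> power_mult_distrib power_divide)
      also have "(4 * norm x / \<rho>)\<^sup>2 \<le> 4 / R\<^sup>2"
      proof -
        have "4 * norm x / \<rho> \<le> 4 * (2 * R) / \<rho>" using True \<rho> by (intro divide_right_mono mult_left_mono) auto
        also have "\<dots> = 2 / R" using R by (simp add: \<rho>_def power2_eq_square)
        finally have "(4 * norm x / \<rho>)\<^sup>2 \<le> (2 / R)\<^sup>2" using \<rho> by (intro power_mono) auto
        then show ?thesis by (simp add: power_divide)
      qed
      finally show ?thesis using True by simp
    next
      case False
      then show ?thesis by (simp add: g\<eta> \<eta> out)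
    qed
    \<comment> \<open>Dimension at least 4 makes the coefficient of the gradient term at least
      1.\<close>
    have "?g\<^sup>2 \<le> (real DIM('a) - 2) / 2 * ?g\<^sup>2"
      using m mult_right_mono[of 1 "(real DIM('a) - 2) / 2" "?g\<^sup>2"] by simp
    then have "?g\<^sup>2 - neg_laplacian u x \<le> h x" using le[of x] by (simp add: neg_laplacian_def)
    then have "\<eta> x * (?g\<^sup>2 - neg_laplacian u x) \<le> \<eta> x * h x" using \<eta>01 by (intro mult_left_mono) auto
    then have "\<eta> x * ?g\<^sup>2 \<le> \<eta> x * h x + Z x + gradient u x \<bullet> gradient \<eta> x"
      by (simp add: Z_def algebra_simps)
    with a b c show ?thesis by simp
  qed
  have vol: "(LBINT (x::'a). indicator (cball 0 (2 * R)) x) = unit_ball_vol DIM('a) * (2 * R) ^ (2 * m)"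
    using content_cball[of "2 * R" "0::'a"] R m by simp
  have "9/32 * (LBINT x. indicator (cball 0 R) x * (norm (gradient u x))\<^sup>2)
     = (LBINT x. 9/32 * (indicator (cball 0 R) x * (norm (gradient u x))\<^sup>2))"
    by (rule integral_mult_right_zero[symmetric])
  also have "\<dots> \<le> (LBINT x. indicator (cball 0 (2 * R)) x * (3 / R\<^sup>2) + R ^ (2 * m - 2) * h x ^ m + Z x)"
    by (intro integral_mono integrable_mult_right ig Bochner_Integration.integrable_add integrable_mult_left ii h Z point)
  also have "\<dots> = (LBINT (x::'a). indicator (cball 0 (2 * R)) x) * (3 / R\<^sup>2) + R ^ (2 * m - 2) * (LBINT x. h x ^ m)"
    using ii h(2) Z by simp
  also have "\<dots> = (3 * 4 ^ m * unit_ball_vol DIM('a) + (LBINT x. h x ^ m)) * R ^ (2 * m - 2)"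
  proof -
    have "(2 * R) ^ (2 * m) = 4 ^ m * (R ^ (2 * m - 2) * R\<^sup>2)"
    proof -
      have "2 * m - 2 + 2 = 2 * m" using m by simp
      then have "R ^ (2 * m) = R ^ (2 * m - 2) * R\<^sup>2" by (metis power_add)
      moreover have "(2 * R) ^ (2 * m) = 4 ^ m * R ^ (2 * m)" by (simp add: power_mult_distrib power_mult)
      ultimately show ?thesis by simp
    qed
    then show ?thesis unfolding vol using R by (simp add: field_simps)
  qed
  finally have "9/32 * (LBINT x. indicator (cball 0 R) x * (norm (gradient u x))\<^sup>2)
    \<le> (3 * 4 ^ m * unit_ball_vol DIM('a) + (LBINT x. h x ^ m)) * R ^ (2 * m - 2)" .
  moreover have "0 \<le> (LBINT x. indicator (cball 0 R) x * (norm (gradient u x))\<^sup>2)"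
    by (intro integral_nonneg_AE AE_I2) auto
  \<comment> \<open>The factor 32/9 is rounded up to 4.\<close>
  ultimately have "(LBINT x. indicator (cball 0 R) x * (norm (gradient u x))\<^sup>2)
    \<le> 4 * ((3 * 4 ^ m * unit_ball_vol DIM('a) + (LBINT x. h x ^ m)) * R ^ (2 * m - 2))" by linarith
  then show ?thesis by (simp only: mult.assoc)
qed

text \<open>The averaging identity between scales E k and N k, as they tend to 0 and infinity. The
  average at large scale dies by the energy growth, the one at small scale tends to the derivative
  at \<open>c\<close> times the mass of the profile, and off \<open>c\<close> the difference of the
  two bumps tends to 1.\<close>

lemma gradient_representation:
  fixes u :: "'a::euclidean_space \<Rightarrow> real"
  assumes m: "DIM('a) = 2 * m" "m \<ge> 2" and u: "smooth u" and b: "b \<in> Basis"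
    and f: "integrable lborel ((neg_laplacian ^^ m) u)"
    and growth: "\<And>R. R \<ge> 1 \<Longrightarrow> (LBINT x. indicator (cball 0 R) x * (norm (gradient u x))\<^sup>2) \<le> C * R ^ (2 * m - 2)"
  shows "(4 * pi) ^ m * fact (m - 1) * partial_deriv b u c
    = 2 * (LBINT y. (neg_laplacian ^^ m) u y * (((y - c) \<bullet> b) / ((y - c) \<bullet> (y - c))))"
proof -
  define v where "v = partial_deriv b u"
  define f where "f = (neg_laplacian ^^ m) u"
  define S where "S y = (y - c) \<bullet> (y - c)" for y
  define A where "A r = (LBINT y. v y * radial c (\<lambda>s. profile m (s / r\<^sup>2) / r ^ (2 * m)) y)" for r
  define E where "E k = inverse (real (Suc k))" for k
  define N where "N k = real (Suc k)" for k
  have E: "0 < E k" "E k \<le> 1" "E k \<le> N k" for k by (auto simp: E_def N_def field_simps)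
  have N: "N k \<ge> 1" for k by (auto simp: N_def)
  have cv: "continuous_on UNIV v" and cf: "continuous_on UNIV f"
    using u b by (auto simp: v_def f_def intro: C1_cont smooth_C1 smooth_partial smooth_neg_laplacian_pow)
  have fi: "integrable lborel f" using f by (simp add: f_def)
  have tp: "trunc_power 1 4 (profile m)" using m by (intro trunc_power_profile) simp
  have cp: "continuous_on UNIV (profile m)" by (rule trunc_power_continuous[OF tp])
  have cr: "continuous_on UNIV (radial c' (\<lambda>s. profile m (s / r\<^sup>2) / r ^ (2 * m)))" if "r > 0" for r and c' :: 'a
    unfolding radial_def[abs_def] using that by (intro continuous_intros continuous_on_compose2[OF cp]) auto
  have sr: "bounded_support (radial c' (\<lambda>s. profile m (s / r\<^sup>2) / r ^ (2 * m)))" if "r > 0" for r and c' :: 'a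
  proof -
    have "trunc_power (r\<^sup>2) 4 (\<lambda>s. profile m (s / r\<^sup>2))"
      using that by (intro trunc_power_scale[OF tp]) simp
    from trunc_power_mult[OF this, of "[:1 / r ^ (2 * m):]"]
    show ?thesis by (intro bounded_support_radial[of "r\<^sup>2" 4]) auto
  qed
  have ir: "integrable lborel (\<lambda>y. v y * radial c (\<lambda>s. profile m (s / r\<^sup>2) / r ^ (2 * m)) y)" if "r > 0" for r
    by (intro integrable_mult_bounded_support sr cv cr that)
  obtain P where P: "P \<ge> 0" "\<And>s. s \<in> {0..1} \<Longrightarrow> \<bar>profile m s\<bar> \<le> P"
    using continuous_bounded_compact[OF cp compact_Icc] by blast
  have P: "\<bar>profile m s\<bar> \<le> P" if "s \<ge> 0" for s
    using P(2)[of s] P(1) that trunc_power_zero[OF tp, of s] by (cases "s \<le> 1") auto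
  have P0: "P \<ge> 0" using P[of 0] by simp
  \<comment> \<open>Once r >= |c|, the kernel is at most P / r^(2m) and supported within radius 2r.
    Replacing |grad u| by half of 1/r + r |grad u|^2 makes both contributions of order r^(2m-1), so
    the average is O(1/r).\<close>
  have AN: "(\<lambda>k. A (N k)) \<longlonglongrightarrow> 0"
  proof (rule Lim_null_comparison)
    define D where "D = P / 2 * (unit_ball_vol DIM('a) * 4 ^ m + C * 4 ^ (m - 1))"
    show "(\<lambda>k. D * E k) \<longlonglongrightarrow> 0"
      unfolding E_def by (rule tendsto_mult_right_zero[OF LIMSEQ_inverse_real_of_nat])
    show "\<forall>\<^sub>F k in sequentially. norm (A (N k)) \<le> D * E k"
    proof (rule eventually_mono[OF eventually_ge_at_top[of "nat \<lceil>norm c\<rceil>"]])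
      fix k assume "nat \<lceil>norm c\<rceil> \<le> k"
      then have ck: "norm c \<le> N k" by (simp add: N_def)
      define r where "r = N k"
      have r: "r \<ge> 1" using N by (simp add: r_def)
      define w where "w y = P / r ^ (2 * m) / 2 * (indicator (cball 0 (2 * r)) y / r + r * (indicator (cball 0 (2 * r)) y * (norm (gradient u y))\<^sup>2))" for y
      have ii: "integrable lborel (\<lambda>x::'a. indicator (cball 0 (2 * r)) x :: real)"
        using integrable_indicator_continuous[of "\<lambda>x::'a. 1" "cball 0 (2 * r)"] by simp
      have ig: "integrable lborel (\<lambda>x. indicator (cball 0 (2 * r)) x * (norm (gradient u x))\<^sup>2)"
        by (intro integrable_indicator_continuous continuous_intros continuous_on_gradient smooth_C1 u compact_cball)
      have "norm (A r) \<le> (LBINT y. w y)"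
        unfolding A_def
      proof (rule Bochner_Integration.integral_norm_bound_integral)
        show "integrable lborel w" unfolding w_def[abs_def] using ii ig by auto
        show "norm (v y * radial c (\<lambda>s. profile m (s / r\<^sup>2) / r ^ (2 * m)) y) \<le> w y" for y
        proof (cases "y \<in> cball 0 (2 * r)")
          case True
          have "\<bar>v y\<bar> \<le> norm (gradient u y)"
            using Basis_le_norm[OF b, of "gradient u y"] by (simp add: v_def gradient_inner_Basis[OF b])
          also have "norm (gradient u y) \<le> (1 / r + r * (norm (gradient u y))\<^sup>2) / 2"
          proof -
            have "2 * (r * norm (gradient u y)) * 1 \<le> (r * norm (gradient u y))\<^sup>2 + 1\<^sup>2" by (rule sum_squares_bound)
            then show ?thesis using r by (simp add: field_simps power2_eq_square)
          qed
          finally have v: "\<bar>v y\<bar> \<le> (1 / r + r * (norm (gradient u y))\<^sup>2) / 2" .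
          have "\<bar>radial c (\<lambda>s. profile m (s / r\<^sup>2) / r ^ (2 * m)) y\<bar> \<le> P / r ^ (2 * m)"
            unfolding radial_def abs_divide using r by (intro frac_le P P0) auto
          from mult_mono[OF v this] have "norm (v y * radial c (\<lambda>s. profile m (s / r\<^sup>2) / r ^ (2 * m)) y)
              \<le> (1 / r + r * (norm (gradient u y))\<^sup>2) / 2 * (P / r ^ (2 * m))"
            using r by (simp add: abs_mult)
          then show ?thesis using True by (simp add: w_def mult_ac)
        next
          case False
          have "2 * r < norm y" using False by simp
          moreover have "norm y \<le> norm (y - c) + norm c" using norm_triangle_ineq[of "y - c" c] by simp
          ultimately have "r \<le> norm (y - c)" using ck by (simp add: r_def)
          then have "r\<^sup>2 \<le> (y - c) \<bullet> (y - c)"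
            using r power_mono[of r "norm (y - c)" 2] by (simp add: power2_norm_eq_inner)
          then have "radial c (\<lambda>s. profile m (s / r\<^sup>2) / r ^ (2 * m)) y = 0"
            using r trunc_power_zero[OF tp] by (simp add: radial_def)
          then show ?thesis using False by (simp add: w_def)
        qed
      qed (use ir r in auto)
      also have "\<dots> = P / r ^ (2 * m) / 2 * (unit_ball_vol DIM('a) * (2 * r) ^ (2 * m) / r
           + r * (LBINT y. indicator (cball 0 (2 * r)) y * (norm (gradient u y))\<^sup>2))"
        unfolding w_def using ii ig content_cball[of "2 * r" "0::'a"] r m by simp
      also have "\<dots> \<le> P / r ^ (2 * m) / 2 * (unit_ball_vol DIM('a) * (2 * r) ^ (2 * m) / r + r * (C * (2 * r) ^ (2 * m - 2)))"
        using r P0 growth[of "2 * r"] by (intro mult_left_mono add_left_mono) auto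
      also have "\<dots> = D * E k"
      proof -
        have 1: "(2 * r) ^ (2 * m) = 4 ^ m * r ^ (2 * m)" by (simp add: power_mult_distrib power_mult)
        have "2 * m - 2 = 2 * (m - 1)" by simp
        then have "(2 * r) ^ (2 * m - 2) = 4 ^ (m - 1) * r ^ (2 * (m - 1))" by (simp add: power_mult_distrib power_mult)
        moreover have "2 * (m - 1) + 2 = 2 * m" using m by simp
        then have "r ^ (2 * m) = r ^ (2 * (m - 1)) * r\<^sup>2" by (metis power_add)
        ultimately show ?thesis unfolding 1 D_def E_def r_def[unfolded N_def, symmetric] using r
          by (simp add: field_simps power2_eq_square)
      qed
      finally show "norm (A (N k)) \<le> D * E k" by (simp add: r_def)
    qed
  qed
  have AE: "(\<lambda>k. A (E k)) \<longlonglongrightarrow> (4 * pi) ^ m * fact (m - 1) * v c"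
  proof -
    \<comment> \<open>Substituting y = c + r x fixes the kernel: the Jacobian cancels 1 / r^(2m),
      because the order equals the dimension.\<close>
    have A1: "A r = (LBINT x. v (c + r *\<^sub>R x) * radial 0 (profile m) x)" if r: "r > 0" for r
    proof -
      have "A r = r ^ DIM('a) * (LBINT x. v (c + r *\<^sub>R x) * radial c (\<lambda>s. profile m (s / r\<^sup>2) / r ^ (2 * m)) (c + r *\<^sub>R x))"
        unfolding A_def using r by (intro lborel_scale(2)) (auto intro!: cont_borel_measurable continuous_on_mult cv cr)
      also have "\<dots> = (LBINT x. r ^ DIM('a) * (v (c + r *\<^sub>R x) * radial c (\<lambda>s. profile m (s / r\<^sup>2) / r ^ (2 * m)) (c + r *\<^sub>R x)))"
        by (rule integral_mult_right_zero[symmetric])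
      also have "\<dots> = (LBINT x. v (c + r *\<^sub>R x) * radial 0 (profile m) x)"
        using r m by (intro Bochner_Integration.integral_cong refl) (simp add: radial_def power2_eq_square)
      finally show ?thesis .
    qed
    obtain V where V: "V \<ge> 0" "\<And>x. x \<in> cball c 1 \<Longrightarrow> \<bar>v x\<bar> \<le> V"
      using continuous_bounded_compact[OF cv compact_cball] by blast
    have crp: "continuous_on UNIV (radial (0::'a) (profile m))" using cr[of 1 0] by simp
    have irp: "integrable lborel (radial (0::'a) (profile m))"
      using sr[of 1 0] crp by (intro integrable_bounded_support) auto
    have "(\<lambda>k. LBINT x. v (c + E k *\<^sub>R x) * radial 0 (profile m) x) \<longlonglongrightarrow> (LBINT (x::'a). v c * radial 0 (profile m) x)"
    proof (rule integral_dominated_convergence)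
      show "integrable lborel (\<lambda>x::'a. V * norm (radial 0 (profile m) x))"
        using irp by auto
      show "AE x in lborel. (\<lambda>k. v (c + E k *\<^sub>R x) * radial 0 (profile m) x) \<longlonglongrightarrow> v c * radial 0 (profile m) x"
      proof (rule AE_I2)
        fix x
        have "(\<lambda>k. c + E k *\<^sub>R x) \<longlonglongrightarrow> c + 0 *\<^sub>R x"
          unfolding E_def by (intro tendsto_intros LIMSEQ_inverse_real_of_nat)
        then have "(\<lambda>k. v (c + E k *\<^sub>R x)) \<longlonglongrightarrow> v c"
          by (intro continuous_on_tendsto_compose[OF cv, of _ c]) auto
        then show "(\<lambda>k. v (c + E k *\<^sub>R x) * radial 0 (profile m) x) \<longlonglongrightarrow> v c * radial 0 (profile m) x"
          by (intro tendsto_intros)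
      qed
      show "AE x in lborel. norm (v (c + E k *\<^sub>R x) * radial 0 (profile m) x) \<le> V * norm (radial 0 (profile m) x)" for k
      proof (rule AE_I2)
        fix x :: 'a
        show "norm (v (c + E k *\<^sub>R x) * radial 0 (profile m) x) \<le> V * norm (radial 0 (profile m) x)"
        proof (cases "norm x \<le> 1")
          case True
          then have "E k * norm x \<le> 1" using E[of k] by (intro mult_le_one) auto
          then have "\<bar>v (c + E k *\<^sub>R x)\<bar> \<le> V" using E[of k] by (intro V) (auto simp: dist_norm)
          then show ?thesis by (simp add: abs_mult mult_right_mono)
        next
          case False
          then have "1 \<le> x \<bullet> x" using power_mono[of 1 "norm x" 2] by (simp add: power2_norm_eq_inner)
          then show ?thesis using trunc_power_zero[OF tp] by (simp add: radial_def)
        qed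
      qed
    qed (auto intro!: cont_borel_measurable continuous_intros continuous_on_compose2[OF cv] crp)
    also have "(LBINT (x::'a). v c * radial 0 (profile m) x) = v c * ((4 * pi) ^ m * fact (m - 1))"
      using integral_profile[OF m] integral_mult_right_zero[of _ "v c" "radial 0 (profile m)"] by simp
    finally show ?thesis using A1[OF E(1)] by (simp add: mult.commute)
  qed
  define B where "B k y = bump m (S y / (N k)\<^sup>2) - bump m (S y / (E k)\<^sup>2)" for k y
  have id: "A (N k) - A (E k) = (LBINT y. f y * (- 2 * ((y - c) \<bullet> b) / S y * B k y))" for k
  proof -
    have "A (N k) - A (E k) = (LBINT y. v y * (radial c (\<lambda>s. profile m (s / (N k)\<^sup>2) / (N k) ^ (2 * m)) y
            - radial c (\<lambda>s. profile m (s / (E k)\<^sup>2) / (E k) ^ (2 * m)) y))"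
      unfolding A_def right_diff_distrib using ir[of "N k"] ir[OF E(1)] N[of k] by simp
    then show ?thesis
      using scaled_radial_average_difference[OF u b m(1) E(1) E(3)] by (simp add: v_def f_def S_def B_def)
  qed
  have lim: "(\<lambda>k. LBINT y. f y * (- 2 * ((y - c) \<bullet> b) / S y * B k y)) \<longlonglongrightarrow> (LBINT y. f y * (- 2 * ((y - c) \<bullet> b) / S y))"
  proof (rule integral_dominated_convergence)
    have n4: "DIM('a) \<ge> 4" using m by simp
    show "integrable lborel (\<lambda>y. 2 * norm (f y / norm (y - c)))"
      using integrable_div_norm_power[OF n4 _ cf fi, of 1] by (intro integrable_mult_right integrable_norm) simp
    have cb: "continuous_on UNIV (bump m)" by (rule trunc_power_continuous[OF trunc_power_bump])
    have mS: "(\<lambda>y. - 2 * ((y - c) \<bullet> b) / S y) \<in> borel_measurable borel" unfolding S_def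
      by (intro borel_measurable_divide cont_borel_measurable continuous_intros)
    have mf: "f \<in> borel_measurable borel" by (rule cont_borel_measurable[OF cf])
    then show "(\<lambda>y. f y * (- 2 * ((y - c) \<bullet> b) / S y)) \<in> borel_measurable lborel"
      using borel_measurable_times[OF mf mS] by simp
    have "(B k) \<in> borel_measurable borel" for k
      unfolding B_def S_def using E(1)[of k] N[of k]
      by (intro cont_borel_measurable continuous_intros continuous_on_compose2[OF cb]) auto
    then show "(\<lambda>y. f y * (- 2 * ((y - c) \<bullet> b) / S y * B k y)) \<in> borel_measurable lborel" for k
      using borel_measurable_times[OF mf borel_measurable_times[OF mS]] by simp
    have bump01: "0 \<le> bump m s" "bump m s \<le> 1" if "s \<ge> 0" for s
      using that by (auto simp: bump_def intro!: power_le_one)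
    have S0: "S y \<ge> 0" for y by (simp add: S_def)
    show "AE y in lborel. norm (f y * (- 2 * ((y - c) \<bullet> b) / S y * B k y)) \<le> 2 * norm (f y / norm (y - c))" for k
    proof (rule AE_I2)
      fix y
      have "\<bar>B k y\<bar> \<le> 1"
        using bump01[of "S y / (N k)\<^sup>2"] bump01[of "S y / (E k)\<^sup>2"] S0[of y] by (simp add: B_def abs_le_iff)
      moreover have "\<bar>- 2 * ((y - c) \<bullet> b) / S y\<bar> \<le> 2 / norm (y - c)"
      proof (cases "y = c")
        case False
        have "\<bar>(y - c) \<bullet> b\<bar> \<le> norm (y - c)" by (rule Basis_le_norm[OF b])
        moreover have "S y = norm (y - c) * norm (y - c)" by (simp add: S_def power2_norm_eq_inner[symmetric] power2_eq_square)
        ultimately show ?thesis using False by (simp add: abs_mult field_simps)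
      qed (simp add: S_def)
      ultimately have "\<bar>- 2 * ((y - c) \<bullet> b) / S y\<bar> * \<bar>B k y\<bar> \<le> 2 / norm (y - c) * 1"
        by (intro mult_mono) auto
      then have "\<bar>f y\<bar> * (\<bar>- 2 * ((y - c) \<bullet> b) / S y\<bar> * \<bar>B k y\<bar>) \<le> \<bar>f y\<bar> * (2 / norm (y - c) * 1)"
        by (intro mult_left_mono) auto
      then show "norm (f y * (- 2 * ((y - c) \<bullet> b) / S y * B k y)) \<le> 2 * norm (f y / norm (y - c))"
        by (simp add: abs_mult mult_ac)
    qed
    show "AE y in lborel. (\<lambda>k. f y * (- 2 * ((y - c) \<bullet> b) / S y * B k y)) \<longlonglongrightarrow> f y * (- 2 * ((y - c) \<bullet> b) / S y)"
    proof (rule AE_I2)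
      fix y
      show "(\<lambda>k. f y * (- 2 * ((y - c) \<bullet> b) / S y * B k y)) \<longlonglongrightarrow> f y * (- 2 * ((y - c) \<bullet> b) / S y)"
      proof (cases "y = c")
        case False
        then have Sp: "S y > 0" by (simp add: S_def)
        have E0: "E \<longlonglongrightarrow> 0" unfolding E_def by (rule LIMSEQ_inverse_real_of_nat)
        have NE: "S y / (N k)\<^sup>2 = S y * (E k)\<^sup>2" for k by (simp add: N_def E_def divide_inverse power_inverse)
        have "(\<lambda>k. S y * (E k)\<^sup>2) \<longlonglongrightarrow> S y * 0\<^sup>2" by (intro tendsto_intros E0)
        then have "(\<lambda>k. bump m (S y * (E k)\<^sup>2)) \<longlonglongrightarrow> bump m 0"
          by (intro continuous_on_tendsto_compose[OF cb, of _ 0]) auto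
        then have 1: "(\<lambda>k. bump m (S y / (N k)\<^sup>2)) \<longlonglongrightarrow> 1" by (simp add: NE bump_def)
        have "\<forall>\<^sub>F k in sequentially. E k < min 1 (S y)"
          using order_tendstoD(2)[OF E0, of "min 1 (S y)"] Sp by simp
        then have "\<forall>\<^sub>F k in sequentially. bump m (S y / (E k)\<^sup>2) = 0"
        proof (rule eventually_mono)
          fix k assume "E k < min 1 (S y)"
          moreover have "(E k)\<^sup>2 \<le> E k" using E(1,2)[of k] power_decreasing[of 1 2 "E k"] by simp
          ultimately have "1 \<le> S y / (E k)\<^sup>2" using E(1)[of k] by (simp add: field_simps)
          then show "bump m (S y / (E k)\<^sup>2) = 0" by (simp add: bump_def)
        qed
        then have "(\<lambda>k. bump m (S y / (E k)\<^sup>2)) \<longlonglongrightarrow> 0" by (rule tendsto_eventually)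
        from tendsto_diff[OF 1 this] have "(\<lambda>k. B k y) \<longlonglongrightarrow> 1" by (simp add: B_def)
        then have "(\<lambda>k. f y * (- 2 * ((y - c) \<bullet> b) / S y * B k y)) \<longlonglongrightarrow> f y * (- 2 * ((y - c) \<bullet> b) / S y * 1)"
          by (intro tendsto_mult tendsto_const)
        then show ?thesis by simp
      qed (simp add: S_def)
    qed
  qed
  have "(\<lambda>k. A (N k) - A (E k)) \<longlonglongrightarrow> 0 - (4 * pi) ^ m * fact (m - 1) * v c"
    by (intro tendsto_diff AN AE)
  from LIMSEQ_unique[OF this lim[folded id]]
  have "- ((4 * pi) ^ m * fact (m - 1) * v c) = (LBINT y. - 2 * (f y * (((y - c) \<bullet> b) / S y)))"
    by (simp add: mult_ac)
  also have "\<dots> = - 2 * (LBINT y. f y * (((y - c) \<bullet> b) / S y))"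
    by (rule integral_mult_right_zero)
  finally show ?thesis by (simp add: v_def f_def S_def)
qed

section \<open>Rescaled gradients at infinity\<close>

text \<open>The integral of (a - l b)^2 is nonnegative for all real l. The choice l = X / B is
  optimal; for B = 0 the inequality is linear in l and forces X = 0.\<close>

lemma Cauchy_Schwarz_integral:
  fixes a b :: "'a \<Rightarrow> real"
  assumes a: "integrable M (\<lambda>x. (a x)\<^sup>2)" and b: "integrable M (\<lambda>x. (b x)\<^sup>2)" and ab: "integrable M (\<lambda>x. a x * b x)"
  shows "(\<integral>x. a x * b x \<partial>M)\<^sup>2 \<le> (\<integral>x. (a x)\<^sup>2 \<partial>M) * (\<integral>x. (b x)\<^sup>2 \<partial>M)"
proof -
  define A B X where "A = (\<integral>x. (a x)\<^sup>2 \<partial>M)" and "B = (\<integral>x. (b x)\<^sup>2 \<partial>M)" and "X = (\<integral>x. a x * b x \<partial>M)"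
  have B0: "B \<ge> 0" unfolding B_def by (intro integral_nonneg_AE AE_I2) auto
  have key: "2 * l * X \<le> A + l\<^sup>2 * B" for l
  proof -
    have "2 * l * X = (\<integral>x. 2 * l * (a x * b x) \<partial>M)" unfolding X_def by (rule integral_mult_right_zero[symmetric])
    also have "\<dots> \<le> (\<integral>x. (a x)\<^sup>2 + l\<^sup>2 * (b x)\<^sup>2 \<partial>M)"
    proof (intro integral_mono integrable_mult_right Bochner_Integration.integrable_add a b ab)
      fix x
      show "2 * l * (a x * b x) \<le> (a x)\<^sup>2 + l\<^sup>2 * (b x)\<^sup>2"
        using sum_squares_bound[of "a x" "l * b x"] by (simp add: power_mult_distrib mult_ac)
    qed
    also have "\<dots> = A + l\<^sup>2 * B" unfolding A_def B_def using a b by simp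
    finally show ?thesis .
  qed
  show ?thesis
  proof (cases "B = 0")
    case True
    have "X = 0"
    proof (rule ccontr)
      assume "X \<noteq> 0"
      then have "2 * ((A + 1) / (2 * X)) * X = A + 1" by simp
      then show False using key[of "(A + 1) / (2 * X)"] True by simp
    qed
    then show ?thesis by (simp add: X_def[symmetric] B_def[symmetric] True)
  next
    case False
    then have "B > 0" using B0 by simp
    have "2 * (X / B) * X \<le> A + (X / B)\<^sup>2 * B" by (rule key)
    then have "X\<^sup>2 \<le> A * B" using \<open>B > 0\<close> by (simp add: field_simps power2_eq_square)
    then show ?thesis by (simp add: X_def A_def B_def)
  qed
qed

lemma Cauchy_Schwarz_weighted:
  fixes f k :: "'a \<Rightarrow> real"
  assumes f: "integrable M f" and fk: "integrable M (\<lambda>x. f x * k x)" and fk2: "integrable M (\<lambda>x. \<bar>f x\<bar> * (k x)\<^sup>2)"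
  shows "(\<integral>x. f x * k x \<partial>M)\<^sup>2 \<le> (\<integral>x. \<bar>f x\<bar> \<partial>M) * (\<integral>x. \<bar>f x\<bar> * (k x)\<^sup>2 \<partial>M)"
proof -
  define a b where "a x = sqrt \<bar>f x\<bar>" and "b x = sgn (f x) * sqrt \<bar>f x\<bar> * k x" for x
  have "(a x)\<^sup>2 = \<bar>f x\<bar>" "(b x)\<^sup>2 = \<bar>f x\<bar> * (k x)\<^sup>2" "a x * b x = f x * k x" for x
  proof -
    show "(a x)\<^sup>2 = \<bar>f x\<bar>" by (simp add: a_def)
    show "(b x)\<^sup>2 = \<bar>f x\<bar> * (k x)\<^sup>2" by (cases "f x = 0") (auto simp: b_def power_mult_distrib sgn_if)
    have "a x * b x = sgn (f x) * (sqrt \<bar>f x\<bar> * sqrt \<bar>f x\<bar>) * k x" by (simp add: a_def b_def)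
    then show "a x * b x = f x * k x" by (simp add: mult.commute[of "sgn (f x)"] abs_mult_sgn)
  qed
  then show ?thesis
    using Cauchy_Schwarz_integral[of M a b] f fk fk2 by simp
qed

text \<open>Inversion in the unit sphere and at the same time the gradient of ln |z|. The vector
  kernel of the gradient representation at \<open>c\<close> is
  \<open>inversion (y - c)\<close>.\<close>

definition inversion :: "'a::real_inner \<Rightarrow> 'a" where
  "inversion z = (1 / (z \<bullet> z)) *\<^sub>R z"

lemma norm_inversion: "norm (inversion z) = 1 / norm z"
  by (cases "z = 0") (auto simp: inversion_def power2_norm_eq_inner[symmetric] power2_eq_square)

lemma square_le_one_plus_cube: "t \<ge> 0 \<Longrightarrow> t\<^sup>2 \<le> 1 + t ^ 3" for t :: real
proof (cases "t \<le> 1")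
  case True
  assume "t \<ge> 0"
  then have "t\<^sup>2 \<le> 1" using True by (intro power_le_one) auto
  then show ?thesis using \<open>t \<ge> 0\<close> by (simp add: add_increasing2)
next
  case False
  then have "t\<^sup>2 \<le> t ^ 3" by (intro power_increasing) auto
  then show ?thesis by simp
qed

text \<open>
  For nonzero points the left-hand side is \<open>(|a - b| / (|a| |b|))\<^sup>2\<close>. The bound survives at \<open>0\<close>, where
  \<open>inversion 0 = 0\<close> and \<open>1 / 0 = 0\<close>.
\<close>

lemma inversion_diff_bound:
  fixes a b :: "'a::real_inner"
  shows "(norm (inversion a - inversion b))\<^sup>2 \<le> 4 * min 1 (norm (a - b)) * (1 + 1 / norm a ^ 3 + 1 / norm b ^ 3)"
proof -
  have aux: "(1 / t)\<^sup>2 \<le> 4 * min 1 t * (1 + (1 / t) ^ 3)" if "t > 0" for t :: real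
  proof (cases "t \<le> 1")
    case True
    have "(1 / t)\<^sup>2 = t * (1 / t) ^ 3" using that by (simp add: power2_eq_square power3_eq_cube)
    also have "\<dots> \<le> 4 * min 1 t * (1 + (1 / t) ^ 3)" using that True by (simp add: algebra_simps)
    finally show ?thesis .
  next
    case False
    then have 1: "(1 / t)\<^sup>2 \<le> 1 + (1 / t) ^ 3" by (intro square_le_one_plus_cube) auto
    have 2: "0 \<le> 1 + (1 / t) ^ 3" using False by simp
    have "x \<le> 1 + c \<Longrightarrow> 0 \<le> 1 + c \<Longrightarrow> x \<le> 4 * (1 + c)" for x c :: real by (simp add: distrib_left)
    from this[OF 1 2] have "(1 / t)\<^sup>2 \<le> 4 * (1 + (1 / t) ^ 3)" .
    moreover have "4 * min 1 t = 4" using False by simp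
    ultimately show ?thesis by (simp only:)
  qed
  show ?thesis
  proof (cases "a = 0 \<or> b = 0")
    case True
    then consider "a = 0" "b = 0" | "a = 0" "b \<noteq> 0" | "a \<noteq> 0" "b = 0" by blast
    then show ?thesis
    proof cases
      case 2
      then have "norm (inversion a - inversion b) = 1 / norm b" by (simp add: norm_inversion inversion_def[of 0])
      then show ?thesis using aux[of "norm b"] 2 by (simp add: power_divide)
    next
      case 3
      then have "norm (inversion a - inversion b) = 1 / norm a" by (simp add: norm_inversion inversion_def[of 0])
      then show ?thesis using aux[of "norm a"] 3 by (simp add: power_divide)
    qed (simp add: inversion_def)
  next
    case False
    define X Y d where "X = 1 / norm a" and "Y = 1 / norm b" and "d = norm (a - b)"
    have X: "X > 0" and Y: "Y > 0" and d: "d \<ge> 0" using False by (auto simp: X_def Y_def d_def)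
    have "(norm (inversion a - inversion b))\<^sup>2 = (norm (inversion a))\<^sup>2 + (norm (inversion b))\<^sup>2 - 2 * (inversion a \<bullet> inversion b)"
      by (simp add: power2_norm_eq_inner inner_diff inner_commute)
    also have "inversion a \<bullet> inversion b = (a \<bullet> b) * X\<^sup>2 * Y\<^sup>2"
      by (simp add: inversion_def X_def Y_def power_divide power2_norm_eq_inner)
    also have "a \<bullet> b = ((norm a)\<^sup>2 + (norm b)\<^sup>2 - d\<^sup>2) / 2"
      by (simp add: d_def power2_norm_eq_inner inner_diff inner_commute)
    also have "norm a = 1 / X" by (simp add: X_def)
    also have "norm b = 1 / Y" by (simp add: Y_def)
    also have "norm (inversion a) = X" by (simp add: X_def norm_inversion)
    also have "norm (inversion b) = Y" by (simp add: Y_def norm_inversion)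
    also have "X\<^sup>2 + Y\<^sup>2 - 2 * (((1 / X)\<^sup>2 + (1 / Y)\<^sup>2 - d\<^sup>2) / 2 * X\<^sup>2 * Y\<^sup>2) = d\<^sup>2 * X\<^sup>2 * Y\<^sup>2"
      using X Y by (simp add: field_simps)
    finally have eq: "(norm (inversion a - inversion b))\<^sup>2 = d\<^sup>2 * X\<^sup>2 * Y\<^sup>2" .
    have dle: "d \<le> 1 / X + 1 / Y" using norm_triangle_ineq4[of a b] by (simp add: d_def X_def Y_def)
    \<comment> \<open>By the identity just proved, this is the triangle inequality for the two
      inverted points.\<close>
    have dXY: "d * (X * Y) \<le> X + Y"
    proof -
      have "(1 / X + 1 / Y) * (X * Y) = X + Y" using X Y by (simp add: distrib_right)
      then show ?thesis using mult_right_mono[OF dle, of "X * Y"] X Y by simp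
    qed
    have cube: "(X + Y) * (X * Y) \<le> X ^ 3 + Y ^ 3"
    proof -
      have "0 \<le> (X + Y) * (X - Y)\<^sup>2" using X Y by simp
      then show ?thesis by (simp add: power2_eq_square power3_eq_cube algebra_simps)
    qed
    have sq: "(X + Y)\<^sup>2 \<le> 4 * (1 + X ^ 3 + Y ^ 3)"
    proof -
      have "(X + Y)\<^sup>2 \<le> 2 * X\<^sup>2 + 2 * Y\<^sup>2" using sum_squares_bound[of X Y] by (simp add: power2_sum)
      moreover have "0 \<le> X ^ 3" "0 \<le> Y ^ 3" using X Y by auto
      moreover have "X\<^sup>2 \<le> 1 + X ^ 3" "Y\<^sup>2 \<le> 1 + Y ^ 3" using X Y by (auto intro: square_le_one_plus_cube)
      ultimately have "(X + Y)\<^sup>2 \<le> 4 + 4 * X ^ 3 + 4 * Y ^ 3" by linarith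
      then show ?thesis by (simp add: distrib_left)
    qed
    have XY: "X ^ 3 = 1 / norm a ^ 3" "Y ^ 3 = 1 / norm b ^ 3" by (simp_all add: X_def Y_def power_divide)
    have pos: "0 \<le> 1 + X ^ 3 + Y ^ 3" using X Y by (simp add: add_nonneg_nonneg)
    show ?thesis
    \<comment> \<open>For small d one factor d is kept and the other is spent on bounding dXY by X +
      Y. For large d both factors are spent, since \<open>min 1 d\<close> is then constant.\<close>
    proof (cases "d \<le> 1")
      case True
      have "d\<^sup>2 * X\<^sup>2 * Y\<^sup>2 = d * ((d * (X * Y)) * (X * Y))" by (simp add: power2_eq_square mult_ac)
      also have "\<dots> \<le> d * ((X + Y) * (X * Y))"
        using dXY X Y d by (intro mult_left_mono mult_right_mono) auto
      also have "\<dots> \<le> d * (X ^ 3 + Y ^ 3)" using cube d by (intro mult_left_mono)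
      also have "\<dots> \<le> 4 * d * (1 + X ^ 3 + Y ^ 3)" using d X Y by (simp add: algebra_simps)
      finally show ?thesis using True by (simp add: eq XY d_def[symmetric])
    next
      case False
      have "d\<^sup>2 * X\<^sup>2 * Y\<^sup>2 = (d * (X * Y))\<^sup>2" by (simp add: power_mult_distrib mult_ac)
      also have "\<dots> \<le> (X + Y)\<^sup>2" using dXY X Y d by (intro power_mono) auto
      also note sq
      finally show ?thesis using False by (simp add: eq XY d_def[symmetric])
    qed
  qed
qed

lemma integrable_indicator_compact:
  "compact K \<Longrightarrow> integrable lborel (\<lambda>x::'a::euclidean_space. indicator K x :: real)"
  using integrable_indicator_continuous[of "\<lambda>x::'a. 1" K] by simp

text \<open>The bound is uniform in the pole \<open>p\<close>: the integrand is at most 1 outside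
  the unit ball about \<open>p\<close>, and the integral over that ball is independent of
  \<open>p\<close> by translation.\<close>

lemma inverse_norm_cube_cball:
  fixes p :: "'a::euclidean_space"
  assumes n: "DIM('a) \<ge> 4"
  shows "(\<integral>\<^sup>+w. ennreal (indicator (cball 0 1) w / norm (w - p) ^ 3) \<partial>lborel)
    \<le> ennreal (unit_ball_vol DIM('a) + (LBINT (x::'a). indicator (ball 0 1) x / norm x ^ 3))"
proof -
  have "(\<integral>\<^sup>+w. ennreal (indicator (cball 0 1) w / norm (w - p) ^ 3) \<partial>lborel)
    \<le> (\<integral>\<^sup>+w. ennreal (indicator (cball 0 1) w + indicator (ball p 1) w / norm (w - p) ^ 3) \<partial>lborel)"
  proof (intro nn_integral_mono ennreal_leI)
    fix w
    show "indicator (cball 0 1) w / norm (w - p) ^ 3 \<le> (indicator (cball 0 1) w + indicator (ball p 1) w / norm (w - p) ^ 3 :: real)"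
    proof (cases "w \<in> ball p 1")
      case True
      then show ?thesis by (simp add: indicator_def)
    next
      case False
      then have "1 \<le> norm (w - p)" by (simp add: dist_norm norm_minus_commute)
      then have "1 \<le> norm (w - p) ^ 3" by (rule one_le_power)
      then show ?thesis using False by (simp add: indicator_def divide_le_eq)
    qed
  qed
  also have "\<dots> = ennreal (LBINT w. indicator (cball 0 1) w + indicator (ball p 1) w / norm (w - p) ^ 3)"
    using integrable_indicator_compact[of "cball (0::'a) 1"] integrable_inverse_norm_cube(1)[OF n, of p]
    by (intro nn_integral_eq_integral Bochner_Integration.integrable_add AE_I2) (auto intro!: add_nonneg_nonneg)
  also have "(LBINT w. indicator (cball 0 1) w + indicator (ball p 1) w / norm (w - p) ^ 3)
      = unit_ball_vol DIM('a) + (LBINT (x::'a). indicator (ball 0 1) x / norm x ^ 3)"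
    using integrable_indicator_compact[of "cball (0::'a) 1"] integrable_inverse_norm_cube[OF n, of p] content_cball[of 1 "0::'a"]
    by (subst Bochner_Integration.integral_add) auto
  finally show ?thesis .
qed

text \<open>Vanishes identically for \<open>u x = - \<alpha> ln |x|\<close>, the model behaviour at infinity.\<close>

definition blowup :: "('a::euclidean_space \<Rightarrow> real) \<Rightarrow> real \<Rightarrow> real \<Rightarrow> 'a \<Rightarrow> 'a" where
  "blowup u \<alpha> R w = R *\<^sub>R gradient u (R *\<^sub>R w) + \<alpha> *\<^sub>R inversion w"

lemma borel_measurable_inversion: "(inversion :: 'a::euclidean_space \<Rightarrow> 'a) \<in> borel_measurable borel"
  unfolding inversion_def[abs_def]
  by (intro borel_measurable_scaleR borel_measurable_divide borel_measurable_continuous_onI continuous_intros)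

lemma borel_measurable_blowup:
  assumes "C1 u"
  shows "blowup u \<alpha> R \<in> borel_measurable borel"
  unfolding blowup_def[abs_def]
  by (intro borel_measurable_add borel_measurable_scaleR borel_measurable_const borel_measurable_inversion
      borel_measurable_continuous_onI continuous_on_compose2[OF continuous_on_gradient[OF assms]] continuous_intros) auto

text \<open>Dilation turns the kernel of the representation into minus
  \<open>inversion (w - y /\<^sub>R R)\<close>. Since the coefficient of \<open>inversion w\<close>
  in \<open>blowup\<close> contains the same integral of \<open>f\<close>, that term goes under the
  integral, and only a difference of two inversions at distance |y| / R remains. Cauchy-Schwarz with
  weight |f| is applied to each component.\<close>

lemma blowup_pointwise:
  fixes u :: "'a::euclidean_space \<Rightarrow> real"
  assumes n: "DIM('a) \<ge> 4" and f: "continuous_on UNIV f" "integrable lborel f"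
    and rep: "\<And>b x. b \<in> Basis \<Longrightarrow> partial_deriv b u x = \<kappa> * (LBINT y. f y * (((y - x) \<bullet> b) / ((y - x) \<bullet> (y - x))))"
    and R: "R > 0"
  defines "g \<equiv> \<lambda>w y. \<bar>f y\<bar> * (4 * min 1 (norm y / R) * (1 + 1 / norm w ^ 3 + 1 / norm (w - y /\<^sub>R R) ^ 3))"
  shows "integrable lborel (g w)"
    and "(norm (blowup u (\<kappa> * (LBINT y. f y)) R w))\<^sup>2 \<le> \<kappa>\<^sup>2 * (LBINT y. \<bar>f y\<bar>) * (LBINT y. g w y)"
proof -
  have mf: "f \<in> borel_measurable borel" by (rule cont_borel_measurable[OF f(1)])
  define D where "D y = inversion (w - y /\<^sub>R R) - inversion w" for y
  have nRw: "norm (w - y /\<^sub>R R) = norm (y - R *\<^sub>R w) / R" for y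
  proof -
    have "y - R *\<^sub>R w = (- R) *\<^sub>R (w - y /\<^sub>R R)" using R by (simp add: algebra_simps)
    then have "norm (y - R *\<^sub>R w) = R * norm (w - y /\<^sub>R R)" using R by (metis abs_minus_cancel abs_of_pos norm_scaleR)
    then show ?thesis using R by simp
  qed
  have icube: "integrable lborel (\<lambda>y. \<bar>f y\<bar> * (1 / norm (w - y /\<^sub>R R) ^ 3))"
    using integrable_mult_right[OF integrable_norm[OF integrable_div_norm_power[OF n order_refl f, of "R *\<^sub>R w"]], of "R ^ 3"] R
    by (simp add: nRw power_divide mult_ac)
  have iw: "integrable lborel (\<lambda>y. 4 * (\<bar>f y\<bar> * (1 + 1 / norm w ^ 3) + \<bar>f y\<bar> * (1 / norm (w - y /\<^sub>R R) ^ 3)))"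
    by (intro integrable_mult_right Bochner_Integration.integrable_add integrable_mult_left integrable_abs icube f)
  have mD: "D \<in> borel_measurable borel" unfolding D_def
    by (intro borel_measurable_diff borel_measurable_const measurable_compose[OF _ borel_measurable_inversion]
        borel_measurable_continuous_onI continuous_intros)
  have mnD: "(\<lambda>y. norm (D y)) \<in> borel_measurable borel"
    using mD by (rule measurable_compose) (rule borel_measurable_norm)
  have mg: "g w \<in> borel_measurable borel" unfolding g_def
    by (intro borel_measurable_times borel_measurable_abs mf borel_measurable_add borel_measurable_divide borel_measurable_const
        borel_measurable_continuous_onI continuous_intros) (use R in auto)
  have g0: "0 \<le> g w y" for y unfolding g_def using R
    by (intro mult_nonneg_nonneg add_nonneg_nonneg) auto
  show ig: "integrable lborel (g w)"
  proof (rule Bochner_Integration.integrable_bound[OF iw])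
    show "AE y in lborel. norm (g w y) \<le> norm (4 * (\<bar>f y\<bar> * (1 + 1 / norm w ^ 3) + \<bar>f y\<bar> * (1 / norm (w - y /\<^sub>R R) ^ 3)))"
    proof (rule AE_I2)
      fix y
      let ?A = "1 + 1 / norm w ^ 3 + 1 / norm (w - y /\<^sub>R R) ^ 3"
      have A: "0 \<le> ?A" by (intro add_nonneg_nonneg) auto
      have "g w y \<le> \<bar>f y\<bar> * (4 * 1 * ?A)" unfolding g_def using A
        by (intro mult_left_mono mult_right_mono) auto
      also have "\<dots> = 4 * (\<bar>f y\<bar> * (1 + 1 / norm w ^ 3) + \<bar>f y\<bar> * (1 / norm (w - y /\<^sub>R R) ^ 3))"
        by (simp add: algebra_simps)
      finally show "norm (g w y) \<le> norm (4 * (\<bar>f y\<bar> * (1 + 1 / norm w ^ 3) + \<bar>f y\<bar> * (1 / norm (w - y /\<^sub>R R) ^ 3)))"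
        using g0[of y] by simp
    qed
  qed (use mg in simp)
  have D2: "\<bar>f y\<bar> * (norm (D y))\<^sup>2 \<le> g w y" for y
  proof -
    have "w - y /\<^sub>R R - w = - (y /\<^sub>R R)" by simp
    then have e: "norm (w - y /\<^sub>R R - w) = norm y / R" using R by (simp add: divide_inverse mult.commute)
    have "(norm (D y))\<^sup>2 \<le> 4 * min 1 (norm (w - y /\<^sub>R R - w)) * (1 + 1 / norm (w - y /\<^sub>R R) ^ 3 + 1 / norm w ^ 3)"
      unfolding D_def by (rule inversion_diff_bound)
    then have "(norm (D y))\<^sup>2 \<le> 4 * min 1 (norm y / R) * (1 + 1 / norm w ^ 3 + 1 / norm (w - y /\<^sub>R R) ^ 3)"
      unfolding e by (simp add: add_ac)
    then show ?thesis unfolding g_def by (intro mult_left_mono) auto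
  qed
  have iD2: "integrable lborel (\<lambda>y. \<bar>f y\<bar> * (norm (D y))\<^sup>2)"
  proof (rule Bochner_Integration.integrable_bound[OF ig])
    show "(\<lambda>y. \<bar>f y\<bar> * (norm (D y))\<^sup>2) \<in> borel_measurable lborel"
      using borel_measurable_times[OF borel_measurable_abs[OF mf] borel_measurable_power[OF mnD, of 2]] by simp
    show "AE y in lborel. norm (\<bar>f y\<bar> * (norm (D y))\<^sup>2) \<le> norm (g w y)"
      using D2 g0 by (intro AE_I2) simp
  qed
  have Db: "\<bar>D y \<bullet> b\<bar> \<le> norm (D y)" if "b \<in> Basis" for y b by (rule Basis_le_norm[OF that])
  have mDb: "(\<lambda>y. D y \<bullet> b) \<in> borel_measurable borel" for b
    using mD by (intro borel_measurable_inner borel_measurable_const)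
  have iDb2: "integrable lborel (\<lambda>y. \<bar>f y\<bar> * (D y \<bullet> b)\<^sup>2)" if b: "b \<in> Basis" for b
  proof (rule Bochner_Integration.integrable_bound[OF iD2])
    show "(\<lambda>y. \<bar>f y\<bar> * (D y \<bullet> b)\<^sup>2) \<in> borel_measurable lborel"
      using borel_measurable_times[OF borel_measurable_abs[OF mf] borel_measurable_power[OF mDb[of b], of 2]] by simp
    show "AE y in lborel. norm (\<bar>f y\<bar> * (D y \<bullet> b)\<^sup>2) \<le> norm (\<bar>f y\<bar> * (norm (D y))\<^sup>2)"
    proof (rule AE_I2)
      fix y
      have "(D y \<bullet> b)\<^sup>2 \<le> (norm (D y))\<^sup>2" using Db[OF b, of y] by (metis abs_le_square_iff abs_norm_cancel)
      then show "norm (\<bar>f y\<bar> * (D y \<bullet> b)\<^sup>2) \<le> norm (\<bar>f y\<bar> * (norm (D y))\<^sup>2)" by (simp add: mult_left_mono)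
    qed
  qed
  have iDb: "integrable lborel (\<lambda>y. f y * (D y \<bullet> b))" if b: "b \<in> Basis" for b
  proof (rule Bochner_Integration.integrable_bound)
    show "integrable lborel (\<lambda>y. \<bar>f y\<bar> + \<bar>f y\<bar> * (D y \<bullet> b)\<^sup>2)" using iDb2[OF b] f by simp
    show "(\<lambda>y. f y * (D y \<bullet> b)) \<in> borel_measurable lborel"
      using borel_measurable_times[OF mf mDb] by simp
    show "AE y in lborel. norm (f y * (D y \<bullet> b)) \<le> norm (\<bar>f y\<bar> + \<bar>f y\<bar> * (D y \<bullet> b)\<^sup>2)"
    proof (rule AE_I2)
      fix y
      have "\<bar>D y \<bullet> b\<bar> \<le> 1 + (D y \<bullet> b)\<^sup>2" using sum_squares_bound[of "\<bar>D y \<bullet> b\<bar>" 1] by simp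
      then have "\<bar>f y\<bar> * \<bar>D y \<bullet> b\<bar> \<le> \<bar>f y\<bar> * (1 + (D y \<bullet> b)\<^sup>2)" by (rule mult_left_mono) simp
      then show "norm (f y * (D y \<bullet> b)) \<le> norm (\<bar>f y\<bar> + \<bar>f y\<bar> * (D y \<bullet> b)\<^sup>2)"
        by (simp add: abs_mult algebra_simps)
    qed
  qed
  have comp: "blowup u (\<kappa> * (LBINT y. f y)) R w \<bullet> b = - \<kappa> * (LBINT y. f y * (D y \<bullet> b))" if b: "b \<in> Basis" for b
  proof -
    have inv: "R * (((y - R *\<^sub>R w) \<bullet> b) / ((y - R *\<^sub>R w) \<bullet> (y - R *\<^sub>R w))) = - (inversion (w - y /\<^sub>R R) \<bullet> b)" for y
    proof -
      have "y - R *\<^sub>R w = (- R) *\<^sub>R (w - y /\<^sub>R R)" using R by (simp add: algebra_simps)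
      then show ?thesis using R by (simp add: inversion_def)
    qed
    have split: "f y * (- (inversion (w - y /\<^sub>R R) \<bullet> b)) = - (f y * (D y \<bullet> b)) - f y * (inversion w \<bullet> b)" for y
      by (simp add: D_def inner_diff_left algebra_simps)
    have "R * partial_deriv b u (R *\<^sub>R w) = \<kappa> * (R * (LBINT y. f y * (((y - R *\<^sub>R w) \<bullet> b) / ((y - R *\<^sub>R w) \<bullet> (y - R *\<^sub>R w)))))"
      using rep[OF b, of "R *\<^sub>R w"] by simp
    also have "R * (LBINT y. f y * (((y - R *\<^sub>R w) \<bullet> b) / ((y - R *\<^sub>R w) \<bullet> (y - R *\<^sub>R w))))
        = (LBINT y. R * (f y * (((y - R *\<^sub>R w) \<bullet> b) / ((y - R *\<^sub>R w) \<bullet> (y - R *\<^sub>R w)))))"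
      by (rule integral_mult_right_zero[symmetric])
    also have "\<dots> = (LBINT y. f y * (- (inversion (w - y /\<^sub>R R) \<bullet> b)))"
      by (intro Bochner_Integration.integral_cong refl) (simp only: mult.left_commute[of R] inv)
    also have "\<dots> = (LBINT y. - (f y * (D y \<bullet> b)) - f y * (inversion w \<bullet> b))"
      unfolding split ..
    also have "\<dots> = - (LBINT y. f y * (D y \<bullet> b)) - (LBINT y. f y) * (inversion w \<bullet> b)"
      using iDb[OF b] f(2) by simp
    finally show ?thesis
      by (simp add: blowup_def inner_add_left gradient_inner_Basis[OF b] algebra_simps)
  qed
  have "(norm (blowup u (\<kappa> * (LBINT y. f y)) R w))\<^sup>2 = (\<Sum>b\<in>Basis. \<kappa>\<^sup>2 * (LBINT y. f y * (D y \<bullet> b))\<^sup>2)"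
    unfolding power2_norm_eq_inner euclidean_inner[of "blowup u (\<kappa> * (LBINT y. f y)) R w" "blowup u (\<kappa> * (LBINT y. f y)) R w"]
    by (intro sum.cong refl) (simp add: comp power2_eq_square)
  also have "\<dots> \<le> (\<Sum>b\<in>Basis. \<kappa>\<^sup>2 * ((LBINT y. \<bar>f y\<bar>) * (LBINT y. \<bar>f y\<bar> * (D y \<bullet> b)\<^sup>2)))"
    by (intro sum_mono mult_left_mono Cauchy_Schwarz_weighted f iDb iDb2) auto
  also have "\<dots> = \<kappa>\<^sup>2 * (LBINT y. \<bar>f y\<bar>) * (\<Sum>b\<in>Basis. (LBINT y. \<bar>f y\<bar> * (D y \<bullet> b)\<^sup>2))"
    by (simp add: sum_distrib_left mult_ac)
  also have "(\<Sum>b\<in>Basis. (LBINT y. \<bar>f y\<bar> * (D y \<bullet> b)\<^sup>2)) = (LBINT y. (\<Sum>b\<in>Basis. \<bar>f y\<bar> * (D y \<bullet> b)\<^sup>2))"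
    by (rule Bochner_Integration.integral_sum[symmetric]) (rule iDb2)
  also have "\<dots> = (LBINT y. \<bar>f y\<bar> * (norm (D y))\<^sup>2)"
  proof (intro Bochner_Integration.integral_cong refl)
    fix y
    show "(\<Sum>b\<in>Basis. \<bar>f y\<bar> * (D y \<bullet> b)\<^sup>2) = \<bar>f y\<bar> * (norm (D y))\<^sup>2"
      unfolding power2_norm_eq_inner euclidean_inner[of "D y" "D y"] by (simp add: sum_distrib_left power2_eq_square)
  qed
  also have "\<kappa>\<^sup>2 * (LBINT y. \<bar>f y\<bar>) * (LBINT y. \<bar>f y\<bar> * (norm (D y))\<^sup>2) \<le> \<kappa>\<^sup>2 * (LBINT y. \<bar>f y\<bar>) * (LBINT y. g w y)"
    by (intro mult_left_mono integral_mono iD2 ig D2 mult_nonneg_nonneg integral_nonneg_AE AE_I2) auto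
  finally show "(norm (blowup u (\<kappa> * (LBINT y. f y)) R w))\<^sup>2 \<le> \<kappa>\<^sup>2 * (LBINT y. \<bar>f y\<bar>) * (LBINT y. g w y)" .
qed

text \<open>By Tonelli the integral over \<open>w\<close> may be taken first, and it is bounded
  uniformly in \<open>y\<close>. The constant 1, the pole at 0 and the pole at y / R contribute
  \<omega>, \<omega> + J and \<omega> + J, which is the bracket in \<open>M\<close>.\<close>

lemma blowup_L2_bound:
  fixes u :: "'a::euclidean_space \<Rightarrow> real"
  assumes n: "DIM('a) \<ge> 4" and f: "continuous_on UNIV f" "integrable lborel f"
    and rep: "\<And>b x. b \<in> Basis \<Longrightarrow> partial_deriv b u x = \<kappa> * (LBINT y. f y * (((y - x) \<bullet> b) / ((y - x) \<bullet> (y - x))))"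
    and u: "C1 u" and R: "R > 0"
  defines "\<alpha> \<equiv> \<kappa> * (LBINT y. f y)"
    and "M \<equiv> \<kappa>\<^sup>2 * (LBINT y. \<bar>f y\<bar>) * 4 * (3 * unit_ball_vol DIM('a) + 2 * (LBINT (x::'a). indicator (ball 0 1) x / norm x ^ 3))"
  shows "integrable lborel (\<lambda>w. indicator (cball 0 1) w * (norm (blowup u \<alpha> R w))\<^sup>2)"
    and "(LBINT w. indicator (cball 0 1) w * (norm (blowup u \<alpha> R w))\<^sup>2) \<le> M * (LBINT y. \<bar>f y\<bar> * min 1 (norm y / R))"
proof -
  define g where "g = (\<lambda>w y. \<bar>f y\<bar> * (4 * min 1 (norm y / R) * (1 + 1 / norm w ^ 3 + 1 / norm (w - y /\<^sub>R R) ^ 3)))"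
  define c where "c = \<kappa>\<^sup>2 * (LBINT y. \<bar>f y\<bar>)"
  define J where "J = (LBINT (x::'a). indicator (ball 0 1) x / norm x ^ 3)"
  define \<omega> where "\<omega> = unit_ball_vol (real DIM('a))"
  have mf: "f \<in> borel_measurable borel" by (rule cont_borel_measurable[OF f(1)])
  have pw1: "integrable lborel (g w)" for w
    unfolding g_def by (rule blowup_pointwise(1)[OF n f rep R])
  have pw2: "(norm (blowup u \<alpha> R w))\<^sup>2 \<le> c * (LBINT y. g w y)" for w
    unfolding g_def \<alpha>_def c_def by (rule blowup_pointwise(2)[OF n f rep R])
  have c0: "c \<ge> 0" unfolding c_def by (intro mult_nonneg_nonneg integral_nonneg_AE AE_I2) auto
  have J0: "J \<ge> 0" unfolding J_def by (intro integral_nonneg_AE AE_I2) auto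
  have \<omega>0: "\<omega> \<ge> 0" by (simp add: \<omega>_def)
  have g0: "0 \<le> g w y" for w y unfolding g_def using R
    by (intro mult_nonneg_nonneg add_nonneg_nonneg) auto
  have mB: "(\<lambda>w. indicator (cball 0 1) w * (norm (blowup u \<alpha> R w))\<^sup>2) \<in> borel_measurable borel"
    by (intro borel_measurable_times borel_measurable_indicator borel_measurable_power
        measurable_compose[OF borel_measurable_blowup[OF u] borel_measurable_norm]) auto
  define e where "e = (LBINT y. \<bar>f y\<bar> * min 1 (norm y / R))"
  have ie: "integrable lborel (\<lambda>y. \<bar>f y\<bar> * min 1 (norm y / R))"
  proof (rule Bochner_Integration.integrable_bound[OF f(2)])
    show "AE y in lborel. norm (\<bar>f y\<bar> * min 1 (norm y / R)) \<le> norm (f y)"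
      using R by (intro AE_I2) (auto simp: abs_mult intro!: mult_left_le)
    show "(\<lambda>y. \<bar>f y\<bar> * min 1 (norm y / R)) \<in> borel_measurable lborel"
      using R by (simp, intro borel_measurable_times borel_measurable_abs mf borel_measurable_continuous_onI continuous_intros) auto
  qed
  have e0: "e \<ge> 0" unfolding e_def using R by (intro integral_nonneg_AE AE_I2) auto
  have mG: "(\<lambda>(w, y). ennreal (indicator (cball 0 1) w * (c * g w y))) \<in> borel_measurable (lborel \<Otimes>\<^sub>M lborel)"
  proof -
    have "(\<lambda>z. ennreal (indicator (cball 0 1) (fst z) * (c * g (fst z) (snd z)))) \<in> borel_measurable (borel :: ('a \<times> 'a) measure)"
    proof -
      have "(\<lambda>z. indicator (cball (0::'a) 1) (fst z) :: real) \<in> borel_measurable (borel :: ('a \<times> 'a) measure)"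
        by (rule measurable_compose[OF borel_measurable_continuous_onI borel_measurable_indicator]) (auto intro!: continuous_intros)
      moreover have "(\<lambda>z. f (snd z)) \<in> borel_measurable (borel :: ('a \<times> 'a) measure)"
        by (rule measurable_compose[OF borel_measurable_continuous_onI mf]) (auto intro!: continuous_intros)
      moreover have "(\<lambda>z::'a \<times> 'a. 1 / norm (fst z) ^ 3) \<in> borel_measurable borel"
        "(\<lambda>z::'a \<times> 'a. 1 / norm (fst z - snd z /\<^sub>R R) ^ 3) \<in> borel_measurable borel"
        "(\<lambda>z::'a \<times> 'a. min 1 (norm (snd z) / R)) \<in> borel_measurable borel"
        using R by (intro borel_measurable_divide borel_measurable_const borel_measurable_continuous_onI continuous_intros; simp)+
      ultimately show ?thesis unfolding g_def
        by (intro measurable_compose[OF _ measurable_ennreal] borel_measurable_times borel_measurable_abs borel_measurable_add borel_measurable_const)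
    qed
    then show ?thesis by (simp add: lborel_prod case_prod_unfold)
  qed
  have inner: "(\<integral>\<^sup>+w. ennreal (indicator (cball 0 1) w * (c * g w y)) \<partial>lborel)
      \<le> ennreal (c * (\<bar>f y\<bar> * min 1 (norm y / R)) * (4 * (3 * \<omega> + 2 * J)))" for y
  proof -
    define q where "q = c * (4 * (\<bar>f y\<bar> * min 1 (norm y / R)))"
    have q0: "q \<ge> 0" using c0 R by (simp add: q_def)
    have mc: "(\<lambda>w. ennreal (indicator (cball (0::'a) 1) w / norm (w - p) ^ 3)) \<in> borel_measurable borel" for p
      by (intro measurable_compose[OF _ measurable_ennreal] borel_measurable_divide borel_measurable_indicator
          borel_measurable_continuous_onI continuous_intros) auto
    have mi: "(\<lambda>w. ennreal (indicator (cball (0::'a) 1) w)) \<in> borel_measurable borel"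
      by (intro measurable_compose[OF _ measurable_ennreal] borel_measurable_indicator) auto
    have "(\<integral>\<^sup>+w. ennreal (indicator (cball 0 1) w * (c * g w y)) \<partial>lborel)
       = (\<integral>\<^sup>+w. ennreal q * (ennreal (indicator (cball 0 1) w) + ennreal (indicator (cball 0 1) w / norm (w - 0) ^ 3)
            + ennreal (indicator (cball 0 1) w / norm (w - y /\<^sub>R R) ^ 3)) \<partial>lborel)"
    proof (intro nn_integral_cong)
      fix w :: 'a
      have "indicator (cball 0 1) w * (c * g w y) = q * (indicator (cball 0 1) w + indicator (cball 0 1) w / norm (w - 0) ^ 3
            + indicator (cball 0 1) w / norm (w - y /\<^sub>R R) ^ 3)"
        by (simp add: g_def q_def indicator_def algebra_simps)
      then show "ennreal (indicator (cball 0 1) w * (c * g w y)) = ennreal q * (ennreal (indicator (cball 0 1) w) + ennreal (indicator (cball 0 1) w / norm (w - 0) ^ 3)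
            + ennreal (indicator (cball 0 1) w / norm (w - y /\<^sub>R R) ^ 3))"
        using q0 by (simp only: ennreal_mult' ennreal_plus[symmetric] indicator_pos_le divide_nonneg_nonneg zero_le_power norm_ge_zero add_nonneg_nonneg)
    qed
    also have "\<dots> = ennreal q * ((\<integral>\<^sup>+w. ennreal (indicator (cball (0::'a) 1) w) \<partial>lborel) + (\<integral>\<^sup>+w. ennreal (indicator (cball (0::'a) 1) w / norm (w - 0) ^ 3) \<partial>lborel)
            + (\<integral>\<^sup>+w. ennreal (indicator (cball 0 1) w / norm (w - y /\<^sub>R R) ^ 3) \<partial>lborel))"
      using mc mi by (subst nn_integral_cmult, simp, subst nn_integral_add, simp_all, subst nn_integral_add, simp_all)
    also have "(\<integral>\<^sup>+w. ennreal (indicator (cball (0::'a) 1) w) \<partial>lborel) = ennreal \<omega>"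
      using integrable_indicator_compact[of "cball (0::'a) 1"] content_cball[of 1 "0::'a"]
      by (subst nn_integral_eq_integral) (auto simp: \<omega>_def)
    also have "ennreal q * (ennreal \<omega> + (\<integral>\<^sup>+w. ennreal (indicator (cball (0::'a) 1) w / norm (w - 0) ^ 3) \<partial>lborel)
            + (\<integral>\<^sup>+w. ennreal (indicator (cball 0 1) w / norm (w - y /\<^sub>R R) ^ 3) \<partial>lborel))
        \<le> ennreal q * (ennreal \<omega> + ennreal (\<omega> + J) + ennreal (\<omega> + J))"
      unfolding \<omega>_def J_def by (intro mult_left_mono add_mono inverse_norm_cube_cball n order_refl) auto
    also have "\<dots> = ennreal (c * (\<bar>f y\<bar> * min 1 (norm y / R)) * (4 * (3 * \<omega> + 2 * J)))"
      using q0 \<omega>0 J0 by (simp add: ennreal_plus[symmetric] ennreal_mult'[symmetric] q_def algebra_simps del: ennreal_plus)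
    finally show ?thesis .
  qed
  have "(\<integral>\<^sup>+w. ennreal (indicator (cball 0 1) w * (norm (blowup u \<alpha> R w))\<^sup>2) \<partial>lborel)
      \<le> (\<integral>\<^sup>+w. (\<integral>\<^sup>+y. ennreal (indicator (cball 0 1) w * (c * g w y)) \<partial>lborel) \<partial>lborel)"
  proof (intro nn_integral_mono)
    fix w
    have i: "integrable lborel (\<lambda>y. indicator (cball 0 1) w * (c * g w y))"
      by (intro integrable_mult_right pw1)
    have "indicator (cball 0 1) w * (norm (blowup u \<alpha> R w))\<^sup>2 \<le> indicator (cball 0 1) w * (c * (LBINT y. g w y))"
      by (intro mult_left_mono pw2) auto
    also have "\<dots> = (LBINT y. indicator (cball 0 1) w * (c * g w y))"
      by (simp only: integral_mult_right_zero)
    finally have "ennreal (indicator (cball 0 1) w * (norm (blowup u \<alpha> R w))\<^sup>2) \<le> ennreal (LBINT y. indicator (cball 0 1) w * (c * g w y))"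
      by (rule ennreal_leI)
    also have "\<dots> = (\<integral>\<^sup>+y. ennreal (indicator (cball 0 1) w * (c * g w y)) \<partial>lborel)"
      using c0 g0 by (intro nn_integral_eq_integral[symmetric] i AE_I2) auto
    finally show "ennreal (indicator (cball 0 1) w * (norm (blowup u \<alpha> R w))\<^sup>2) \<le> (\<integral>\<^sup>+y. ennreal (indicator (cball 0 1) w * (c * g w y)) \<partial>lborel)" .
  qed
  also have "\<dots> = (\<integral>\<^sup>+y. (\<integral>\<^sup>+w. ennreal (indicator (cball 0 1) w * (c * g w y)) \<partial>lborel) \<partial>lborel)"
    using lborel_pair.Fubini[OF mG] by simp
  also have "\<dots> \<le> (\<integral>\<^sup>+y. ennreal (c * (\<bar>f y\<bar> * min 1 (norm y / R)) * (4 * (3 * \<omega> + 2 * J))) \<partial>lborel)"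
    by (intro nn_integral_mono inner)
  also have "\<dots> = ennreal (LBINT y. c * (\<bar>f y\<bar> * min 1 (norm y / R)) * (4 * (3 * \<omega> + 2 * J)))"
    using c0 \<omega>0 J0 R by (intro nn_integral_eq_integral integrable_mult_left integrable_mult_right ie AE_I2) auto
  also have "(LBINT y. c * (\<bar>f y\<bar> * min 1 (norm y / R)) * (4 * (3 * \<omega> + 2 * J))) = M * e"
    unfolding e_def M_def c_def[symmetric] \<omega>_def[symmetric] J_def[symmetric]
    by (simp only: integral_mult_right_zero integral_mult_left_zero) (simp add: mult_ac)
  finally have fin: "(\<integral>\<^sup>+w. ennreal (indicator (cball 0 1) w * (norm (blowup u \<alpha> R w))\<^sup>2) \<partial>lborel) \<le> ennreal (M * e)" .
  show i: "integrable lborel (\<lambda>w. indicator (cball 0 1) w * (norm (blowup u \<alpha> R w))\<^sup>2)"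
    using mB fin by (intro integrableI_nonneg) (auto intro: le_less_trans)
  have "ennreal (LBINT w. indicator (cball 0 1) w * (norm (blowup u \<alpha> R w))\<^sup>2) \<le> ennreal (M * e)"
    using fin by (subst nn_integral_eq_integral[symmetric, OF i]) auto
  moreover have "M * e \<ge> 0" using c0 \<omega>0 J0 e0 by (simp add: M_def c_def[symmetric] \<omega>_def[symmetric] J_def[symmetric])
  ultimately show "(LBINT w. indicator (cball 0 1) w * (norm (blowup u \<alpha> R w))\<^sup>2) \<le> M * (LBINT y. \<bar>f y\<bar> * min 1 (norm y / R))"
    unfolding e_def by (subst (asm) ennreal_le_iff) auto
qed

text \<open>The truncation in min 1 (|y| / R) gives the dominating function |f|, so integrability of
  \<open>f\<close> suffices; the convergence carries no rate because \<open>f\<close> has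
  none.\<close>

lemma blowup_tendsto_L2:
  fixes u :: "'a::euclidean_space \<Rightarrow> real"
  assumes n: "DIM('a) \<ge> 4" and f: "continuous_on UNIV f" "integrable lborel f"
    and rep: "\<And>b x. b \<in> Basis \<Longrightarrow> partial_deriv b u x = \<kappa> * (LBINT y. f y * (((y - x) \<bullet> b) / ((y - x) \<bullet> (y - x))))"
    and u: "C1 u"
  shows "((\<lambda>R. LBINT w. indicator (cball 0 1) w * (norm (blowup u (\<kappa> * (LBINT y. f y)) R w))\<^sup>2) \<longlongrightarrow> 0) at_top"
proof -
  define M where "M = \<kappa>\<^sup>2 * (LBINT y. \<bar>f y\<bar>) * 4 * (3 * unit_ball_vol DIM('a) + 2 * (LBINT (x::'a). indicator (ball 0 1) x / norm x ^ 3))"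
  have mf: "f \<in> borel_measurable borel" by (rule cont_borel_measurable[OF f(1)])
  have "((\<lambda>R. LBINT y. \<bar>f y\<bar> * min 1 (norm y / R)) \<longlongrightarrow> (LBINT (y::'a). 0)) at_top"
  proof (rule integral_dominated_convergence_at_top)
    show "integrable lborel (\<lambda>y. norm (f y))" using f(2) by simp
    show "\<forall>\<^sub>F R in at_top. AE y in lborel. norm (\<bar>f y\<bar> * min 1 (norm y / R)) \<le> norm (f y)"
      using eventually_gt_at_top[of 0]
    proof (rule eventually_mono)
      fix R :: real assume "R > 0"
      then show "AE y in lborel. norm (\<bar>f y\<bar> * min 1 (norm y / R)) \<le> norm (f y)"
        by (intro AE_I2) (auto simp: abs_mult intro!: mult_left_le)
    qed
    show "AE y in lborel. ((\<lambda>R. \<bar>f y\<bar> * min 1 (norm y / R)) \<longlongrightarrow> 0) at_top"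
    proof (rule AE_I2)
      fix y :: 'a
      have "((\<lambda>R. norm y / R) \<longlongrightarrow> 0) at_top"
        by (rule tendsto_divide_0[OF tendsto_const]) (rule filterlim_mono[OF filterlim_ident at_top_le_at_infinity order_refl])
      then have "((\<lambda>R. \<bar>f y\<bar> * min 1 (norm y / R)) \<longlongrightarrow> \<bar>f y\<bar> * min 1 0) at_top"
        by (intro tendsto_intros)
      then show "((\<lambda>R. \<bar>f y\<bar> * min 1 (norm y / R)) \<longlongrightarrow> 0) at_top" by simp
    qed
    show "(\<lambda>y. \<bar>f y\<bar> * min 1 (norm y / R)) \<in> borel_measurable lborel" for R
      by (simp, intro borel_measurable_times borel_measurable_abs mf borel_measurable_min borel_measurable_const borel_measurable_divide borel_measurable_continuous_onI continuous_intros)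
  qed auto
  from tendsto_mult_right_zero[OF this[simplified], of M]
  have lim: "((\<lambda>R. M * (LBINT y. \<bar>f y\<bar> * min 1 (norm y / R))) \<longlongrightarrow> 0) at_top" .
  show ?thesis
  proof (rule tendsto_sandwich[OF _ _ tendsto_const lim])
    show "\<forall>\<^sub>F R in at_top. 0 \<le> (LBINT w. indicator (cball 0 1) w * (norm (blowup u (\<kappa> * (LBINT y. f y)) R w))\<^sup>2)"
      by (intro always_eventually allI integral_nonneg_AE AE_I2) auto
    show "\<forall>\<^sub>F R in at_top. (LBINT w. indicator (cball 0 1) w * (norm (blowup u (\<kappa> * (LBINT y. f y)) R w))\<^sup>2)
        \<le> M * (LBINT y. \<bar>f y\<bar> * min 1 (norm y / R))"
      using eventually_gt_at_top[of 0]
      by (rule eventually_mono) (use blowup_L2_bound(2)[OF n f rep u] in \<open>simp add: M_def\<close>)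
  qed
qed

section \<open>Averages of the curvature at infinity\<close>

text \<open>The factor \<open>s\<^sup>2\<close> keeps the quotient of the weight by the squared norm differentiable at the origin.\<close>

definition cutoff :: "real \<Rightarrow> real" where
  "cutoff s = s\<^sup>2 * max 0 (1 - s) ^ 3"

definition cutoff' :: "real \<Rightarrow> real" where
  "cutoff' s = 2 * s * max 0 (1 - s) ^ 3 - 3 * s\<^sup>2 * (max 0 (1 - s))\<^sup>2"

lemma cutoff_deriv: "(cutoff has_real_derivative cutoff' s) (at s)"
proof -
  have "((\<lambda>s. s\<^sup>2 * max 0 (1 - s) ^ Suc 2) has_real_derivative
      2 * s * max 0 (1 - s) ^ Suc 2 + - (real (Suc 2) * max 0 (1 - s) ^ 2) * s\<^sup>2) (at s)"
    by (intro DERIV_mult max_power_derivative) (auto intro!: derivative_eq_intros)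
  moreover have "cutoff = (\<lambda>s. s\<^sup>2 * max 0 (1 - s) ^ Suc 2)" by (simp add: cutoff_def fun_eq_iff)
  ultimately show ?thesis by (simp add: cutoff'_def mult_ac)
qed

lemma trunc_power_cutoff: "trunc_power 1 (Suc 2) cutoff"
  unfolding trunc_power_def by (rule exI[of _ "[:0, 0, 1:]"]) (simp add: cutoff_def power2_eq_square)

lemma trunc_power_cutoff': "trunc_power 1 (Suc 1) cutoff'"
proof -
  have "cutoff' s = poly [:0, 2, -5:] s * max 0 (1 - s) ^ Suc 1" for s
    by (auto simp: cutoff'_def max_def power2_eq_square power3_eq_cube algebra_simps)
  then show ?thesis unfolding trunc_power_def by blast
qed

text \<open>\<open>cutoff s / s\<close> with the singularity at 0 removed: the weight that results
  when |\<open>inversion w\<close>|^2 is multiplied by the cutoff at s = |w|^2.\<close>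

definition cutoff_quot :: "real \<Rightarrow> real" where
  "cutoff_quot s = s * max 0 (1 - s) ^ 3"

lemma trunc_power_cutoff_quot: "trunc_power 1 (Suc 2) cutoff_quot"
  unfolding trunc_power_def by (rule exI[of _ "[:0, 1:]"]) (simp add: cutoff_quot_def)

text \<open>The divergence theorem for the field \<open>cutoff\<close> (|x|^2) x / |x|^2, whose
  divergence is 2 \<open>cutoff'\<close> + (2m - 2) \<open>cutoff_quot\<close> at |x|^2, carried out
  on moments.\<close>

lemma integral_cutoff':
  assumes m: "DIM('a::euclidean_space) = 2 * m" "m \<ge> 2"
  shows "(LBINT (x::'a). radial 0 cutoff' x) = - (real m - 1) * (LBINT (x::'a). radial 0 cutoff_quot x)"
proof -
  obtain k where k: "m = Suc (Suc k)" using m(2) le_Suc_ex[of 2 m] by auto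
  have d: "deriv cutoff = cutoff'" using DERIV_imp_deriv[OF cutoff_deriv] by blast
  have A: "moment m (deriv cutoff') = - real m * moment (Suc k) cutoff'"
    using moment_deriv(1)[OF trunc_power_cutoff', of "Suc k"] by (simp add: k)
  have B: "moment (Suc k) cutoff' = - real (Suc k) * moment k cutoff"
    using moment_deriv(1)[OF trunc_power_cutoff, of k] d by simp
  have A': "moment m (deriv cutoff') = real m * (real m - 1) * moment k cutoff"
    unfolding A B by (simp add: k algebra_simps)
  have Q: "moment m (deriv cutoff_quot) = - real m * moment (Suc k) cutoff_quot"
    using moment_deriv(1)[OF trunc_power_cutoff_quot, of "Suc k"] by (simp add: k)
  have Q': "moment (Suc k) cutoff_quot = moment k cutoff"
    by (simp add: moment_def cutoff_def cutoff_quot_def power2_eq_square mult_ac)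
  show ?thesis
    unfolding integral_radial[OF trunc_power_cutoff' order_refl m(1)]
      integral_radial[OF trunc_power_cutoff_quot one_le_numeral m(1)] A' Q Q'
    by (simp add: algebra_simps)
qed

lemma integral_cutoff_quot_pos: "(LBINT (x::'a::euclidean_space). radial 0 cutoff_quot x) > 0"
proof -
  have nn: "radial 0 cutoff_quot x \<ge> 0" for x :: 'a by (simp add: radial_def cutoff_quot_def)
  have c: "continuous_on UNIV (radial (0::'a) cutoff_quot)" unfolding radial_def[abs_def]
    by (intro continuous_on_compose2[OF trunc_power_continuous[OF trunc_power_cutoff_quot]] continuous_intros) auto
  have i: "integrable lborel (radial (0::'a) cutoff_quot)"
    by (intro integrable_bounded_support bounded_support_radial[OF trunc_power_cutoff_quot] c) simp
  have "(LBINT (x::'a). radial 0 cutoff_quot x) \<noteq> 0"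
  proof
    assume "(LBINT (x::'a). radial 0 cutoff_quot x) = 0"
    then have "AE x::'a in lborel. radial 0 cutoff_quot x = 0"
      using integral_nonneg_eq_0_iff_AE[OF i] nn by auto
    moreover have "AE x::'a in lborel. x \<noteq> 0" by (rule AE_lborel_singleton)
    ultimately have "AE x::'a in lborel. x \<notin> ball 0 1"
    proof eventually_elim
      case (elim x)
      show ?case
      proof
        assume "x \<in> ball 0 1"
        then have "x \<bullet> x < 1" using power_strict_mono[of "norm x" 1 2] by (simp add: power2_norm_eq_inner)
        then show False using elim by (simp add: radial_def cutoff_quot_def)
      qed
    qed
    then have "emeasure lborel (ball (0::'a) 1) = 0"
      using AE_iff_measurable[of "ball (0::'a) 1" lborel "\<lambda>x. x \<notin> ball 0 1"] by (simp add: ball_def)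
    then have "measure lborel (ball (0::'a) 1) = 0" by (simp add: measure_def)
    then show False using content_ball_gt_0_iff[of "0::'a" 1] by simp
  qed
  moreover have "(LBINT (x::'a). radial 0 cutoff_quot x) \<ge> 0"
    by (intro integral_nonneg_AE AE_I2 nn)
  ultimately show ?thesis by simp
qed

text \<open>Once the Laplacian has moved onto the weight, only grad u occurs, and x = R w produces
  the factor R^(2m-2). In the limit the square contributes (m-1) \<alpha>^2 J and the linear term 2
  \<alpha> times the integral of \<open>cutoff'\<close>, that is -2 (m-1) \<alpha> J.\<close>

lemma curvature_average_limit:
  fixes u :: "'a::euclidean_space \<Rightarrow> real"
  assumes m: "DIM('a) = 2 * m" "m \<ge> 2" and f: "continuous_on UNIV f" "integrable lborel f"
    and rep: "\<And>b x. b \<in> Basis \<Longrightarrow> partial_deriv b u x = \<kappa> * (LBINT y. f y * (((y - x) \<bullet> b) / ((y - x) \<bullet> (y - x))))"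
    and u: "smooth u"
  defines "\<alpha> \<equiv> \<kappa> * (LBINT y. f y)"
  shows "((\<lambda>R. (LBINT x. (laplacian u x + (real m - 1) * (norm (gradient u x))\<^sup>2) * cutoff ((x \<bullet> x) / R\<^sup>2)) / R ^ (2 * m - 2))
     \<longlongrightarrow> (real m - 1) * (LBINT (x::'a). radial 0 cutoff_quot x) * (\<alpha>\<^sup>2 - 2 * \<alpha>)) at_top"
proof -
  have n4: "DIM('a) \<ge> 4" using m by simp
  have C1u: "C1 u" using u by (rule smooth_C1)
  define J where "J = (LBINT (x::'a). radial 0 cutoff_quot x)"
  define E where "E R = (LBINT w. indicator (cball 0 1) w * (norm (blowup u \<alpha> R w))\<^sup>2)" for R
  define I where "I R = (LBINT x. (laplacian u x + (real m - 1) * (norm (gradient u x))\<^sup>2) * cutoff ((x \<bullet> x) / R\<^sup>2))" for R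
  have E: "(E \<longlongrightarrow> 0) at_top"
    unfolding E_def[abs_def] \<alpha>_def by (rule blowup_tendsto_L2[OF n4 f rep C1u])
  have E0: "E R \<ge> 0" for R unfolding E_def by (intro integral_nonneg_AE AE_I2) auto
  define \<omega> where "\<omega> = unit_ball_vol (real DIM('a))"
  have cc: "continuous_on UNIV cutoff" and cc': "continuous_on UNIV cutoff'" and cq: "continuous_on UNIV cutoff_quot"
    using trunc_power_continuous trunc_power_cutoff trunc_power_cutoff' trunc_power_cutoff_quot by blast+
  have cg: "continuous_on UNIV (gradient u)" by (rule continuous_on_gradient[OF C1u])
  obtain C where C: "C \<ge> 0" "\<And>s. s \<in> {0..1} \<Longrightarrow> \<bar>cutoff' s\<bar> \<le> C"
    using continuous_bounded_compact[OF cc' compact_Icc] by blast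
  define P where "P R w = R *\<^sub>R gradient u (R *\<^sub>R w)" for R w
  define T where "T R w = (real m - 1) * (norm (P R w))\<^sup>2 * cutoff (w \<bullet> w) - 2 * cutoff' (w \<bullet> w) * (P R w \<bullet> w)" for R w
  \<comment> \<open>\<open>T\<close> with the dilated gradient \<open>P\<close> replaced by its
    limit \<open>- \<alpha> *\<^sub>R inversion w\<close>.\<close>
  define L where "L w = (real m - 1) * \<alpha>\<^sup>2 * radial 0 cutoff_quot w + 2 * \<alpha> * radial 0 cutoff' w" for w :: 'a
  have cP: "continuous_on UNIV (P R)" for R unfolding P_def
    by (intro continuous_intros continuous_on_compose2[OF cg]) auto
  have zero: "cutoff (w \<bullet> w) = 0" "cutoff' (w \<bullet> w) = 0" "cutoff_quot (w \<bullet> w) = 0" if "w \<notin> cball 0 1" for w :: 'a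
  proof -
    have "1 \<le> w \<bullet> w" using that power_mono[of 1 "norm w" 2] by (simp add: power2_norm_eq_inner)
    then show "cutoff (w \<bullet> w) = 0" "cutoff' (w \<bullet> w) = 0" "cutoff_quot (w \<bullet> w) = 0"
      by (auto simp: cutoff_def cutoff'_def cutoff_quot_def)
  qed
  have iT: "integrable lborel (T R)" for R unfolding T_def
    by (intro integrable_bounded_support bounded_supportI[of 1] continuous_intros
        continuous_on_compose2[OF cc] continuous_on_compose2[OF cc'] cP) (auto simp: zero)
  have icq: "integrable lborel (radial (0::'a) cutoff_quot)" "integrable lborel (radial (0::'a) cutoff')"
    unfolding radial_def[abs_def]
    by (intro integrable_bounded_support bounded_supportI[of 1] continuous_intros
        continuous_on_compose2[OF cq] continuous_on_compose2[OF cc']; auto simp: zero)+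
  have iL: "integrable lborel L" unfolding L_def by (intro Bochner_Integration.integrable_add integrable_mult_right icq)
  have intL: "(LBINT w. L w) = (real m - 1) * J * (\<alpha>\<^sup>2 - 2 * \<alpha>)"
  proof -
    have "(LBINT w. L w) = (real m - 1) * \<alpha>\<^sup>2 * J + 2 * \<alpha> * (LBINT (x::'a). radial 0 cutoff' x)"
      unfolding L_def J_def using icq by simp
    then show ?thesis unfolding integral_cutoff'[OF m] J_def by (simp add: algebra_simps)
  qed
  have IT: "I R / R ^ (2 * m - 2) = (LBINT w. T R w)" if R: "R > 0" for R
  proof -
    define W where "W = radial (0::'a) (\<lambda>s. cutoff (s / R\<^sup>2))"
    have dW: "((\<lambda>s. cutoff (s / R\<^sup>2)) has_real_derivative cutoff' (s / R\<^sup>2) * (1 / R\<^sup>2)) (at s)" for s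
      by (intro DERIV_chain2[OF cutoff_deriv] DERIV_cdivide DERIV_ident)
    have cW: "continuous_on UNIV (\<lambda>s. cutoff' (s / R\<^sup>2) * (1 / R\<^sup>2))"
      using R by (intro continuous_intros continuous_on_compose2[OF cc']) auto
    have C1W: "C1 W" unfolding W_def by (rule C1_radial[OF dW cW])
    have sW: "bounded_support W" unfolding W_def using R
      by (intro bounded_support_radial[OF trunc_power_scale[OF trunc_power_cutoff]]) auto
    have gW: "gradient W x = (2 * cutoff' ((x \<bullet> x) / R\<^sup>2) / R\<^sup>2) *\<^sub>R x" for x
    proof -
      have "gradient W x = (\<Sum>b\<in>Basis. (2 * cutoff' ((x \<bullet> x) / R\<^sup>2) / R\<^sup>2) *\<^sub>R ((x \<bullet> b) *\<^sub>R b))"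
        unfolding gradient_def W_def partial_deriv_radial[OF dW] by (simp add: mult_ac)
      then show ?thesis unfolding scaleR_sum_right[symmetric] euclidean_representation .
    qed
    have cnl: "continuous_on UNIV (neg_laplacian u)" using u by (intro C1_cont smooth_C1 smooth_neg_laplacian)
    have i1: "integrable lborel (\<lambda>x. neg_laplacian u x * W x)"
      by (intro integrable_mult_bounded_support sW cnl C1_cont[OF C1W])
    have i2: "integrable lborel (\<lambda>x. (real m - 1) * (norm (gradient u x))\<^sup>2 * W x)"
      by (intro integrable_mult_bounded_support sW continuous_intros cg C1_cont[OF C1W])
    have i3: "integrable lborel (\<lambda>x. gradient u x \<bullet> gradient W x)"
    proof (intro integrable_bounded_support bounded_supportI[of R] continuous_on_inner cg continuous_on_gradient[OF C1W])
      fix x :: 'a assume "R < norm x"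
      then have "norm (x /\<^sub>R R) > 1" using R by (simp add: field_simps)
      then have "cutoff' ((x /\<^sub>R R) \<bullet> (x /\<^sub>R R)) = 0" by (intro zero) auto
      moreover have "(x /\<^sub>R R) \<bullet> (x /\<^sub>R R) = (x \<bullet> x) / R\<^sup>2" by (simp add: power2_eq_square field_simps)
      ultimately show "gradient u x \<bullet> gradient W x = 0" by (simp add: gW)
    qed
    have "I R = (LBINT x. - (neg_laplacian u x * W x) + (real m - 1) * (norm (gradient u x))\<^sup>2 * W x)"
      unfolding I_def by (intro Bochner_Integration.integral_cong refl) (simp add: W_def radial_def neg_laplacian_def algebra_simps)
    also have "\<dots> = - (LBINT x. gradient u x \<bullet> gradient W x) + (LBINT x. (real m - 1) * (norm (gradient u x))\<^sup>2 * W x)"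
      using i1 i2 integral_laplacian_by_parts[OF smooth_C2[OF u] C1W sW] by simp
    also have "\<dots> = (LBINT x. (real m - 1) * (norm (gradient u x))\<^sup>2 * W x - gradient u x \<bullet> gradient W x)"
      using i2 i3 by simp
    also have "\<dots> = R ^ DIM('a) * (LBINT w. (real m - 1) * (norm (gradient u (0 + R *\<^sub>R w)))\<^sup>2 * W (0 + R *\<^sub>R w)
        - gradient u (0 + R *\<^sub>R w) \<bullet> gradient W (0 + R *\<^sub>R w))"
      using R by (intro lborel_scale(2) cont_borel_measurable continuous_intros cg C1_cont[OF C1W] continuous_on_gradient[OF C1W])
    also have "\<dots> = R ^ (2 * m - 2) * (LBINT w. R\<^sup>2 * ((real m - 1) * (norm (gradient u (0 + R *\<^sub>R w)))\<^sup>2 * W (0 + R *\<^sub>R w)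
        - gradient u (0 + R *\<^sub>R w) \<bullet> gradient W (0 + R *\<^sub>R w)))"
    proof -
      have "2 * m - 2 + 2 = 2 * m" using m by simp
      then have "R ^ DIM('a) = R ^ (2 * m - 2) * R\<^sup>2" unfolding m(1) by (metis power_add)
      then show ?thesis by (simp only: integral_mult_right_zero mult.assoc)
    qed
    also have "(LBINT w. R\<^sup>2 * ((real m - 1) * (norm (gradient u (0 + R *\<^sub>R w)))\<^sup>2 * W (0 + R *\<^sub>R w)
        - gradient u (0 + R *\<^sub>R w) \<bullet> gradient W (0 + R *\<^sub>R w))) = (LBINT w. T R w)"
    proof (intro Bochner_Integration.integral_cong refl)
      fix w :: 'a
      have s: "((R *\<^sub>R w) \<bullet> (R *\<^sub>R w)) / R\<^sup>2 = w \<bullet> w" using R by (simp add: power2_eq_square)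
      show "R\<^sup>2 * ((real m - 1) * (norm (gradient u (0 + R *\<^sub>R w)))\<^sup>2 * W (0 + R *\<^sub>R w)
        - gradient u (0 + R *\<^sub>R w) \<bullet> gradient W (0 + R *\<^sub>R w)) = T R w"
      proof -
        have a: "W (0 + R *\<^sub>R w) = cutoff (w \<bullet> w)" using s by (simp add: W_def radial_def)
        have b: "gradient W (0 + R *\<^sub>R w) = (2 * cutoff' (w \<bullet> w) / R) *\<^sub>R w"
          unfolding gW add_0 s using R by (simp add: power2_eq_square)
        show ?thesis unfolding a b using R
          by (simp add: T_def P_def power_mult_distrib right_diff_distrib power2_eq_square)
      qed
    qed
    finally show ?thesis using R by simp
  qed
  \<comment> \<open>Coefficient of |B| in the error: one summand from the cross term of the square,
    one from the linear term.\<close>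
  define c where "c = 2 * (real m - 1) * \<bar>\<alpha>\<bar> + 2 * C"
  have c0: "c \<ge> 0" using C m by (simp add: c_def)
  have err: "\<bar>T R w - L w\<bar> \<le> indicator (cball 0 1) w * ((real m - 1) * (norm (blowup u \<alpha> R w))\<^sup>2 + c * norm (blowup u \<alpha> R w))" for R w
  proof (cases "w \<in> cball 0 1")
    case True
    define B where "B = blowup u \<alpha> R w"
    define K where "K = inversion w"
    have PB: "P R w = B - \<alpha> *\<^sub>R K" by (simp add: P_def B_def K_def blowup_def)
    have w1: "norm w \<le> 1" using True by simp
    define s where "s = w \<bullet> w"
    have s01: "s \<in> {0..1}" using w1 power_mono[of "norm w" 1 2] by (simp add: s_def power2_norm_eq_inner[symmetric])
    \<comment> \<open>At w = 0 the convention makes \<open>K\<close> vanish, which is harmless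
      because \<open>cutoff' 0 = 0\<close>.\<close>
    have Kw: "cutoff' s * (K \<bullet> w) = cutoff' s"
      by (cases "w = 0") (auto simp: K_def inversion_def s_def cutoff'_def)
    have KK: "(norm K)\<^sup>2 * cutoff s = cutoff_quot s"
      by (cases "w = 0") (auto simp: K_def norm_inversion s_def cutoff_def cutoff_quot_def power2_norm_eq_inner power_divide power2_eq_square[of "w \<bullet> w"])
    have max01: "0 \<le> max 0 (1 - s) ^ 3" "max 0 (1 - s) ^ 3 \<le> 1" using s01 by (auto intro!: power_le_one)
    have F01: "0 \<le> cutoff s" "cutoff s \<le> 1"
      using s01 max01 unfolding cutoff_def by (auto intro!: mult_le_one power_le_one)
    have KF: "norm K * cutoff s \<le> 1"
    proof (cases "w = 0")
      case False
      have "norm K * cutoff s = norm w ^ 3 * max 0 (1 - s) ^ 3"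
        using False by (simp add: K_def norm_inversion cutoff_def s_def power2_norm_eq_inner[symmetric] power2_eq_square power3_eq_cube)
      also have "\<dots> \<le> 1" using max01 w1 s01 by (intro mult_le_one power_le_one) auto
      finally show ?thesis .
    qed (simp add: K_def inversion_def)
    have "T R w - L w = (real m - 1) * (cutoff s * (norm B)\<^sup>2 - 2 * \<alpha> * (cutoff s * (B \<bullet> K))) - 2 * (cutoff' s * (B \<bullet> w))"
    proof -
      have e: "(norm (P R w))\<^sup>2 = (norm B)\<^sup>2 - 2 * \<alpha> * (B \<bullet> K) + \<alpha>\<^sup>2 * (norm K)\<^sup>2"
        unfolding PB power2_norm_eq_inner by (simp add: inner_diff inner_commute power2_eq_square algebra_simps)
      have e1: "(norm (P R w))\<^sup>2 * cutoff s = cutoff s * (norm B)\<^sup>2 - 2 * \<alpha> * (cutoff s * (B \<bullet> K)) + \<alpha>\<^sup>2 * cutoff_quot s"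
        unfolding e KK[symmetric] by (simp add: algebra_simps)
      have e2: "cutoff' s * (P R w \<bullet> w) = cutoff' s * (B \<bullet> w) - \<alpha> * cutoff' s"
        unfolding PB inner_diff_left inner_scaleR_left right_diff_distrib by (simp add: Kw mult.left_commute)
      have e3: "T R w = (real m - 1) * ((norm (P R w))\<^sup>2 * cutoff s) - 2 * (cutoff' s * (P R w \<bullet> w))"
        by (simp add: T_def s_def)
      show ?thesis unfolding e3 e1 e2 by (simp add: L_def radial_def s_def[symmetric] algebra_simps)
    qed
    moreover have "\<bar>cutoff s * (norm B)\<^sup>2\<bar> \<le> (norm B)\<^sup>2" using F01 by (simp add: mult_left_le_one_le)
    moreover have "\<bar>2 * \<alpha> * (cutoff s * (B \<bullet> K))\<bar> \<le> 2 * \<bar>\<alpha>\<bar> * norm B"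
    proof -
      have "\<bar>cutoff s * (B \<bullet> K)\<bar> \<le> cutoff s * (norm B * norm K)"
        using F01 Cauchy_Schwarz_ineq2[of B K] by (simp add: abs_mult mult_left_mono)
      also have "\<dots> \<le> norm B * 1" using mult_left_mono[OF KF, of "norm B"] by (simp add: mult_ac)
      finally have "2 * \<bar>\<alpha>\<bar> * \<bar>cutoff s * (B \<bullet> K)\<bar> \<le> 2 * \<bar>\<alpha>\<bar> * (norm B * 1)" by (intro mult_left_mono) auto
      then show ?thesis by (simp add: abs_mult)
    qed
    moreover have "\<bar>cutoff' s * (B \<bullet> w)\<bar> \<le> C * norm B"
    proof -
      have "\<bar>B \<bullet> w\<bar> \<le> norm B * norm w" by (rule Cauchy_Schwarz_ineq2)
      also have "\<dots> \<le> norm B" using w1 by (simp add: mult_left_le)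
      finally show ?thesis unfolding abs_mult using C(2)[OF s01] C(1) by (intro mult_mono) auto
    qed
    moreover have "\<bar>a * (x - y) - 2 * z\<bar> \<le> a * (X + Y) + 2 * Z" if "a \<ge> 0" "\<bar>x\<bar> \<le> X" "\<bar>y\<bar> \<le> Y" "\<bar>z\<bar> \<le> Z" for a x y z X Y Z :: real
    proof -
      have "\<bar>a * (x - y)\<bar> \<le> a * (X + Y)" unfolding abs_mult using that by (intro mult_mono) auto
      then show ?thesis using that by linarith
    qed
    ultimately have "\<bar>T R w - L w\<bar> \<le> (real m - 1) * ((norm B)\<^sup>2 + 2 * \<bar>\<alpha>\<bar> * norm B) + 2 * (C * norm B)"
      using m by simp
    then show ?thesis using True by (simp add: B_def c_def algebra_simps)
  next
    case False
    then show ?thesis using zero[OF False] by (simp add: T_def L_def radial_def)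
  qed
  \<comment> \<open>\<open>E R\<close> itself controls the quadratic error; Cauchy-Schwarz against
    the indicator of the unit ball controls the linear one.\<close>
  have bound: "norm (I R / R ^ (2 * m - 2) - (real m - 1) * J * (\<alpha>\<^sup>2 - 2 * \<alpha>)) \<le> (real m - 1) * E R + c * sqrt (\<omega> * E R)" if R: "R > 0" for R
  proof -
    let ?B = "\<lambda>w. norm (blowup u \<alpha> R w)"
    have ii: "integrable lborel (\<lambda>w::'a. indicator (cball 0 1) w :: real)" by (rule integrable_indicator_compact) simp
    have iB2: "integrable lborel (\<lambda>w. indicator (cball 0 1) w * (?B w)\<^sup>2)"
      using blowup_L2_bound(1)[OF n4 f rep C1u R] by (simp add: \<alpha>_def)
    have mB: "(\<lambda>w. indicator (cball 0 1) w * ?B w) \<in> borel_measurable borel"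
      by (intro borel_measurable_times borel_measurable_indicator
        measurable_compose[OF borel_measurable_blowup[OF C1u] borel_measurable_norm]) auto
    have iB: "integrable lborel (\<lambda>w. indicator (cball 0 1) w * ?B w)"
    proof (rule Bochner_Integration.integrable_bound)
      show "integrable lborel (\<lambda>w. indicator (cball 0 1) w + indicator (cball 0 1) w * (?B w)\<^sup>2)"
        by (intro Bochner_Integration.integrable_add ii iB2)
      show "AE w in lborel. norm (indicator (cball 0 1) w * ?B w) \<le> norm (indicator (cball 0 1) w + indicator (cball 0 1) w * (?B w)\<^sup>2)"
      proof (rule AE_I2)
        fix w
        have "2 * ?B w \<le> (?B w)\<^sup>2 + 1" using sum_squares_bound[of "?B w" 1] by simp
        then have "?B w \<le> 1 + (?B w)\<^sup>2" using norm_ge_zero[of "blowup u \<alpha> R w"] by linarith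
        then show "norm (indicator (cball 0 1) w * ?B w) \<le> norm (indicator (cball 0 1) w + indicator (cball 0 1) w * (?B w)\<^sup>2)"
          by (simp add: indicator_def)
      qed
    qed (use mB in simp)
    have "(LBINT w. indicator (cball 0 1) w * (indicator (cball 0 1) w * ?B w))\<^sup>2
       \<le> (LBINT w. (indicator (cball (0::'a) 1) w)\<^sup>2) * (LBINT w. (indicator (cball 0 1) w * ?B w)\<^sup>2)"
    proof (rule Cauchy_Schwarz_integral)
      have "(\<lambda>w. (indicator (cball (0::'a) 1) w :: real)\<^sup>2) = indicator (cball 0 1)" by (auto simp: indicator_def)
      then show "integrable lborel (\<lambda>w. (indicator (cball (0::'a) 1) w :: real)\<^sup>2)" using ii by simp
      have "(\<lambda>w. (indicator (cball 0 1) w * ?B w)\<^sup>2) = (\<lambda>w. indicator (cball 0 1) w * (?B w)\<^sup>2)" by (auto simp: indicator_def)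
      then show "integrable lborel (\<lambda>w. (indicator (cball 0 1) w * ?B w)\<^sup>2)" using iB2 by simp
      have "(\<lambda>w. indicator (cball 0 1) w * (indicator (cball 0 1) w * ?B w)) = (\<lambda>w. indicator (cball 0 1) w * ?B w)" by (auto simp: indicator_def)
      then show "integrable lborel (\<lambda>w. indicator (cball 0 1) w * (indicator (cball 0 1) w * ?B w))" using iB by simp
    qed
    also have "(LBINT w. (indicator (cball (0::'a) 1) w :: real)\<^sup>2) = (LBINT w. indicator (cball (0::'a) 1) w)"
      by (intro Bochner_Integration.integral_cong refl) (simp add: indicator_def)
    also have "\<dots> = \<omega>" using content_cball[of 1 "0::'a"] by (simp add: \<omega>_def)
    also have "(LBINT w. (indicator (cball 0 1) w * ?B w)\<^sup>2) = E R"
      unfolding E_def by (intro Bochner_Integration.integral_cong refl) (simp add: indicator_def)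
    also have "(LBINT w. indicator (cball 0 1) w * (indicator (cball 0 1) w * ?B w)) = (LBINT w. indicator (cball 0 1) w * ?B w)"
      by (intro Bochner_Integration.integral_cong refl) (simp add: indicator_def)
    finally have cs: "(LBINT w. indicator (cball 0 1) w * ?B w) \<le> sqrt (\<omega> * E R)" by (rule real_le_rsqrt)
    have "norm (LBINT w. T R w - L w) \<le> (LBINT w. (real m - 1) * (indicator (cball 0 1) w * (?B w)\<^sup>2) + c * (indicator (cball 0 1) w * ?B w))"
    proof (rule Bochner_Integration.integral_norm_bound_integral)
      show "norm (T R w - L w) \<le> (real m - 1) * (indicator (cball 0 1) w * (?B w)\<^sup>2) + c * (indicator (cball 0 1) w * ?B w)" for w
        using err[of R w] by (simp add: algebra_simps)
    qed (intro Bochner_Integration.integrable_diff Bochner_Integration.integrable_add integrable_mult_right iT iL iB iB2)+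
    also have "\<dots> = (real m - 1) * E R + c * (LBINT w. indicator (cball 0 1) w * ?B w)"
      using iB iB2 by (simp add: E_def)
    also have "\<dots> \<le> (real m - 1) * E R + c * sqrt (\<omega> * E R)"
      by (intro add_left_mono mult_left_mono cs c0)
    finally show ?thesis using iT iL intL IT[OF R] by simp
  qed
  have "((\<lambda>R. (real m - 1) * E R + c * sqrt (\<omega> * E R)) \<longlongrightarrow> (real m - 1) * 0 + c * sqrt (\<omega> * 0)) at_top"
    by (intro tendsto_intros E)
  then have lim0: "((\<lambda>R. (real m - 1) * E R + c * sqrt (\<omega> * E R)) \<longlongrightarrow> 0) at_top" by simp
  have "((\<lambda>R. I R / R ^ (2 * m - 2) - (real m - 1) * J * (\<alpha>\<^sup>2 - 2 * \<alpha>)) \<longlongrightarrow> 0) at_top"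
    by (rule Lim_null_comparison[OF eventually_mono[OF eventually_gt_at_top[of 0] bound] lim0])
  then show ?thesis unfolding I_def J_def by (simp add: LIM_zero_iff)
qed

text \<open>Hoelder's inequality over the whole ball would give only boundedness at this scale.
  Smallness comes from the tail of the integral of h^m, while the contribution of any fixed ball is
  killed by R^(2m-2).\<close>

lemma scaled_average_tendsto_0:
  fixes h :: "'a::euclidean_space \<Rightarrow> real"
  assumes m: "DIM('a) = 2 * m" "m \<ge> 2" and c: "continuous_on UNIV h"
    and h: "\<And>x. 0 \<le> h x" "integrable lborel (\<lambda>x. h x ^ m)"
  shows "((\<lambda>R. (LBINT x. indicator (cball 0 R) x * h x) / R ^ (2 * m - 2)) \<longlongrightarrow> 0) at_top"
proof (rule tendstoI)
  fix e :: real assume e: "e > 0"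
  define \<omega> where "\<omega> = unit_ball_vol (real DIM('a))"
  have \<omega>: "\<omega> > 0" unfolding \<omega>_def by simp
  \<comment> \<open>Chosen so that each of three errors is at most e/3: the fixed ball of radius k,
    the constant \<delta> integrated over the ball of radius R, and the tail divided by
    \<delta>^(m-1).\<close>
  define \<delta> where "\<delta> = e / (3 * \<omega>)"
  have \<delta>: "\<delta> > 0" using e \<omega> by (simp add: \<delta>_def)
  have mh: "h \<in> borel_measurable borel" by (rule cont_borel_measurable[OF c])
  have mind: "(\<lambda>x. indicator (- cball 0 k) x * h x ^ m) \<in> borel_measurable borel" for k
    by (intro borel_measurable_times borel_measurable_indicator borel_measurable_power mh) auto
  have "((\<lambda>k. LBINT x. indicator (- cball 0 k) x * h x ^ m) \<longlongrightarrow> (LBINT (x::'a). 0)) at_top"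
  proof (rule integral_dominated_convergence_at_top[OF _ _ h(2)])
    show "\<forall>\<^sub>F k in at_top. AE x in lborel. norm (indicator (- cball 0 k) x * h x ^ m) \<le> h x ^ m"
      using h(1) by (intro always_eventually allI AE_I2) (auto simp: indicator_def)
    show "AE x in lborel. ((\<lambda>k. indicator (- cball 0 k) x * h x ^ m) \<longlongrightarrow> 0) at_top"
    proof (rule AE_I2)
      fix x :: 'a
      have "\<forall>\<^sub>F k in at_top. indicator (- cball 0 k) x * h x ^ m = 0"
        using eventually_ge_at_top[of "norm x"] by (rule eventually_mono) simp
      then show "((\<lambda>k. indicator (- cball 0 k) x * h x ^ m) \<longlongrightarrow> 0) at_top" by (rule tendsto_eventually)
    qed
    show "(\<lambda>x. indicator (- cball 0 k) x * h x ^ m) \<in> borel_measurable lborel" for k using mind by simp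
  qed auto
  then have "((\<lambda>k. (LBINT x. indicator (- cball 0 k) x * h x ^ m)) \<longlongrightarrow> 0) at_top" by simp
  then have "\<forall>\<^sub>F k in at_top. (LBINT x. indicator (- cball 0 k) x * h x ^ m) < e * \<delta> ^ (m - 1) / 3"
    using e \<delta> by (intro order_tendstoD(2)) auto
  then obtain k where k: "(LBINT x. indicator (- cball 0 k) x * h x ^ m) < e * \<delta> ^ (m - 1) / 3"
    using eventually_happens'[OF trivial_limit_at_top_linorder] by blast
  define H where "H = (LBINT x. indicator (cball 0 k) x * h x)"
  have "((\<lambda>R::real. H / R ^ (2 * m - 2)) \<longlongrightarrow> 0) at_top"
    using m by (intro tendsto_divide_0[OF tendsto_const] filterlim_at_top_imp_at_infinity filterlim_pow_at_top filterlim_ident) auto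
  then have "\<forall>\<^sub>F R in at_top. H / R ^ (2 * m - 2) < e / 3" using e by (intro order_tendstoD(2)) auto
  then show "\<forall>\<^sub>F R in at_top. dist ((LBINT x. indicator (cball 0 R) x * h x) / R ^ (2 * m - 2)) 0 < e"
    using eventually_gt_at_top[of 0]
  proof eventually_elim
    case (elim R)
    have i1: "integrable lborel (\<lambda>x. indicator (cball 0 k) x * h x)" "integrable lborel (\<lambda>x. indicator (cball 0 R) x * h x)"
      by (intro integrable_indicator_continuous c compact_cball)+
    have i2: "integrable lborel (\<lambda>x::'a. indicator (cball 0 R) x :: real)" by (rule integrable_indicator_compact) simp
    have i3: "integrable lborel (\<lambda>x. indicator (- cball 0 k) x * h x ^ m)"
      using integrable_real_mult_indicator[OF _ h(2), of "- cball 0 k"] by (simp add: mult.commute)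
    have point: "indicator (cball 0 R) x * h x / R ^ (2 * m - 2) \<le> indicator (cball 0 k) x * h x / R ^ (2 * m - 2)
       + indicator (cball 0 R) x * (\<delta> / R ^ (2 * m)) + indicator (- cball 0 k) x * h x ^ m / \<delta> ^ (m - 1)" for x
    proof (cases "x \<in> cball 0 R \<and> x \<notin> cball 0 k")
      case True
      define t where "t = R\<^sup>2 * h x"
      have t0: "t \<ge> 0" using h(1) by (simp add: t_def)
      obtain j where j: "m = Suc j" using m by (cases m) auto
      \<comment> \<open>Either t <= \<delta>, or t^(m-1) >= \<delta>^(m-1) and the second summand
        alone exceeds t.\<close>
      have "t \<le> \<delta> + t ^ m / \<delta> ^ (m - 1)"
      proof (cases "t \<le> \<delta>")
        case True
        then show ?thesis using t0 \<delta> by (simp add: add_increasing2)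
      next
        case False
        then have "\<delta> ^ j \<le> t ^ j" using \<delta> by (intro power_mono) auto
        then have "t * \<delta> ^ j \<le> t * t ^ j" using t0 by (rule mult_left_mono)
        then have "t \<le> t ^ m / \<delta> ^ (m - 1)" using \<delta> by (simp add: j pos_le_divide_eq)
        then show ?thesis using \<delta> by simp
      qed
      then have "t / R ^ (2 * m) \<le> (\<delta> + t ^ m / \<delta> ^ (m - 1)) / R ^ (2 * m)"
        using elim by (intro divide_right_mono) auto
      moreover have "t / R ^ (2 * m) = h x / R ^ (2 * m - 2)"
      proof -
        have "2 * m - 2 + 2 = 2 * m" using m by simp
        then have "R ^ (2 * m) = R ^ (2 * m - 2) * R\<^sup>2" by (metis power_add)
        then show ?thesis using elim by (simp add: t_def)
      qed
      moreover have "(\<delta> + t ^ m / \<delta> ^ (m - 1)) / R ^ (2 * m) = \<delta> / R ^ (2 * m) + h x ^ m / \<delta> ^ (m - 1)"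
        using elim by (simp add: t_def power_mult_distrib power_mult[symmetric] add_divide_distrib)
      ultimately show ?thesis using True by simp
    next
      case False
      then show ?thesis using h(1)[of x] \<delta> elim by (auto simp: indicator_def)
    qed
    have vol: "(LBINT (x::'a). indicator (cball 0 R) x) = \<omega> * R ^ (2 * m)"
      using content_cball[of R "0::'a"] elim m by (simp add: \<omega>_def)
    have "(LBINT x. indicator (cball 0 R) x * h x) / R ^ (2 * m - 2) = (LBINT x. indicator (cball 0 R) x * h x / R ^ (2 * m - 2))"
      by simp
    also have "\<dots> \<le> (LBINT x. indicator (cball 0 k) x * h x / R ^ (2 * m - 2)
       + indicator (cball 0 R) x * (\<delta> / R ^ (2 * m)) + indicator (- cball 0 k) x * h x ^ m / \<delta> ^ (m - 1))"
      by (intro integral_mono point Bochner_Integration.integrable_add integrable_divide integrable_mult_left i1 i2 i3)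
    also have "\<dots> = H / R ^ (2 * m - 2) + \<omega> * R ^ (2 * m) * (\<delta> / R ^ (2 * m)) + (LBINT x. indicator (- cball 0 k) x * h x ^ m) / \<delta> ^ (m - 1)"
      using i1 i2 i3 vol by (simp add: H_def)
    also have "\<omega> * R ^ (2 * m) * (\<delta> / R ^ (2 * m)) = e / 3" using elim \<omega> by (simp add: \<delta>_def)
    also have "(LBINT x. indicator (- cball 0 k) x * h x ^ m) / \<delta> ^ (m - 1) < e / 3"
      using k \<delta> by (simp add: pos_divide_less_eq)
    finally have "(LBINT x. indicator (cball 0 R) x * h x) / R ^ (2 * m - 2) < H / R ^ (2 * m - 2) + e / 3 + e / 3" by simp
    then have "(LBINT x. indicator (cball 0 R) x * h x) / R ^ (2 * m - 2) < e" using elim(1) by linarith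
    moreover have "0 \<le> (LBINT x. indicator (cball 0 R) x * h x) / R ^ (2 * m - 2)"
      using elim h(1) by (intro divide_nonneg_nonneg integral_nonneg_AE AE_I2) auto
    ultimately show ?case by simp
  qed
qed

text \<open>The weight has values in [0, 1] on the ball, so a nonnegative upper bound survives the
  averaging. It is applied to the curvature density and, for the two-sided hypothesis, to its
  negative.\<close>

lemma curvature_average_le:
  fixes h k :: "'a::euclidean_space \<Rightarrow> real"
  assumes k: "continuous_on UNIV k" and h: "continuous_on UNIV h" "\<And>x. 0 \<le> h x" "\<And>x. k x \<le> h x" and R: "R > 0"
  shows "(LBINT x. k x * cutoff ((x \<bullet> x) / R\<^sup>2)) \<le> (LBINT x. indicator (cball 0 R) x * h x)"
proof (rule integral_mono)
  have c: "continuous_on UNIV (\<lambda>x::'a. cutoff ((x \<bullet> x) / R\<^sup>2))"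
    using R by (intro continuous_on_compose2[OF trunc_power_continuous[OF trunc_power_cutoff]] continuous_intros) auto
  have out: "cutoff ((x \<bullet> x) / R\<^sup>2) = 0" if "R < norm x" for x :: 'a
  proof -
    have "R\<^sup>2 \<le> x \<bullet> x" using that R power_mono[of R "norm x" 2] by (simp add: power2_norm_eq_inner)
    then show ?thesis using R by (simp add: cutoff_def)
  qed
  show "integrable lborel (\<lambda>x. k x * cutoff ((x \<bullet> x) / R\<^sup>2))"
    by (intro integrable_mult_bounded_support bounded_supportI[of R] out k c)
  show "integrable lborel (\<lambda>x. indicator (cball 0 R) x * h x)"
    by (intro integrable_indicator_continuous h) simp
  show "k x * cutoff ((x \<bullet> x) / R\<^sup>2) \<le> indicator (cball 0 R) x * h x" for x
  proof (cases "x \<in> cball 0 R")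
    case True
    define s where "s = (x \<bullet> x) / R\<^sup>2"
    have "(norm x)\<^sup>2 \<le> R\<^sup>2" using True by (intro power_mono) auto
    then have s: "0 \<le> s" "s \<le> 1" using R by (auto simp: s_def power2_norm_eq_inner)
    then have "0 \<le> cutoff s" "cutoff s \<le> 1" by (auto simp: cutoff_def intro!: mult_le_one power_le_one)
    then have "k x * cutoff s \<le> h x * 1" using h(2,3)[of x] by (intro mult_mono) auto
    then show ?thesis using True by (simp add: s_def)
  next
    case False
    then show ?thesis using out[of x] by simp
  qed
qed

section \<open>Volume and normalization\<close>

text \<open>For \<alpha> = 0 the \<open>blowup\<close> is just the dilated gradient, and
  \<open>\<beta>\<close> is the derivative of the integral \<open>A\<close> of u(R w) over the unit
  ball. A loss of (1/2) ln R in the mean of u costs a factor R^m in the mean of exp(n u), against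
  the factor R^(2m) from the change of variables, so the volume would be at least of order
  R^m.\<close>

lemma infinite_volume:
  fixes u :: "'a::euclidean_space \<Rightarrow> real"
  assumes m: "DIM('a) = 2 * m" "m \<ge> 2" and u: "C1 u"
    and lim: "((\<lambda>R. LBINT w. indicator (cball 0 1) w * (norm (blowup u 0 R w))\<^sup>2) \<longlongrightarrow> 0) at_top"
    and int: "\<And>R. R > 0 \<Longrightarrow> integrable lborel (\<lambda>w. indicator (cball 0 1) w * (norm (blowup u 0 R w))\<^sup>2)"
  shows "\<not> integrable lborel (\<lambda>x. exp (real DIM('a) * u x))"
proof
  assume vol: "integrable lborel (\<lambda>x. exp (real DIM('a) * u x))"
  define \<omega> where "\<omega> = unit_ball_vol (real DIM('a))"
  have \<omega>: "\<omega> > 0" unfolding \<omega>_def by simp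
  have cu: "continuous_on UNIV u" by (rule C1_cont[OF u])
  have cg: "continuous_on UNIV (gradient u)" by (rule continuous_on_gradient[OF u])
  have ii: "integrable lborel (\<lambda>w::'a. indicator (cball 0 1) w :: real)" by (rule integrable_indicator_compact) simp
  have intii: "(LBINT (w::'a). indicator (cball 0 1) w) = \<omega>"
    using content_cball[of 1 "0::'a"] by (simp add: \<omega>_def)
  define \<beta> where "\<beta> r = (LBINT w. indicator (cball 0 1) w * (gradient u (r *\<^sub>R w) \<bullet> w))" for r
  \<comment> \<open>The threshold \<omega>/4 combines with t <= 1/4 + t^2 to a total of \<omega>/2,
    that is, slope 1/2 after division by the volume of the ball.\<close>
  have "\<forall>\<^sub>F R in at_top. (LBINT w. indicator (cball 0 1) w * (norm (blowup u 0 R w))\<^sup>2) < \<omega> / 4"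
    using \<omega> by (intro order_tendstoD(2)[OF lim]) auto
  then obtain S0 where S0: "\<And>R. R \<ge> S0 \<Longrightarrow> (LBINT w. indicator (cball 0 1) w * (norm (blowup u 0 R w))\<^sup>2) < \<omega> / 4"
    unfolding eventually_at_top_linorder by blast
  define S where "S = max 1 S0"
  have S: "S \<ge> 1" "S \<ge> S0" by (auto simp: S_def)
  have \<beta>: "- (\<omega> / 2) / r \<le> \<beta> r" if r: "r \<ge> S" for r
  proof -
    have r0: "r > 0" using r S by simp
    let ?B = "\<lambda>w. norm (blowup u 0 r w)"
    have "- (\<omega> / 2) \<le> - (\<omega> / 4) - (LBINT w. indicator (cball 0 1) w * (?B w)\<^sup>2)"
      using S0[of r] r S by simp
    also have "\<dots> = (LBINT w. - (1/4 * indicator (cball 0 1) w) - indicator (cball 0 1) w * (?B w)\<^sup>2)"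
      using ii int[OF r0] intii by simp
    also have "\<dots> \<le> (LBINT w. r * (indicator (cball 0 1) w * (gradient u (r *\<^sub>R w) \<bullet> w)))"
    proof (intro integral_mono Bochner_Integration.integrable_diff integrable_minus integrable_mult_right ii int r0)
      show "integrable lborel (\<lambda>w. indicator (cball 0 1) w * (gradient u (r *\<^sub>R w) \<bullet> w))"
        by (intro integrable_indicator_continuous continuous_intros continuous_on_compose2[OF cg]) auto
      fix w :: 'a
      show "- (1/4 * indicator (cball 0 1) w) - indicator (cball 0 1) w * (?B w)\<^sup>2 \<le> r * (indicator (cball 0 1) w * (gradient u (r *\<^sub>R w) \<bullet> w))"
      proof (cases "w \<in> cball 0 1")
        case True
        have "\<bar>r * (gradient u (r *\<^sub>R w) \<bullet> w)\<bar> = \<bar>blowup u 0 r w \<bullet> w\<bar>" by (simp add: blowup_def)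
        also have "\<dots> \<le> ?B w * norm w" by (rule Cauchy_Schwarz_ineq2)
        also have "\<dots> \<le> ?B w" using True by (simp add: mult_left_le)
        also have "\<dots> \<le> 1/4 + (?B w)\<^sup>2" using sum_squares_bound[of "?B w" "1/2"] by (simp add: power2_eq_square)
        finally show ?thesis using True by simp
      qed simp
    qed
    also have "\<dots> = \<beta> r * r" unfolding \<beta>_def by (simp only: integral_mult_right_zero mult.commute)
    finally show ?thesis by (rule pos_divide_le_eq[OF r0, THEN iffD2])
  qed
  define A where "A R = (LBINT w. indicator (cball 0 1) w * u (R *\<^sub>R w))" for R
  have iA: "integrable lborel (\<lambda>w. indicator (cball 0 1) w * u (R *\<^sub>R w))" for R
    by (intro integrable_indicator_continuous continuous_on_compose2[OF cu] continuous_intros) auto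
  have A: "A R \<ge> A S - \<omega> / 2 * ln (R / S)" if R: "R \<ge> S" for R
  proof -
    have "A R - A S = (LBINT w. indicator (cball 0 1) w * u (R *\<^sub>R w) - indicator (cball 0 1) w * u (S *\<^sub>R w))"
      unfolding A_def using iA by simp
    also have "\<dots> = (LBINT w. (LBINT r. indicator {S..R} r *\<^sub>R (indicator (cball 0 1) w * (gradient u (r *\<^sub>R w) \<bullet> w))))"
    proof (intro Bochner_Integration.integral_cong refl)
      fix w :: 'a
      have "(LBINT r. indicator {S..R} r *\<^sub>R (indicator (cball 0 1) w * (gradient u (r *\<^sub>R w) \<bullet> w)))
         = indicator (cball 0 1) w * u (R *\<^sub>R w) - indicator (cball 0 1) w * u (S *\<^sub>R w)"
      proof (rule integral_FTC_atLeastAtMost[OF R])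
        fix r
        have "((\<lambda>r. indicator (cball 0 1) w * u (0 + r *\<^sub>R w)) has_real_derivative indicator (cball 0 1) w * (gradient u (0 + r *\<^sub>R w) \<bullet> w)) (at r)"
          by (intro DERIV_cmult has_real_derivative_line u)
        then show "((\<lambda>r. indicator (cball 0 1) w * u (r *\<^sub>R w)) has_vector_derivative indicator (cball 0 1) w * (gradient u (r *\<^sub>R w) \<bullet> w)) (at r within {S..R})"
          by (simp add: has_real_derivative_iff_has_vector_derivative has_vector_derivative_at_within)
      next
        show "continuous_on {S..R} (\<lambda>r. indicator (cball 0 1) w * (gradient u (r *\<^sub>R w) \<bullet> w))"
          by (intro continuous_intros continuous_on_compose2[OF cg]) auto
      qed
      then show "indicator (cball 0 1) w * u (R *\<^sub>R w) - indicator (cball 0 1) w * u (S *\<^sub>R w)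
         = (LBINT r. indicator {S..R} r *\<^sub>R (indicator (cball 0 1) w * (gradient u (r *\<^sub>R w) \<bullet> w)))" by simp
    qed
    also have "\<dots> = (LBINT r. indicator {S..R} r *\<^sub>R \<beta> r)"
      unfolding \<beta>_def
    proof (rule fubini_compact)
      have "continuous_on (cball 0 1 \<times> {S..R}) (\<lambda>z. gradient u (snd z *\<^sub>R fst z) \<bullet> fst z)"
        by (intro continuous_intros continuous_on_compose2[OF cg]) auto
      then show "continuous_on (cball 0 1 \<times> {S..R}) (\<lambda>(w, r). indicator (cball 0 1) w * (gradient u (r *\<^sub>R w) \<bullet> w))"
        by (rule continuous_on_eq) auto
    qed auto
    also have "\<dots> \<ge> - (\<omega> / 2) * ln (R / S)"
    proof -
      have S0: "S > 0" using S by simp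
      have "(LBINT r. indicator {S..R} r *\<^sub>R (- (\<omega> / 2) / r)) = - (\<omega> / 2) * ln R - - (\<omega> / 2) * ln S"
      proof (rule integral_FTC_atLeastAtMost[OF R])
        fix r assume "S \<le> r"
        then have "r > 0" using S0 by simp
        then have "((\<lambda>r. - (\<omega> / 2) * ln r) has_real_derivative - (\<omega> / 2) * (1 / r)) (at r)"
          by (intro DERIV_cmult) (auto intro!: derivative_eq_intros)
        then show "((\<lambda>r. - (\<omega> / 2) * ln r) has_vector_derivative - (\<omega> / 2) / r) (at r within {S..R})"
          by (simp add: has_real_derivative_iff_has_vector_derivative has_vector_derivative_at_within)
      next
        show "continuous_on {S..R} (\<lambda>r. - (\<omega> / 2) / r)" using S0 by (intro continuous_intros) auto
      qed
      then have ln: "(LBINT r. indicator {S..R} r *\<^sub>R (- (\<omega> / 2) / r)) = - (\<omega> / 2) * ln (R / S)"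
        using S0 R by (simp add: ln_div right_diff_distrib)
      show ?thesis
      proof (cases "integrable lborel (\<lambda>r. indicator {S..R} r *\<^sub>R \<beta> r)")
        case True
        have "(LBINT r. indicator {S..R} r *\<^sub>R (- (\<omega> / 2) / r)) \<le> (LBINT r. indicator {S..R} r *\<^sub>R \<beta> r)"
        proof (rule integral_mono[OF _ True])
          show "integrable lborel (\<lambda>r. indicator {S..R} r *\<^sub>R (- (\<omega> / 2) / r))"
            using S0 by (intro borel_integrable_compact continuous_intros) auto
          show "indicator {S..R} r *\<^sub>R (- (\<omega> / 2) / r) \<le> indicator {S..R} r *\<^sub>R \<beta> r" for r
            using \<beta>[of r] by (simp add: indicator_def)
        qed
        then show ?thesis using ln by simp
      next
        case False
        \<comment> \<open>The integral is then \<open>0\<close> by convention and the bound is trivial.\<close>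
        have "0 \<le> ln (R / S)" using R S0 by simp
        then show ?thesis using \<omega> not_integrable_integral_eq[OF False] by simp
      qed
    qed
    finally show ?thesis by simp
  qed
  define V where "V = (LBINT x. exp (real DIM('a) * u x))"
  define a where "a = exp (real DIM('a) * A S / \<omega>)"
  have V: "\<omega> * a * S ^ m * R \<le> V" if R: "R \<ge> S" for R
  proof -
    have R0: "R > 0" "R \<ge> 1" using R S by auto
    define p where "p = real DIM('a) * A R / \<omega>"
    have ce: "continuous_on UNIV (\<lambda>x. exp (real DIM('a) * u x))" using cu by (intro continuous_intros)
    have ie: "integrable lborel (\<lambda>w. exp (real DIM('a) * u (0 + R *\<^sub>R w)))"
      using lborel_scale(1)[OF R0(1) cont_borel_measurable[OF ce], of 0] vol by simp
    \<comment> \<open>Jensen's inequality through the tangent line of exp at \<open>p\<close>,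
      integrated over the unit ball; outside it the lower bound is 0.\<close>
    have "\<omega> * exp p = exp p * (\<omega> - p * \<omega> + real DIM('a) * A R)" using \<omega> by (simp add: p_def)
    also have "\<dots> = exp p * (LBINT w. (indicator (cball 0 1) w - p * indicator (cball 0 1) w) + real DIM('a) * (indicator (cball 0 1) w * u (R *\<^sub>R w)))"
      using ii iA intii by (simp add: A_def)
    also have "\<dots> = (LBINT w. exp p * ((indicator (cball 0 1) w - p * indicator (cball 0 1) w) + real DIM('a) * (indicator (cball 0 1) w * u (R *\<^sub>R w))))"
      by (rule integral_mult_right_zero[symmetric])
    also have "\<dots> \<le> (LBINT w. exp (real DIM('a) * u (0 + R *\<^sub>R w)))"
    proof (intro integral_mono integrable_mult_right Bochner_Integration.integrable_add Bochner_Integration.integrable_diff ii iA ie)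
      fix w :: 'a
      show "exp p * ((indicator (cball 0 1) w - p * indicator (cball 0 1) w) + real DIM('a) * (indicator (cball 0 1) w * u (R *\<^sub>R w)))
        \<le> exp (real DIM('a) * u (0 + R *\<^sub>R w))"
      proof (cases "w \<in> cball 0 1")
        case True
        have "exp p * (1 + (real DIM('a) * u (R *\<^sub>R w) - p)) \<le> exp p * exp (real DIM('a) * u (R *\<^sub>R w) - p)"
          by (intro mult_left_mono exp_ge_add_one_self) auto
        also have "\<dots> = exp (real DIM('a) * u (R *\<^sub>R w))" by (simp add: exp_add[symmetric])
        finally show ?thesis using True by (simp add: algebra_simps)
      qed simp
    qed
    finally have 1: "\<omega> * exp p \<le> (LBINT w. exp (real DIM('a) * u (0 + R *\<^sub>R w)))" .
    have "V = R ^ DIM('a) * (LBINT w. exp (real DIM('a) * u (0 + R *\<^sub>R w)))"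
      unfolding V_def by (rule lborel_scale(2)[OF R0(1) cont_borel_measurable[OF ce]])
    also have "\<dots> \<ge> R ^ (2 * m) * (\<omega> * exp p)"
      using 1 R0 m \<omega> by (intro mult_mono) auto
    finally have 2: "R ^ (2 * m) * (\<omega> * exp p) \<le> V" .
    have "real DIM('a) * A S / \<omega> - real m * ln (R / S) \<le> p"
    proof -
      have "real DIM('a) * (A S - \<omega> / 2 * ln (R / S)) / \<omega> \<le> p"
        unfolding p_def using A[OF R] \<omega> by (intro divide_right_mono mult_left_mono) auto
      also have "real DIM('a) * (A S - \<omega> / 2 * ln (R / S)) / \<omega> = real DIM('a) * A S / \<omega> - real m * ln (R / S)"
        using \<omega> m(1) by (simp add: field_simps)
      finally show ?thesis .
    qed
    then have "exp (real DIM('a) * A S / \<omega> - real m * ln (R / S)) \<le> exp p" by simp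
    moreover have "exp (real DIM('a) * A S / \<omega> - real m * ln (R / S)) = a * (S / R) ^ m"
    proof -
      have "exp (- (real m * ln (R / S))) = (S / R) ^ m"
        using R0 S by (simp add: exp_minus exp_of_nat_mult[of m] power_inverse[symmetric] del: power_divide)
      then show ?thesis by (simp add: a_def exp_diff exp_minus divide_inverse)
    qed
    ultimately have "R ^ (2 * m) * (\<omega> * (a * (S / R) ^ m)) \<le> R ^ (2 * m) * (\<omega> * exp p)"
      using \<omega> R0 by (intro mult_left_mono) auto
    moreover have "R ^ (2 * m) * (\<omega> * (a * (S / R) ^ m)) = \<omega> * a * S ^ m * R ^ m"
      using R0 by (simp add: power_divide mult_2 power_add)
    moreover have "\<omega> * a * S ^ m * R \<le> \<omega> * a * S ^ m * R ^ m"
      using \<omega> S R0 m power_increasing[of 1 m R] by (intro mult_left_mono) (auto simp: a_def)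
    ultimately show ?thesis using 2 by linarith
  qed
  define q where "q = \<omega> * a * S ^ m"
  have q: "q > 0" using \<omega> S by (simp add: q_def a_def)
  \<comment> \<open>At this radius the linear lower bound is at least V + q.\<close>
  have "q * max S (V / q + 1) \<le> V" using V[of "max S (V / q + 1)"] by (simp add: q_def)
  moreover have "q * (V / q + 1) \<le> q * max S (V / q + 1)" using q by (intro mult_left_mono) auto
  moreover have "q * (V / q + 1) = V + q" using q by (simp add: distrib_left)
  ultimately show False using q by simp
qed

text \<open>Legendre's duplication formula at the positive integers, Gamma(m) Gamma(m + 1/2) =
  2^(1-2m) sqrt(pi) Gamma(2m), with factorials for the integer arguments.\<close>

lemma Gamma_half_integer:
  assumes "m \<ge> 1"
  shows "fact (m - 1) * Gamma (real m + 1 / 2) * 4 ^ m = 2 * sqrt pi * fact (2 * m - 1)"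
  using assms
proof (induction m rule: dec_induct)
  case base
  have "Gamma (1 / 2 + 1) = 1 / 2 * Gamma (1 / 2 :: real)" by (rule Gamma_plus1) (auto dest: nonpos_Ints_nonpos)
  then show ?case by (simp add: Gamma_one_half_real)
next
  case (step m)
  obtain k where k: "m = Suc k" using step.hyps by (cases m) auto
  have "real m + 1 / 2 \<notin> \<int>\<^sub>\<le>\<^sub>0" by (auto dest: nonpos_Ints_nonpos)
  then have "Gamma (real m + 1 / 2 + 1) = (real m + 1 / 2) * Gamma (real m + 1 / 2)" by (rule Gamma_plus1)
  then have "fact m * Gamma (real (Suc m) + 1 / 2) * 4 ^ Suc m
     = real m * (real m + 1 / 2) * 4 * (fact (m - 1) * Gamma (real m + 1 / 2) * 4 ^ m)"
    by (simp add: k add_ac)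
  also have "\<dots> = real m * (real m + 1 / 2) * 4 * (2 * sqrt pi * fact (2 * m - 1))" unfolding step.IH ..
  also have "real m * (real m + 1 / 2) * 4 = (2 * real m + 1) * (2 * real m)" by (simp add: algebra_simps)
  also have "(2 * real m + 1) * (2 * real m) * (2 * sqrt pi * fact (2 * m - 1)) = 2 * sqrt pi * fact (2 * Suc m - 1)"
    by (simp add: k algebra_simps)
  finally show ?case by simp
qed

text \<open>Duplication removes the half-integer Gamma value from |S^n|. This identifies the mass of
  the profile with the constant of the theorem, so that total curvature (n-1)! |S^n| means \<alpha>
  = 2.\<close>

lemma unit_sphere_volume_even:
  assumes "CARD('n::finite) = 2 * m" "m \<ge> 1"
  shows "fact (2 * m - 1) * unit_sphere_volume TYPE('n) = (4 * pi) ^ m * fact (m - 1)"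
proof -
  define G where "G = Gamma (real m + 1 / 2)"
  have Gpos: "G > 0" unfolding G_def by (intro Gamma_real_pos) auto
  have dup: "fact (m - 1) * G * 4 ^ m = 2 * sqrt pi * fact (2 * m - 1)"
    unfolding G_def by (rule Gamma_half_integer[OF assms(2)])
  have "pi powr (real m + 1 / 2) = pi ^ m * sqrt pi"
    by (simp add: powr_add powr_realpow powr_half_sqrt)
  then have "unit_sphere_volume TYPE('n) = 2 * (pi ^ m * sqrt pi) / G"
    unfolding unit_sphere_volume_eq G_def using assms by (simp add: add_divide_distrib)
  then have "fact (2 * m - 1) * unit_sphere_volume TYPE('n) = pi ^ m * (2 * sqrt pi * fact (2 * m - 1)) / G"
    by simp
  also have "\<dots> = pi ^ m * (fact (m - 1) * G * 4 ^ m) / G" unfolding dup ..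
  finally show ?thesis using Gpos by (simp add: power_mult_distrib mult_ac)
qed

section \<open>From averages of the curvature to the total Q-curvature\<close>

lemma curvature_density_continuous:
  assumes "smooth u"
  shows "continuous_on UNIV (\<lambda>x. laplacian u x + c * (norm (gradient u x))\<^sup>2)"
proof -
  have "continuous_on UNIV (\<lambda>x. - neg_laplacian u x + c * (norm (gradient u x))\<^sup>2)"
    by (intro continuous_intros continuous_on_gradient smooth_C1 C1_cont smooth_neg_laplacian assms)
  then show ?thesis by (simp add: neg_laplacian_def)
qed

text \<open>\<open>h\<close> is the positive part of the curvature density in part (1) and its
  absolute value in part (2). The energy growth and the representation rest on the upper bound alone
  and are therefore shared; a matching lower bound reverses the inequality for the limit of the
  averages.\<close>

lemma normalized_total_curvature:
  fixes u h :: "'a::euclidean_space \<Rightarrow> real"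
  assumes m: "DIM('a) = 2 * m" "m \<ge> 2" and u: "smooth u"
    and f: "integrable lborel ((neg_laplacian ^^ m) u)"
    and h: "continuous_on UNIV h" "\<And>x. 0 \<le> h x" "integrable lborel (\<lambda>x. h x ^ m)"
    and le: "\<And>x. laplacian u x + (real m - 1) * (norm (gradient u x))\<^sup>2 \<le> h x"
  defines "\<alpha> \<equiv> 2 / ((4 * pi) ^ m * fact (m - 1)) * (LBINT x. (neg_laplacian ^^ m) u x)"
  shows "\<alpha>\<^sup>2 - 2 * \<alpha> \<le> 0"
    and "(\<And>x. - h x \<le> laplacian u x + (real m - 1) * (norm (gradient u x))\<^sup>2) \<Longrightarrow> \<alpha>\<^sup>2 - 2 * \<alpha> = 0"
    and "integrable lborel (\<lambda>x. exp (real DIM('a) * u x)) \<Longrightarrow> \<alpha> \<noteq> 0"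
proof -
  define \<gamma> :: real where "\<gamma> = (4 * pi) ^ m * fact (m - 1)"
  have \<gamma>: "\<gamma> > 0" by (simp add: \<gamma>_def)
  define g where "g = (neg_laplacian ^^ m) u"
  define k where "k x = laplacian u x + (real m - 1) * (norm (gradient u x))\<^sup>2" for x
  have cg: "continuous_on UNIV g" unfolding g_def by (intro C1_cont smooth_C1 smooth_neg_laplacian_pow u)
  have ig: "integrable lborel g" using f by (simp add: g_def)
  have n2: "(real DIM('a) - 2) / 2 = real m - 1" using m by (simp add: field_simps)
  have n4: "DIM('a) \<ge> 4" using m by simp
  have growth: "(LBINT x. indicator (cball 0 R) x * (norm (gradient u x))\<^sup>2)
      \<le> 4 * (3 * 4 ^ m * unit_ball_vol DIM('a) + (LBINT x. h x ^ m)) * R ^ (2 * m - 2)" if "R \<ge> 1" for R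
    by (rule gradient_energy_growth[OF m u h(2,3) _ that]) (simp only: n2 le)
  have rep: "partial_deriv b u x = 2 / \<gamma> * (LBINT y. g y * (((y - x) \<bullet> b) / ((y - x) \<bullet> (y - x))))" if b: "b \<in> Basis" for b x
  proof -
    have "\<gamma> * partial_deriv b u x = 2 * (LBINT y. g y * (((y - x) \<bullet> b) / ((y - x) \<bullet> (y - x))))"
      unfolding \<gamma>_def g_def by (rule gradient_representation[OF m u b f growth])
    then have "\<gamma> * partial_deriv b u x / \<gamma> = 2 / \<gamma> * (LBINT y. g y * (((y - x) \<bullet> b) / ((y - x) \<bullet> (y - x))))"
      by (simp only: times_divide_eq_left)
    then show ?thesis using \<gamma> by simp
  qed
  define J where "J = (LBINT (x::'a). radial 0 cutoff_quot x)"
  have J: "(real m - 1) * J > 0" unfolding J_def using m(2) by (intro mult_pos_pos integral_cutoff_quot_pos) simp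
  have \<alpha>: "\<alpha> = 2 / \<gamma> * (LBINT y. g y)" by (simp add: \<alpha>_def \<gamma>_def g_def)
  note lim = curvature_average_limit[OF m cg ig rep u, folded \<alpha> J_def k_def]
  note tail = scaled_average_tendsto_0[OF m h]
  have ck: "continuous_on UNIV k" unfolding k_def by (rule curvature_density_continuous[OF u])
  have "(real m - 1) * J * (\<alpha>\<^sup>2 - 2 * \<alpha>) \<le> 0"
  proof (rule tendsto_le[OF trivial_limit_at_top_linorder tail lim])
    show "\<forall>\<^sub>F R in at_top. (LBINT x. k x * cutoff ((x \<bullet> x) / R\<^sup>2)) / R ^ (2 * m - 2)
        \<le> (LBINT x. indicator (cball 0 R) x * h x) / R ^ (2 * m - 2)"
      using eventually_gt_at_top[of 0]
    proof eventually_elim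
      case (elim R)
      then show ?case
        using curvature_average_le[OF ck h(1,2) le[folded k_def]] by (intro divide_right_mono) auto
    qed
  qed
  then have "(real m - 1) * J * (\<alpha>\<^sup>2 - 2 * \<alpha>) \<le> (real m - 1) * J * 0" by (simp only: mult_zero_right)
  then show nonpos: "\<alpha>\<^sup>2 - 2 * \<alpha> \<le> 0" by (simp only: mult_le_cancel_left_pos[OF J])
  show "\<alpha>\<^sup>2 - 2 * \<alpha> = 0" if ge: "\<And>x. - h x \<le> laplacian u x + (real m - 1) * (norm (gradient u x))\<^sup>2"
  proof -
    have "(real m - 1) * J * (\<alpha>\<^sup>2 - 2 * \<alpha>) \<ge> - 0"
    proof (rule tendsto_le[OF trivial_limit_at_top_linorder lim tendsto_minus[OF tail]])
      show "\<forall>\<^sub>F R in at_top. - ((LBINT x. indicator (cball 0 R) x * h x) / R ^ (2 * m - 2))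
          \<le> (LBINT x. k x * cutoff ((x \<bullet> x) / R\<^sup>2)) / R ^ (2 * m - 2)"
        using eventually_gt_at_top[of 0]
      proof eventually_elim
        case (elim R)
        have "- k x \<le> h x" for x using ge[of x] by (simp add: k_def)
        then have "(LBINT x. - k x * cutoff ((x \<bullet> x) / R\<^sup>2)) \<le> (LBINT x. indicator (cball 0 R) x * h x)"
          using ck by (intro curvature_average_le h elim continuous_on_minus)
        then have "- (LBINT x. indicator (cball 0 R) x * h x) \<le> (LBINT x. k x * cutoff ((x \<bullet> x) / R\<^sup>2))" by simp
        from divide_right_mono[OF this, of "R ^ (2 * m - 2)"] show ?case using elim by simp
      qed
    qed
    then have "(real m - 1) * J * 0 \<le> (real m - 1) * J * (\<alpha>\<^sup>2 - 2 * \<alpha>)" by (simp only: mult_zero_right minus_zero)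
    then have "\<alpha>\<^sup>2 - 2 * \<alpha> \<ge> 0" by (simp only: mult_le_cancel_left_pos[OF J])
    with nonpos show ?thesis by simp
  qed
  show "\<alpha> \<noteq> 0" if "integrable lborel (\<lambda>x. exp (real DIM('a) * u x))"
  proof
    assume "\<alpha> = 0"
    note C1u = smooth_C1[OF u]
    have "\<not> integrable lborel (\<lambda>x. exp (real DIM('a) * u x))"
      by (rule infinite_volume[OF m C1u blowup_tendsto_L2[OF n4 cg ig rep C1u, folded \<alpha>, unfolded \<open>\<alpha> = 0\<close>]
            blowup_L2_bound(1)[OF n4 cg ig rep C1u, folded \<alpha>, unfolded \<open>\<alpha> = 0\<close>]])
    with that show False by contradiction
  qed
qed

theorem theorem1p14:
  fixes u Q :: "real ^ 'n \<Rightarrow> real"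
  assumes "CARD('n) \<ge> 4" and "even CARD('n)"
    and "smooth u"
    and "is_Q_curvature u Q"
    and "integrable lborel (\<lambda>x. Q x * exp (real CARD('n) * u x))"
  shows
    "((\<integral>\<^sup>+x. ennreal ((max (- scalar_curvature u x) 0) ^ (CARD('n) div 2) *
              exp (real CARD('n) * u x)) \<partial>lborel) < \<infinity> \<longrightarrow>
        0 \<le> (LINT x|lborel. Q x * exp (real CARD('n) * u x)) \<and>
        (LINT x|lborel. Q x * exp (real CARD('n) * u x))
          \<le> fact (CARD('n) - 1) * unit_sphere_volume TYPE('n)) \<and>
     ((\<integral>\<^sup>+x. ennreal (\<bar>scalar_curvature u x\<bar> ^ (CARD('n) div 2) *
              exp (real CARD('n) * u x)) \<partial>lborel) < \<infinity> \<longrightarrow>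
        ((LINT x|lborel. Q x * exp (real CARD('n) * u x)) = 0 \<or>
         (LINT x|lborel. Q x * exp (real CARD('n) * u x))
           = fact (CARD('n) - 1) * unit_sphere_volume TYPE('n)) \<and>
        (integrable lborel (\<lambda>x. exp (real CARD('n) * u x)) \<longrightarrow>
         (LINT x|lborel. Q x * exp (real CARD('n) * u x))
           = fact (CARD('n) - 1) * unit_sphere_volume TYPE('n)))"
proof -
  define m where "m = CARD('n) div 2"
  have m: "DIM(real ^ 'n) = 2 * m" "m \<ge> 2" and n: "CARD('n) = 2 * m"
    using assms(1,2) by (auto simp: m_def)
  define f where "f = (neg_laplacian ^^ m) u"
  define k where "k x = laplacian u x + (real m - 1) * (norm (gradient u x))\<^sup>2" for x
  define \<Gamma> where "\<Gamma> = fact (CARD('n) - 1) * unit_sphere_volume TYPE('n)"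
  have \<Gamma>: "\<Gamma> = (4 * pi) ^ m * fact (m - 1)" "\<Gamma> > 0"
    using unit_sphere_volume_even[OF n] m(2) by (simp_all add: \<Gamma>_def n)
  have Q: "Q x * exp (real CARD('n) * u x) = f x" for x
    using assms(4) n by (simp add: is_Q_curvature_def f_def)
  have intf: "integrable lborel f" using assms(5) unfolding Q .
  define I where "I = (LBINT x. f x)"
  \<comment> \<open>With this normalisation I = 0 and I = \<Gamma> are the two roots \<alpha> = 0
    and \<alpha> = 2.\<close>
  define \<alpha> where "\<alpha> = 2 / \<Gamma> * I"
  have I\<alpha>: "I = \<Gamma> * \<alpha> / 2" using \<Gamma>(2) by (simp add: \<alpha>_def)
  have ck: "continuous_on UNIV k" unfolding k_def by (rule curvature_density_continuous[OF assms(3)])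
  have R: "scalar_curvature u x = - (2 * (real CARD('n) - 1) * exp (- 2 * u x) * k x)" for x
    using n by (simp add: scalar_curvature_def k_def field_simps)
  define c where "c = (2 * (real CARD('n) - 1)) ^ m"
  have c: "c > 0" using assms(1) by (simp add: c_def)
  \<comment> \<open>Conformal invariance of the L^(n/2) norm of the scalar curvature: exp(-2u)^m
    cancels exp(nu) because n = 2m.\<close>
  have scale: "(2 * (real CARD('n) - 1) * exp (- 2 * u x) * t) ^ m * exp (real CARD('n) * u x) = c * t ^ m" for x t
  proof -
    have "exp (- 2 * u x) ^ m * exp (real CARD('n) * u x) = 1"
      by (simp add: n exp_of_nat_mult[symmetric] exp_add[symmetric])
    then show ?thesis by (simp add: power_mult_distrib c_def mult_ac)
  qed
  have int: "integrable lborel (\<lambda>x. h x ^ m)"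
    if "continuous_on UNIV h" "\<And>x. 0 \<le> h x" "(\<integral>\<^sup>+x. ennreal (c * h x ^ m) \<partial>lborel) < \<infinity>" for h :: "real ^ 'n \<Rightarrow> real"
  proof -
    have "continuous_on UNIV (\<lambda>x. c * h x ^ m)" using that(1) by (intro continuous_intros)
    then have "(\<lambda>x. c * h x ^ m) \<in> borel_measurable lborel" using cont_borel_measurable by simp
    then have "integrable lborel (\<lambda>x. c * h x ^ m)"
      using that c by (intro integrableI_nonneg) auto
    then show ?thesis using c by simp
  qed
  \<comment> \<open>The scalar curvature is a negative multiple of \<open>k\<close>, so its negative
    part corresponds to the positive part of \<open>k\<close>.\<close>
  have neg: "max (- scalar_curvature u x) 0 ^ m * exp (real CARD('n) * u x) = c * max (k x) 0 ^ m" for x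
  proof -
    have "max (- scalar_curvature u x) 0 = 2 * (real CARD('n) - 1) * exp (- 2 * u x) * max (k x) 0"
      using assms(1) unfolding R by (auto simp: max_def mult_le_0_iff zero_le_mult_iff)
    then show ?thesis by (simp only: scale)
  qed
  have abs: "\<bar>scalar_curvature u x\<bar> ^ m * exp (real CARD('n) * u x) = c * \<bar>k x\<bar> ^ m" for x
  proof -
    have "\<bar>scalar_curvature u x\<bar> = 2 * (real CARD('n) - 1) * exp (- 2 * u x) * \<bar>k x\<bar>"
      using assms(1) unfolding R by (simp add: abs_mult)
    then show ?thesis by (simp only: scale)
  qed
  note total = normalized_total_curvature[OF m assms(3) intf[unfolded f_def], folded \<Gamma>(1) f_def k_def, folded I_def, folded \<alpha>_def]
  have 1: "0 \<le> I \<and> I \<le> \<Gamma>" if "(\<integral>\<^sup>+x. ennreal (c * max (k x) 0 ^ m) \<partial>lborel) < \<infinity>"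
  proof -
    have "continuous_on UNIV (\<lambda>x. max (k x) 0)" using ck by (intro continuous_intros)
    from total(1)[OF this _ int[OF this _ that]] have "\<alpha> * (\<alpha> - 2) \<le> 0"
      by (simp add: power2_eq_square algebra_simps)
    then have "0 \<le> \<alpha>" "\<alpha> \<le> 2" by (auto simp: mult_le_0_iff)
    then show ?thesis using \<Gamma>(2) by (simp add: I\<alpha>)
  qed
  have 2: "(I = 0 \<or> I = \<Gamma>) \<and> (integrable lborel (\<lambda>x. exp (real CARD('n) * u x)) \<longrightarrow> I = \<Gamma>)"
    if "(\<integral>\<^sup>+x. ennreal (c * \<bar>k x\<bar> ^ m) \<partial>lborel) < \<infinity>"
  proof -
    have cont: "continuous_on UNIV (\<lambda>x. \<bar>k x\<bar>)" using ck by (intro continuous_intros)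
    note t = total[OF cont _ int[OF cont _ that]]
    have "\<alpha> * (\<alpha> - 2) = 0" using t(2) by (simp add: power2_eq_square algebra_simps)
    then have "\<alpha> = 0 \<or> \<alpha> = 2" by simp
    moreover have "\<alpha> \<noteq> 0" if "integrable lborel (\<lambda>x. exp (real CARD('n) * u x))"
      using t(3) that by simp
    ultimately show ?thesis by (auto simp: I\<alpha>)
  qed
  show ?thesis
    using 1 2 unfolding Q neg[unfolded m_def] abs[unfolded m_def] I_def \<Gamma>_def by (simp add: m_def)
qed

end
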